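(* Let $\Delta \geq 6$ be an integer and let $G$ be a graph with maximum degree $\Delta$ and clique number at most $\Delta-1$. Then the fractional chromatic number of $G$ satisfies $$\chi_f(G)\ \leq\ \Delta - \min\left\{\tfrac 12,\ \tilde y(\Delta)\,\mu(\Delta)\right\},$$ where $\mu(\Delta)$ and $\tilde y(\Delta)$ are the quantities defined in the context.
   Context: Throughout, $\omega := \Delta-1$. For $0 \le d \le \Delta$ define $$p(\Delta,d) = \frac{\sum_{i=0}^{3}\tfrac14 \Pr\left(\mathrm{Bin}(d,\tfrac{4}{\omega}) \le i\right)}{(\Delta-d)+1},$$ where $\mathrm{Bin}(d,q)$ is a binomial random variable with $d$ trials and success probability $q$. For $0\le k\le \Delta$ let $\mu_k(\Delta)=\min_{0\le d\le k} p(\Delta,d)$ and $\mu(\Delta)=\mu_\Delta(\Delta)$. For $1\le k\le 3$ let $\tilde y_k(\Delta)$ be the maximum value of $y$ such that $(1+\mu(\Delta))y \le \tfrac12(\Delta-1-k) + \left(\tfrac12+\tfrac12 k\mu(\Delta)\right)y$; for $4\le k\le \Delta-2$ let $\tilde y_k(\Delta)$ be the maximum value of $y$ such that $(1+\mu(\Delta))y \le \tfrac12(\Delta-1-k) + \left(\tfrac12+\tfrac12 k\mu_{\Delta+1-k}(\Delta)\right)y$. Finally let $\tilde y(\Delta) = \min\left\{\min_{1\le k\le \Delta-2}\tilde y_k(\Delta),\ \omega,\ \frac{\omega-3}{1-3\mu(\Delta)}\right\}$. The fractional chromatic number $\chi_f(G)$ is the minimum total weight of a nonnegative weighting of the stable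 sets of $G$ such that every vertex lies in stable sets of total weight at least $1$. *)

theory Defs
  imports "HOL-Probability.Probability" "HOL-Library.Ramsey"
begin

section \<open>Finite simple graphs\<close>

text \<open>The set \<open>[V]\<^bsup>2\<^esup>\<close> of two-element subsets, and the predicates \<^const>\<open>clique\<close> and
  \<^const>\<open>indep\<close>, come from \<^theory>\<open>HOL-Library.Ramsey\<close>.\<close>

definition simple_graph :: "'a set \<Rightarrow> 'a set set \<Rightarrow> bool" where
  "simple_graph V E \<longleftrightarrow> finite V \<and> E \<subseteq> [V]\<^bsup>2\<^esup>"

definition vertex_degree :: "'a set set \<Rightarrow> 'a \<Rightarrow> nat" where
  "vertex_degree E v = card {u. {v, u} \<in> E}"

text \<open>The inserted \<open>0\<close> only matters for the graph without vertices.\<close>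

definition max_degree :: "'a set \<Rightarrow> 'a set set \<Rightarrow> nat" where
  "max_degree V E = Max (insert 0 (vertex_degree E ` V))"

definition clique_number :: "'a set \<Rightarrow> 'a set set \<Rightarrow> nat" where
  "clique_number V E = Max (card ` {K. K \<subseteq> V \<and> clique K E})"

definition stable_sets :: "'a set \<Rightarrow> 'a set set \<Rightarrow> 'a set set" where
  "stable_sets V E = {S. S \<subseteq> V \<and> indep S E}"

definition fractional_colouring :: "'a set \<Rightarrow> 'a set set \<Rightarrow> ('a set \<Rightarrow> real) \<Rightarrow> bool" where
  "fractional_colouring V E w \<longleftrightarrow>
     (\<forall>S\<in>stable_sets V E. 0 \<le> w S) \<and>
     (\<forall>v\<in>V. 1 \<le> (\<Sum>S\<in>{S \<in> stable_sets V E. v \<in> S}. w S))"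

definition total_weight :: "'a set \<Rightarrow> 'a set set \<Rightarrow> ('a set \<Rightarrow> real) \<Rightarrow> real" where
  "total_weight V E w = (\<Sum>S\<in>stable_sets V E. w S)"

text \<open>For a finite graph the infimum is a minimum: see
  \<open>fractional_chromatic_number_attained\<close> below.\<close>

definition fractional_chromatic_number :: "'a set \<Rightarrow> 'a set set \<Rightarrow> real" where
  "fractional_chromatic_number V E = Inf (total_weight V E ` {w. fractional_colouring V E w})"

lemma finite_stable_sets: "simple_graph V E \<Longrightarrow> finite (stable_sets V E)"
  unfolding simple_graph_def stable_sets_def
  by (rule finite_subset[of _ "Pow V"]) auto

lemma singleton_stable: "v \<in> V \<Longrightarrow> {v} \<in> stable_sets V E"
  by (auto simp: stable_sets_def indep_def)

lemma fractional_colouring_singletons: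
  assumes "simple_graph V E"
  shows "fractional_colouring V E (\<lambda>S. if card S = 1 then 1 else 0)"
  unfolding fractional_colouring_def
proof (intro conjI ballI)
  fix v assume v: "v \<in> V"
  let ?A = "{S \<in> stable_sets V E. v \<in> S}"
  let ?w = "\<lambda>S :: 'a set. if card S = 1 then 1 else (0::real)"
  have "finite ?A" using finite_stable_sets[OF assms] by auto
  moreover have "{v} \<in> ?A" using singleton_stable[OF v] by auto
  ultimately have "?w {v} \<le> (\<Sum>S\<in>?A. ?w S)"
    by (intro member_le_sum) auto
  then show "1 \<le> (\<Sum>S\<in>?A. ?w S)" by simp
qed auto

lemma fractional_chromatic_number_attained:
  assumes G: "simple_graph V E"
  shows "\<exists>w. fractional_colouring V E w \<and>
             total_weight V E w = fractional_chromatic_number V E \<and>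
             (\<forall>w'. fractional_colouring V E w' \<longrightarrow> total_weight V E w \<le> total_weight V E w')"
proof -
  let ?T = "stable_sets V E"
  let ?s = "\<lambda>S :: 'a set. if card S = 1 then 1 else (0::real)"
  define M where "M = total_weight V E ?s"
  have fin: "finite ?T" by (rule finite_stable_sets[OF G])
  have M0: "0 \<le> M" unfolding M_def total_weight_def by (rule sum_nonneg) auto
  define B where "B = (\<Pi>\<^sub>E S\<in>UNIV. if S \<in> ?T then {0..M} else {0::real})"
  define F where "F = B \<inter> (\<Inter>v\<in>V. {w. 1 \<le> (\<Sum>S\<in>{S \<in> ?T. v \<in> S}. w S)})"
  have "compactin (product_topology (\<lambda>i. euclidean) UNIV) B"
    unfolding B_def by (subst compactin_PiE) auto
  then have "compact B" by (simp add: euclidean_product_topology)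
  moreover have cont: "continuous_on UNIV (\<lambda>w :: 'a set \<Rightarrow> real. \<Sum>S\<in>A. w S)" for A
    by (intro continuous_on_sum continuous_on_product_coordinates)
  then have "closed {w :: 'a set \<Rightarrow> real. 1 \<le> (\<Sum>S\<in>A. w S)}" for A
    by (intro closed_Collect_le) auto
  ultimately have "compact F"
    unfolding F_def by (intro compact_Int_closed closed_INT) auto
  then have cF: "compact (total_weight V E ` F)"
    unfolding total_weight_def
    by (intro compact_continuous_image continuous_on_subset[OF cont]) auto
  have FC: "fractional_colouring V E w" if "w \<in> F" for w
    using that by (force simp: F_def B_def fractional_colouring_def PiE_iff split: if_splits)
  have small: "\<exists>u\<in>F. total_weight V E u = total_weight V E w"
    if w: "fractional_colouring V E w" and le: "total_weight V E w \<le> M" for w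
  proof (intro bexI[of _ "\<lambda>S. if S \<in> ?T then w S else 0"])
    let ?u = "\<lambda>S. if S \<in> ?T then w S else 0"
    show "total_weight V E ?u = total_weight V E w" by (simp add: total_weight_def)
    have "w S \<le> M" if "S \<in> ?T" for S
      using member_le_sum[OF that, of w] fin w le
      by (force simp: fractional_colouring_def total_weight_def)
    then have "?u \<in> B" using w by (auto simp: B_def fractional_colouring_def)
    moreover have "(\<Sum>S\<in>{S \<in> ?T. v \<in> S}. ?u S) = (\<Sum>S\<in>{S \<in> ?T. v \<in> S}. w S)" for v
      by (rule sum.cong) auto
    ultimately show "?u \<in> F" using w by (auto simp: F_def fractional_colouring_def)
  qed
  obtain u0 where u0: "u0 \<in> F" "total_weight V E u0 = M"
    using small[OF fractional_colouring_singletons[OF G]] by (auto simp: M_def)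
  then have "total_weight V E ` F \<noteq> {}" by blast
  from compact_attains_inf[OF cF this] obtain w
    where wF: "w \<in> F" and min: "\<And>u. u \<in> F \<Longrightarrow> total_weight V E w \<le> total_weight V E u"
    by blast
  have least: "total_weight V E w \<le> total_weight V E w'" if "fractional_colouring V E w'" for w'
  proof (cases "total_weight V E w' \<le> M")
    case True
    then show ?thesis using small[OF that] min by force
  next
    case False
    then show ?thesis using min[OF u0(1)] u0(2) by simp
  qed
  have "total_weight V E w = fractional_chromatic_number V E"
    unfolding fractional_chromatic_number_def
    by (rule sym, rule cInf_eq_minimum) (use FC[OF wF] least in auto)
  with FC[OF wF] least show ?thesis by blast
qed

section \<open>The quantities \<open>\<mu>\<close> and \<open>\<tilde>y\<close>\<close>

abbreviation omega :: "nat \<Rightarrow> real" where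
  "omega \<Delta> \<equiv> real \<Delta> - 1"

definition p_val :: "nat \<Rightarrow> nat \<Rightarrow> real" where
  "p_val \<Delta> d =
     (\<Sum>i=0..3. 1/4 * measure_pmf.prob (binomial_pmf d (4 / omega \<Delta>)) {X. X \<le> i})
       / ((real \<Delta> - real d) + 1)"

definition mu_k :: "nat \<Rightarrow> nat \<Rightarrow> real" where
  "mu_k \<Delta> k = (MIN d\<in>{0..k}. p_val \<Delta> d)"

definition mu :: "nat \<Rightarrow> real" where
  "mu \<Delta> = mu_k \<Delta> \<Delta>"

text \<open>Intended for \<open>1 \<le> k \<le> \<Delta> - 2\<close>; existence of the maxima is
  \<open>ytilde_k_is_maximum\<close> below.\<close>

definition ytilde_k :: "nat \<Rightarrow> nat \<Rightarrow> real" where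
  "ytilde_k \<Delta> k =
     (if k \<le> 3
      then (GREATEST y. (1 + mu \<Delta>) * y
              \<le> 1/2 * (real \<Delta> - 1 - real k) + (1/2 + 1/2 * real k * mu \<Delta>) * y)
      else (GREATEST y. (1 + mu \<Delta>) * y
              \<le> 1/2 * (real \<Delta> - 1 - real k) + (1/2 + 1/2 * real k * mu_k \<Delta> (\<Delta> + 1 - k)) * y))"

definition ytilde :: "nat \<Rightarrow> real" where
  "ytilde \<Delta> =
     Min {(MIN k\<in>{1..\<Delta> - 2}. ytilde_k \<Delta> k), omega \<Delta>, (omega \<Delta> - 3) / (1 - 3 * mu \<Delta>)}"

lemma p_val_nonneg: "d \<le> \<Delta> \<Longrightarrow> 0 \<le> p_val \<Delta> d"
  unfolding p_val_def by (intro divide_nonneg_nonneg sum_nonneg) auto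

lemma mu_k_bounds:
  assumes "6 \<le> \<Delta>" "k \<le> \<Delta>"
  shows "0 \<le> mu_k \<Delta> k" "mu_k \<Delta> k \<le> 1 / (real \<Delta> + 1)"
proof -
  show "0 \<le> mu_k \<Delta> k"
    unfolding mu_k_def using assms by (subst Min_ge_iff) (auto intro: p_val_nonneg)
  have "4 / omega \<Delta> \<in> {0..1}" using assms by (auto simp: field_simps)
  then have "p_val \<Delta> 0 = 1 / (real \<Delta> + 1)"
    by (simp add: p_val_def binomial_pmf_0 add.commute)
  moreover have "mu_k \<Delta> k \<le> p_val \<Delta> 0"
    unfolding mu_k_def by (rule Min_le) auto
  ultimately show "mu_k \<Delta> k \<le> 1 / (real \<Delta> + 1)" by simp
qed

lemma Greatest_linear:
  fixes a b c :: real
  assumes "c < a"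
  shows "(GREATEST y. a * y \<le> b + c * y) = b / (a - c)"
  by (rule Greatest_equality) (use assms in \<open>auto simp: field_simps\<close>)

lemma ytilde_k_is_maximum:
  assumes "6 \<le> \<Delta>" "1 \<le> k" "k \<le> \<Delta> - 2"
  defines "m \<equiv> if k \<le> 3 then mu \<Delta> else mu_k \<Delta> (\<Delta> + 1 - k)"
  defines "P \<equiv> \<lambda>y. (1 + mu \<Delta>) * y
              \<le> 1/2 * (real \<Delta> - 1 - real k) + (1/2 + 1/2 * real k * m) * y"
  shows "P (ytilde_k \<Delta> k)" "\<And>y. P y \<Longrightarrow> y \<le> ytilde_k \<Delta> k"
proof -
  have m: "0 \<le> m" "m \<le> 1 / (real \<Delta> + 1)" and mu: "0 \<le> mu \<Delta>"
    using mu_k_bounds[OF assms(1), of \<Delta>] mu_k_bounds[OF assms(1), of "\<Delta> + 1 - k"] assms(2)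
    by (auto simp: m_def mu_def)
  have "real k * m \<le> real \<Delta> * (1 / (real \<Delta> + 1))"
    using assms m by (intro mult_mono) auto
  also have "\<dots> < 1" by (simp add: field_simps)
  finally have lt: "1/2 + 1/2 * real k * m < 1 + mu \<Delta>" using mu by simp
  have eq: "ytilde_k \<Delta> k
      = (1/2 * (real \<Delta> - 1 - real k)) / ((1 + mu \<Delta>) - (1/2 + 1/2 * real k * m))"
    using Greatest_linear[OF lt] by (auto simp: ytilde_k_def m_def)
  have pos: "0 < (1 + mu \<Delta>) - (1/2 + 1/2 * real k * m)" using lt by simp
  have iff: "P y \<longleftrightarrow> y \<le> ytilde_k \<Delta> k" for y
  proof -
    have "P y \<longleftrightarrow> y * ((1 + mu \<Delta>) - (1/2 + 1/2 * real k * m)) \<le> 1/2 * (real \<Delta> - 1 - real k)"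
      unfolding P_def right_diff_distrib by (simp only: mult.commute[of y] diff_le_eq)
    then show ?thesis unfolding eq by (simp only: pos_le_divide_eq[OF pos])
  qed
  show "P (ytilde_k \<Delta> k)" "\<And>y. P y \<Longrightarrow> y \<le> ytilde_k \<Delta> k" using iff by auto
qed

end

theory Submission
  imports Defs
begin

text \<open>
  Put \<open>\<omega> = \<Delta> - 1\<close>, and call a clique with \<open>\<omega>\<close> vertices big. In a vertex-minimal counterexample every vertex
  outside a big clique \<open>C\<close> has at most one neighbour in \<open>C\<close>: otherwise delete \<open>C\<close>, add a few edges
  between former neighbours of \<open>C\<close>, colour the rest by minimality, recolour one or two vertices that
  have lost neighbours, and extend the colouring to \<open>C\<close> by Hall's condition. The added edges
  could only be harmful by creating a clique with \<open>\<Delta>\<close> vertices, and this is excluded by choosing \<open>C\<close>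
  and the vertex outside of it with as many common edges as possible. In particular the
  big cliques are disjoint, and every vertex of a big clique has at most two neighbours outside of it.

  Now choose a random set of four vertices from each big clique. By the weighted form of Haxell's
  theorem (Aharoni, Berger and Ziv), the chosen vertices carry a random independent transversal using
  each of them with probability \<open>1/4\<close>; extend it greedily, in random order, to a maximal
  stable set. Colouring with such sets for time \<open>ytilde \<Delta>\<close> gives at least \<open>ytilde \<Delta> * mu \<Delta>\<close> colours
  to every vertex that is not saturated before, and the remaining demands satisfy the local fractional Reed bound of
  Molloy and Reed: a demand \<open>x\<close> can be met with \<open>c\<close> colours if \<open>x(N[v]) + x(K) \<le> 2 c\<close> for each vertex \<open>v\<close>
  and each clique \<open>K\<close> containing \<open>v\<close>.
\<close>

text \<open>Four is twice the outside degree two of a clique vertex, the class size that the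
  transversal theorem needs. Sampling four-sets, instead of taking each clique as one class,
  produces the binomial law: a vertex with d neighbours in big cliques meets X ~ Bin(d, 4/omega)
  sampled ones and avoids the transversal with probability at least max 0 (1 - X/4); by convexity
  the mean is at least the 1 - d/omega of a plain union bound. The denominator of
  \<open>p_val\<close> is the Caro-Wei bound among the at most D - d other neighbours. The terms of
  \<open>ytilde\<close> are what the local Reed bound asks of the residual demands:
  \<open>ytilde_k\<close> belongs to cliques with k vertices, \<open>omega\<close> keeps the demands
  of clique vertices nonnegative, the last term treats small cliques that meet a big one. The saving
  \<open>ytilde * mu\<close> is at most 1/5, a slack that the reductions use up. Colours are points
  of a real interval, so that a vertex can be recoloured with a set of any prescribed measure;
  Hall's condition is used through linear programming duality, one stable set for each vertex
  weighting, instead of distributing such sets over a clique.\<close>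

section \<open>A minimax lemma and greedy saturation\<close>

text \<open>A distribution minimising the sum of the squared deficits has no deficit.\<close>

lemma minimax:
  fixes a :: "'s \<Rightarrow> 'j \<Rightarrow> real"
  assumes fO: "finite \<Omega>" and fJ: "finite J"
    and ex: "\<And>l. (\<forall>j\<in>J. 0 \<le> l j) \<Longrightarrow> \<exists>s\<in>\<Omega>. 0 \<le> (\<Sum>j\<in>J. l j * a s j)"
  shows "\<exists>p. (\<forall>s. 0 \<le> p s) \<and> sum p \<Omega> = 1 \<and> (\<forall>j\<in>J. 0 \<le> (\<Sum>s\<in>\<Omega>. p s * a s j))"
proof -
  define B where "B = (\<Pi>\<^sub>E s\<in>UNIV. if s \<in> \<Omega> then {0..1} else {0::real}) \<inter> {p. sum p \<Omega> = 1}"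
  define b where "b p j = (\<Sum>s\<in>\<Omega>. p s * a s j)" for p j
  define F where "F p = (\<Sum>j\<in>J. (max 0 (- b p j))\<^sup>2)" for p
  have Bp: "p \<in> B \<longleftrightarrow> (\<forall>s\<in>\<Omega>. 0 \<le> p s \<and> p s \<le> 1) \<and> (\<forall>s. s \<notin> \<Omega> \<longrightarrow> p s = 0) \<and> sum p \<Omega> = 1" for p
    unfolding B_def by (auto simp: PiE_iff split: if_splits)
  have c1: "continuous_on UNIV (\<lambda>p :: 's \<Rightarrow> real. sum p \<Omega>)"
    by (intro continuous_on_sum continuous_on_product_coordinates)
  have "compactin (product_topology (\<lambda>i. euclidean) UNIV) (\<Pi>\<^sub>E s\<in>UNIV. if s \<in> \<Omega> then {0..1} else {0::real})"
    by (subst compactin_PiE) auto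
  then have "compact (\<Pi>\<^sub>E s\<in>UNIV. if s \<in> \<Omega> then {0..1} else {0::real})"
    by (simp add: euclidean_product_topology)
  moreover have "closed {p :: 's \<Rightarrow> real. sum p \<Omega> = 1}"
    by (intro closed_Collect_eq c1) auto
  ultimately have cB: "compact B" unfolding B_def by (rule compact_Int_closed)
  have cF: "continuous_on B F"
    unfolding F_def b_def
    by (intro continuous_intros continuous_on_subset[OF continuous_on_product_coordinates]) auto
  have nB: "B \<noteq> {}"
  proof -
    obtain s where "s \<in> \<Omega>" using ex[of "\<lambda>_. 0"] by auto
    then have "(\<lambda>t. if t = s then 1 else 0) \<in> B" using fO by (auto simp: Bp)
    then show ?thesis by blast
  qed
  from continuous_attains_inf[OF cB nB cF] obtain p where p: "p \<in> B" and mn: "\<And>q. q \<in> B \<Longrightarrow> F p \<le> F q"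
    by metis
  \<comment> \<open>The deficits themselves are the weights: as a function of the values
    \<open>b\<close>, the gradient of \<open>F\<close> is -2 \<open>l\<close>, so the point mass
    supplied by \<open>ex\<close> is a direction of descent.\<close>
  define l where "l j = max 0 (- b p j)" for j
  obtain s where s: "s \<in> \<Omega>" and ls: "0 \<le> (\<Sum>j\<in>J. l j * a s j)"
    using ex[of l] by (auto simp: l_def)
  define M where "M = (\<Sum>j\<in>J. (a s j - b p j)\<^sup>2)"
  have M0: "0 \<le> M" unfolding M_def by (intro sum_nonneg) auto
  have F0: "0 \<le> F p" unfolding F_def by (intro sum_nonneg) auto
  have lb: "(\<Sum>j\<in>J. l j * b p j) = - F p"
    unfolding F_def sum_negf[symmetric] by (intro sum.cong) (auto simp: l_def max_def power2_eq_square)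
  have key: "F p \<le> F p - 2 * t * F p + t\<^sup>2 * M" if t: "0 \<le> t" "t \<le> 1" for t
  proof -
    define q where "q u = (1 - t) * p u + t * (if u = s then 1 else 0)" for u
    have q1: "sum q \<Omega> = 1" unfolding q_def sum.distrib sum_distrib_left[symmetric]
      using p s fO by (simp add: Bp)
    have q0: "0 \<le> q u" for u using p t by (cases "u \<in> \<Omega>") (auto simp: q_def Bp)
    then have "q u \<le> 1" if "u \<in> \<Omega>" for u using member_le_sum[OF that, of q] fO q1 by auto
    then have "q \<in> B" using q0 q1 s p by (auto simp: Bp q_def)
    then have "F p \<le> F q" by (rule mn)
    also have bq: "b q j = b p j + t * (a s j - b p j)" for j
    proof -
      have "b q j = (\<Sum>u\<in>\<Omega>. (1 - t) * (p u * a u j) + t * (if u = s then a u j else 0))"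
        unfolding b_def q_def by (intro sum.cong) (auto simp: algebra_simps)
      also have "\<dots> = (1 - t) * b p j + t * a s j"
        unfolding sum.distrib sum_distrib_left[symmetric] b_def using s fO by simp
      finally show ?thesis by (simp add: algebra_simps)
    qed
    have "F q \<le> (\<Sum>j\<in>J. (l j - t * (a s j - b p j))\<^sup>2)"
      unfolding F_def
    proof (intro sum_mono)
      fix j
      have "- b q j \<le> l j - t * (a s j - b p j)" by (auto simp: bq l_def)
      then have "max 0 (- b q j) \<le> \<bar>l j - t * (a s j - b p j)\<bar>" by auto
      then have "(max 0 (- b q j))\<^sup>2 \<le> \<bar>l j - t * (a s j - b p j)\<bar>\<^sup>2" by (intro power_mono) auto
      then show "(max 0 (- b q j))\<^sup>2 \<le> (l j - t * (a s j - b p j))\<^sup>2" by simp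
    qed
    also have "\<dots> = (\<Sum>j\<in>J. (l j)\<^sup>2) - 2 * t * ((\<Sum>j\<in>J. l j * a s j) - (\<Sum>j\<in>J. l j * b p j)) + t\<^sup>2 * M"
      unfolding M_def sum_distrib_left sum_subtractf[symmetric] sum.distrib[symmetric]
      by (intro sum.cong) (auto simp: power2_eq_square algebra_simps)
    also have "\<dots> \<le> F p - 2 * t * F p + t\<^sup>2 * M"
    proof -
      have "0 \<le> t * (\<Sum>j\<in>J. l j * a s j)" using ls t by auto
      moreover have "(\<Sum>j\<in>J. (l j)\<^sup>2) = F p" by (simp add: F_def l_def)
      ultimately show ?thesis unfolding lb by (simp add: algebra_simps)
    qed
    finally show ?thesis .
  qed
  have "F p = 0"
  proof (rule ccontr)
    assume "F p \<noteq> 0"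
    then have Fp: "0 < F p" using F0 by simp
    \<comment> \<open>Small enough that the quadratic error in \<open>key\<close> is at most
      \<open>t * F p\<close>, half of the linear gain; the \<open>+ 1\<close> guards against
      \<open>M = 0\<close>.\<close>
    define t where "t = min 1 (F p / (M + 1))"
    have t: "0 < t" "t \<le> 1" using Fp M0 by (auto simp: t_def)
    have "t * M \<le> F p / (M + 1) * M" using M0 by (intro mult_right_mono) (auto simp: t_def)
    also have "\<dots> \<le> F p" using Fp M0 by (simp add: field_simps)
    finally have "t * (t * M) \<le> t * F p" using t by (intro mult_left_mono) auto
    moreover have "2 * (t * F p) \<le> t * (t * M)" using key[of t] t by (simp add: power2_eq_square algebra_simps)
    ultimately show False using mult_pos_pos[OF t(1) Fp] by linarith
  qed
  then have z: "(max 0 (- b p j))\<^sup>2 = 0" if "j \<in> J" for j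
    using that fJ unfolding F_def by (subst (asm) sum_nonneg_eq_0_iff) auto
  have "0 \<le> b p j" if "j \<in> J" for j
    using z[OF that] by (auto simp: max_def split: if_splits)
  moreover have "0 \<le> p u" for u using p by (cases "u \<in> \<Omega>") (auto simp: Bp)
  ultimately show ?thesis using p unfolding b_def by (auto simp: Bp)
qed

definition cover :: "'a set set \<Rightarrow> ('a set \<Rightarrow> real) \<Rightarrow> 'a \<Rightarrow> real" where
  "cover \<S> w v = (\<Sum>S\<in>{S\<in>\<S>. v \<in> S}. w S)"

lemma cover_alt: "finite \<S> \<Longrightarrow> cover \<S> w v = (\<Sum>S\<in>\<S>. w S * (if v \<in> S then 1 else 0))"
  unfolding cover_def by (simp add: sum.If_cases if_distrib Collect_conj_eq cong: if_cong)

lemma cover_add: "cover \<S> (\<lambda>S. t * w S + u * w' S) v = t * cover \<S> w v + u * cover \<S> w' v"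
  unfolding cover_def by (simp add: sum.distrib sum_distrib_left)

text \<open>Run the strategy for the set \<open>U\<close> of vertices with positive remaining demand
  until the next of them is saturated, then restart with the smaller set. All requirements are
  linear in the weights and add up over the phases; a vertex that is short of its demand at the end
  was in \<open>U\<close> in every phase, so its own requirements \<open>Hs\<close> survive.\<close>

lemma greedy_saturation:
  fixes \<S> :: "'a set set" and r :: "'a \<Rightarrow> real" and Hs :: "'a \<Rightarrow> ('a set \<Rightarrow> real) set"
  assumes fS: "finite \<S>" and fW: "finite W"
    and strat: "\<And>U. U \<subseteq> W \<Longrightarrow> \<exists>p. (\<forall>S. 0 \<le> p S) \<and> sum p \<S> = 1 \<and>
        (\<forall>S\<in>\<S>. p S \<noteq> 0 \<longrightarrow> S \<inter> W \<subseteq> U) \<and> (\<forall>h\<in>H0. 0 \<le> (\<Sum>S\<in>\<S>. p S * h S)) \<and>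
        (\<forall>v\<in>U. \<forall>h\<in>Hs v. 0 \<le> (\<Sum>S\<in>\<S>. p S * h S))"
    and "0 \<le> y" and "\<And>v. v \<in> W \<Longrightarrow> 0 \<le> r v"
  shows "\<exists>w. (\<forall>S. 0 \<le> w S) \<and> sum w \<S> = y \<and> (\<forall>v\<in>W. cover \<S> w v \<le> r v) \<and>
        (\<forall>h\<in>H0. 0 \<le> (\<Sum>S\<in>\<S>. w S * h S)) \<and>
        (\<forall>v\<in>W. cover \<S> w v < r v \<longrightarrow> (\<forall>h\<in>Hs v. 0 \<le> (\<Sum>S\<in>\<S>. w S * h S)))"
  using assms(4,5)
proof (induction "card {v\<in>W. 0 < r v}" arbitrary: r y rule: less_induct)
  case (less r y)
  define U where "U = {v\<in>W. 0 < r v}"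
  have "U \<subseteq> W" by (auto simp: U_def)
  from strat[OF this] obtain p where p: "(\<forall>S. 0 \<le> p S) \<and> sum p \<S> = 1 \<and>
        (\<forall>S\<in>\<S>. p S \<noteq> 0 \<longrightarrow> S \<inter> W \<subseteq> U) \<and> (\<forall>h\<in>H0. 0 \<le> (\<Sum>S\<in>\<S>. p S * h S)) \<and>
        (\<forall>v\<in>U. \<forall>h\<in>Hs v. 0 \<le> (\<Sum>S\<in>\<S>. p S * h S))" by (elim exE) (rule that)
  have p0: "\<And>S. 0 \<le> p S" and p1: "sum p \<S> = 1"
    and pU: "\<And>S. S \<in> \<S> \<Longrightarrow> p S \<noteq> 0 \<Longrightarrow> S \<inter> W \<subseteq> U"
    and pH0: "\<And>h. h \<in> H0 \<Longrightarrow> 0 \<le> (\<Sum>S\<in>\<S>. p S * h S)"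
    and pH: "\<And>v h. v \<in> U \<Longrightarrow> h \<in> Hs v \<Longrightarrow> 0 \<le> (\<Sum>S\<in>\<S>. p S * h S)"
    using p by blast+
  define a where "a = cover \<S> p"
  have a0: "0 \<le> a v" for v unfolding a_def cover_def using p0 by (intro sum_nonneg) auto
  have aU: "a v = 0" if "v \<in> W" "v \<notin> U" for v
    unfolding a_def cover_def using pU that by (intro sum.neutral) auto
  show ?case
  proof (cases "\<forall>v\<in>W. y * a v \<le> r v")
    case True
    have cv: "cover \<S> (\<lambda>S. y * p S) v = y * a v" for v
      unfolding a_def cover_def by (simp add: sum_distrib_left)
    have sm: "(\<Sum>S\<in>\<S>. y * p S * h S) = y * (\<Sum>S\<in>\<S>. p S * h S)" for h
      by (simp add: sum_distrib_left mult.assoc)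
    have un: "v \<in> U" if "v \<in> W" "y * a v < r v" for v
      using that mult_nonneg_nonneg[OF less.prems(1) a0[of v]] by (auto simp: U_def)
    show ?thesis
    proof (rule exI[of _ "\<lambda>S. y * p S"], intro conjI ballI allI impI)
      show "0 \<le> y * p S" for S using p0 less.prems(1) by simp
      show "(\<Sum>S\<in>\<S>. y * p S) = y" using p1 by (simp add: sum_distrib_left[symmetric])
      show "cover \<S> (\<lambda>S. y * p S) v \<le> r v" if "v \<in> W" for v using True that by (simp add: cv)
      show "0 \<le> (\<Sum>S\<in>\<S>. y * p S * h S)" if "h \<in> H0" for h
        unfolding sm using pH0[OF that] less.prems(1) by simp
      show "0 \<le> (\<Sum>S\<in>\<S>. y * p S * h S)" if "v \<in> W" "cover \<S> (\<lambda>S. y * p S) v < r v" "h \<in> Hs v" for v h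
        unfolding sm using pH[OF un that(3)] that less.prems(1) by (simp add: cv)
    qed
  next
    case False
    define X where "X = {v\<in>W. 0 < a v}"
    have fX: "finite X" using fW by (auto simp: X_def)
    have XU: "X \<subseteq> U" using aU by (force simp: X_def)
    obtain v0 where v0: "v0 \<in> W" "r v0 < y * a v0" using False by auto
    have "0 < a v0"
      using v0 less.prems(2)[OF v0(1)] a0[of v0] by (cases "a v0 = 0") auto
    then have v0X: "v0 \<in> X" using v0 by (auto simp: X_def)
    \<comment> \<open>The moment at which the first vertex of \<open>X\<close> runs out of
      demand.\<close>
    define t where "t = Min ((\<lambda>v. r v / a v) ` X)"
    have "t \<in> (\<lambda>v. r v / a v) ` X" unfolding t_def using fX v0X by (intro Min_in) auto
    then obtain m where m: "m \<in> X" "t = r m / a m" by auto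
    have tle: "t \<le> r v / a v" if "v \<in> X" for v unfolding t_def using fX that by (intro Min_le) auto
    have t0: "0 \<le> t" using m XU by (auto simp: X_def U_def)
    have "r v0 / a v0 < y" using v0 v0X by (simp add: X_def divide_less_eq)
    then have ty: "t \<le> y" using tle[OF v0X] by simp
    define r' where "r' v = r v - t * a v" for v
    have r'0: "0 \<le> r' v" if "v \<in> W" for v
    proof (cases "v \<in> X")
      case True
      then show ?thesis using tle[OF True] by (auto simp: r'_def X_def field_simps)
    next
      case False
      then show ?thesis using that a0[of v] less.prems(2)[OF that] by (auto simp: r'_def X_def)
    qed
    have sub: "{v\<in>W. 0 < r' v} \<subseteq> U"
    proof
      fix v assume "v \<in> {v\<in>W. 0 < r' v}"
      then show "v \<in> U" using mult_nonneg_nonneg[OF t0 a0[of v]] by (auto simp: U_def r'_def)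
    qed
    have "r' m = 0" using m by (auto simp: r'_def X_def)
    then have "{v\<in>W. 0 < r' v} \<subset> U" using sub m XU by force
    then have cardlt: "card {v\<in>W. 0 < r' v} < card {v\<in>W. 0 < r v}"
      unfolding U_def[symmetric] using fW by (intro psubset_card_mono) (auto simp: U_def)
    have "0 \<le> y - t" using ty by simp
    then have "\<exists>w. (\<forall>S. 0 \<le> w S) \<and> sum w \<S> = y - t \<and> (\<forall>v\<in>W. cover \<S> w v \<le> r' v) \<and>
        (\<forall>h\<in>H0. 0 \<le> (\<Sum>S\<in>\<S>. w S * h S)) \<and>
        (\<forall>v\<in>W. cover \<S> w v < r' v \<longrightarrow> (\<forall>h\<in>Hs v. 0 \<le> (\<Sum>S\<in>\<S>. w S * h S)))"
      by (rule less.hyps[OF cardlt]) (rule r'0)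
    then obtain w where w: "(\<forall>S. 0 \<le> w S) \<and> sum w \<S> = y - t \<and> (\<forall>v\<in>W. cover \<S> w v \<le> r' v) \<and>
        (\<forall>h\<in>H0. 0 \<le> (\<Sum>S\<in>\<S>. w S * h S)) \<and>
        (\<forall>v\<in>W. cover \<S> w v < r' v \<longrightarrow> (\<forall>h\<in>Hs v. 0 \<le> (\<Sum>S\<in>\<S>. w S * h S)))"
      by (elim exE) (rule that)
    have w0: "\<And>S. 0 \<le> w S"
      and w1: "sum w \<S> = y - t" and wr: "\<And>v. v \<in> W \<Longrightarrow> cover \<S> w v \<le> r' v"
      and wH0: "\<And>h. h \<in> H0 \<Longrightarrow> 0 \<le> (\<Sum>S\<in>\<S>. w S * h S)"
      and wH: "\<And>v h. v \<in> W \<Longrightarrow> cover \<S> w v < r' v \<Longrightarrow> h \<in> Hs v \<Longrightarrow> 0 \<le> (\<Sum>S\<in>\<S>. w S * h S)"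
      using w by blast+
    define w' where "w' S = t * p S + 1 * w S" for S
    have cv: "cover \<S> w' v = t * a v + cover \<S> w v" for v
      unfolding w'_def cover_add a_def by simp
    have sm: "(\<Sum>S\<in>\<S>. w' S * h S) = t * (\<Sum>S\<in>\<S>. p S * h S) + (\<Sum>S\<in>\<S>. w S * h S)" for h
      unfolding w'_def by (simp add: sum_distrib_left sum.distrib algebra_simps)
    have un: "v \<in> U" "cover \<S> w v < r' v" if "v \<in> W" "cover \<S> w' v < r v" for v
    proof -
      show *: "cover \<S> w v < r' v" using that cv by (auto simp: r'_def)
      have "0 \<le> cover \<S> w v" unfolding cover_def using w0 by (intro sum_nonneg) auto
      then show "v \<in> U" using * sub that by auto
    qed
    show ?thesis
    proof (rule exI[of _ w'], intro conjI ballI allI impI)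
      show "sum w' \<S> = y" unfolding w'_def sum.distrib using p1 w1 by (simp add: sum_distrib_left[symmetric])
      show "0 \<le> (\<Sum>S\<in>\<S>. w' S * h S)" if "v \<in> W" "cover \<S> w' v < r v" "h \<in> Hs v" for v h
        unfolding sm using un[OF that(1,2)] pH[OF _ that(3)] wH[OF that(1) _ that(3)] t0 by auto
      show "0 \<le> w' S" for S using p0 w0 t0 by (simp add: w'_def)
      show "cover \<S> w' v \<le> r v" if "v \<in> W" for v using wr[OF that] by (simp add: cv r'_def)
      show "0 \<le> (\<Sum>S\<in>\<S>. w' S * h S)" if "h \<in> H0" for h using pH0[OF that] wH0[OF that] t0 by (simp add: sm)
    qed
  qed
qed

section \<open>A weighted local form of the fractional Reed bound\<close>

definition stable :: "('a \<Rightarrow> 'a \<Rightarrow> bool) \<Rightarrow> 'a set \<Rightarrow> bool" where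
  "stable A S \<longleftrightarrow> (\<forall>u\<in>S. \<forall>v\<in>S. \<not> A u v)"

definition is_clique :: "('a \<Rightarrow> 'a \<Rightarrow> bool) \<Rightarrow> 'a set \<Rightarrow> bool" where
  "is_clique A K \<longleftrightarrow> (\<forall>u\<in>K. \<forall>v\<in>K. u \<noteq> v \<longrightarrow> A u v)"

definition nbrs :: "'a set \<Rightarrow> ('a \<Rightarrow> 'a \<Rightarrow> bool) \<Rightarrow> 'a \<Rightarrow> 'a set" where
  "nbrs V A v = {u\<in>V. A v u}"

text \<open>Weights live on all sets and vanish off the stable subsets of \<open>V\<close>, so sums
  may range over \<open>Pow V\<close>; the total is exactly \<open>c\<close>, so that the stable
  sets can later fill an interval of length \<open>c\<close>.\<close>

definition weight_colouring :: "'a set \<Rightarrow> ('a \<Rightarrow> 'a \<Rightarrow> bool) \<Rightarrow> real \<Rightarrow> ('a set \<Rightarrow> real) \<Rightarrow> bool" where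
  "weight_colouring V A c w \<longleftrightarrow> (\<forall>S. 0 \<le> w S) \<and> (\<forall>S. w S \<noteq> 0 \<longrightarrow> S \<subseteq> V \<and> stable A S) \<and> sum w (Pow V) = c"

lemma finite_nbrs [simp]: "finite V \<Longrightarrow> finite (nbrs V A v)"
  by (simp add: nbrs_def)

lemma nbrs_subset: "nbrs V A v \<subseteq> V"
  by (auto simp: nbrs_def)

lemma stable_subset: "stable A S \<Longrightarrow> T \<subseteq> S \<Longrightarrow> stable A T"
  by (auto simp: stable_def)

text \<open>Choose a maximum stable set with probability proportional to the product of its weights. If it
  meets the neighbours of \<open>v\<close> in a single vertex \<open>u\<close> only, then exchanging \<open>u\<close> for \<open>v\<close> gives a maximum
  stable set, and the vertices \<open>u\<close> leading to the same set form a clique together with \<open>v\<close>.\<close>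

lemma max_stable_distribution:
  fixes x :: "'a \<Rightarrow> real" and \<kappa> :: "'a \<Rightarrow> real"
  assumes fU: "finite U" and sym: "symp A" and irr: "irreflp A"
    and x: "\<And>v. v \<in> U \<Longrightarrow> 0 < x v"
    and \<kappa>: "\<And>v K. v \<in> U \<Longrightarrow> K \<subseteq> U \<Longrightarrow> v \<in> K \<Longrightarrow> is_clique A K \<Longrightarrow> sum x K \<le> \<kappa> v"
  shows "\<exists>p. (\<forall>S. 0 \<le> p S) \<and> (\<forall>S. p S \<noteq> 0 \<longrightarrow> S \<subseteq> U \<and> stable A S) \<and> sum p (Pow U) = 1 \<and>
    (\<forall>v\<in>U. 0 \<le> (\<Sum>S\<in>Pow U. p S * (real (card (S \<inter> insert v (nbrs U A v)))
        + \<kappa> v / x v * (if v \<in> S then 1 else 0) - 2)))"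
proof -
  define \<S> where "\<S> = {S. S \<subseteq> U \<and> stable A S}"
  have fS: "finite \<S>" unfolding \<S>_def using fU by auto
  have eS: "{} \<in> \<S>" by (simp add: \<S>_def stable_def)
  have fin: "finite S" if "S \<in> \<S>" for S using that fU finite_subset by (auto simp: \<S>_def)
  define M where "M = Max (card ` \<S>)"
  have Mmax: "card S \<le> M" if "S \<in> \<S>" for S unfolding M_def using fS that by auto
  define MM where "MM = {S\<in>\<S>. card S = M}"
  have fM: "finite MM" using fS by (auto simp: MM_def)
  have "M \<in> card ` \<S>" unfolding M_def using fS eS by (intro Max_in) auto
  then have neM: "MM \<noteq> {}" by (auto simp: MM_def)
  define P where "P S = prod x S" for S
  have Ppos: "0 < P S" if "S \<in> \<S>" for S unfolding P_def using that x by (intro prod_pos) (auto simp: \<S>_def)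
  define Z where "Z = sum P MM"
  have Z: "0 < Z" unfolding Z_def using fM neM Ppos by (intro sum_pos) (auto simp: MM_def)
  define p where "p S = (if S \<in> MM then P S / Z else 0)" for S
  have MU: "MM \<subseteq> Pow U" by (auto simp: MM_def \<S>_def)
  have sum_p: "(\<Sum>S\<in>Pow U. p S * g S) = (\<Sum>S\<in>MM. P S * g S) / Z" for g
  proof -
    have "(\<Sum>S\<in>Pow U. p S * g S) = (\<Sum>S\<in>MM. p S * g S)"
      using fU MU by (intro sum.mono_neutral_right) (auto simp: p_def)
    also have "\<dots> = (\<Sum>S\<in>MM. P S * g S) / Z" unfolding sum_divide_distrib by (intro sum.cong) (auto simp: p_def)
    finally show ?thesis .
  qed
  have main: "0 \<le> (\<Sum>S\<in>MM. P S * (real (card (S \<inter> insert v (nbrs U A v)))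
        + \<kappa> v / x v * (if v \<in> S then 1 else 0) - 2))" (is "0 \<le> sum ?f MM") if v: "v \<in> U" for v
  proof -
    define N where "N = nbrs U A v"
    have vN: "v \<notin> N" using irr by (auto simp: N_def nbrs_def irreflp_def)
    have NU: "N \<subseteq> U" by (auto simp: N_def nbrs_def)
    have fN: "finite N" using fU NU finite_subset by blast
    \<comment> \<open>Sets containing \<open>v\<close> contribute
      \<open>\<kappa> v / x v - 1\<close>, a single neighbour costs 1, two or more cost nothing, and
      by maximality no set in \<open>MM\<close> misses both \<open>v\<close> and all its
      neighbours.\<close>
    define a where "a = {S\<in>MM. v \<in> S}"
    define b where "b = {S\<in>MM. v \<notin> S \<and> card (S \<inter> N) = 1}"
    define d where "d = {S\<in>MM. v \<notin> S \<and> card (S \<inter> N) \<noteq> 1}"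
    have fa: "finite a" and fb: "finite b" and fd: "finite d" using fM by (auto simp: a_def b_def d_def)
    have "sum ?f MM = sum ?f (a \<union> (b \<union> d))" by (rule sum.cong) (auto simp: a_def b_def d_def)
    also have "\<dots> = sum ?f a + (sum ?f b + sum ?f d)"
      using fa fb fd by (subst sum.union_disjoint, (auto simp: a_def b_def d_def)[3])+ simp
    also have "sum ?f a = (\<Sum>S\<in>a. P S * (\<kappa> v / x v - 1))"
    proof (rule sum.cong)
      fix S assume S: "S \<in> a"
      then have "S \<inter> N = {}" using v by (auto simp: a_def MM_def \<S>_def stable_def N_def nbrs_def)
      then have "S \<inter> insert v N = {v}" using S by (auto simp: a_def)
      then have "card (S \<inter> insert v N) = 1" by (simp only: card_1_singleton_iff) auto
      then show "?f S = P S * (\<kappa> v / x v - 1)" using S unfolding N_def[symmetric] by (simp add: a_def)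
    qed simp
    also have "\<dots> = (\<kappa> v / x v - 1) * sum P a" by (subst sum_distrib_right[symmetric], rule mult.commute)
    also have "sum ?f b = - sum P b"
      unfolding sum_negf[symmetric]
    proof (rule sum.cong)
      fix S assume S: "S \<in> b"
      then have "S \<inter> insert v N = S \<inter> N" by (auto simp: b_def)
      then show "?f S = - P S" using S unfolding N_def[symmetric] by (simp add: b_def)
    qed simp
    finally have split: "sum ?f MM = (\<kappa> v / x v - 1) * sum P a + (- sum P b + sum ?f d)" .
    have "0 \<le> sum ?f d"
    proof (intro sum_nonneg)
      fix S assume S: "S \<in> d"
      have "S \<inter> N \<noteq> {}"
      proof
        assume e: "S \<inter> N = {}"
        have "insert v S \<in> \<S>"
          using S e v sym irr by (auto simp: d_def MM_def \<S>_def stable_def N_def nbrs_def symp_def irreflp_def)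
        from Mmax[OF this] show False using S fin by (auto simp: d_def MM_def)
      qed
      moreover have "finite (S \<inter> N)" using fN by auto
      ultimately have "card (S \<inter> N) \<noteq> 0" by simp
      then have "2 \<le> card (S \<inter> N)" using S by (auto simp: d_def)
      moreover have "S \<inter> insert v N = S \<inter> N" using S by (auto simp: d_def)
      ultimately have "0 \<le> real (card (S \<inter> insert v N)) + \<kappa> v / x v * (if v \<in> S then 1 else 0) - 2"
        using S by (simp add: d_def)
      then show "0 \<le> ?f S" using Ppos[of S] S unfolding N_def[symmetric]
        by (intro mult_nonneg_nonneg) (auto simp: d_def MM_def)
    qed
    moreover have "sum P b \<le> (\<kappa> v / x v - 1) * sum P a"
    proof -
      \<comment> \<open>The vertices that may replace \<open>v\<close> in \<open>T\<close>. Such an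
        exchange multiplies the weight by \<open>x u / x v\<close>.\<close>
      define W where "W T = {u\<in>N. insert u (T - {v}) \<in> \<S>}" for T
      define Y where "Y = (SIGMA T:a. W T)"
      define g where "g = (\<lambda>(T, u). insert u (T - {v}))"
      have fW: "finite (W T)" for T using fN by (auto simp: W_def)
      have fY: "finite Y" unfolding Y_def using fa fW by auto
      have aS: "T \<in> \<S>" "v \<in> T" "finite T" "card T = M" if "T \<in> a" for T
        using that fin by (auto simp: a_def MM_def)
      have uT: "u \<notin> T" if "T \<in> a" "u \<in> N" for T u
        using aS[OF that(1)] that(2) by (auto simp: \<S>_def stable_def N_def nbrs_def)
      have gP: "P (g (T, u)) = P T * (x u / x v)" if "T \<in> a" "u \<in> N" for T u
      proof -
        have "P T = x v * P (T - {v})" unfolding P_def using aS[OF that(1)] by (intro prod.remove) auto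
        moreover have "P (g (T, u)) = x u * P (T - {v})"
          unfolding P_def g_def using aS[OF that(1)] uT[OF that] by simp
        ultimately show ?thesis using x[OF v] by simp
      qed
      have "b \<subseteq> g ` Y"
      proof
        fix S assume S: "S \<in> b"
        then obtain u where u: "S \<inter> N = {u}" by (auto simp: b_def card_1_singleton_iff)
        have uS: "u \<in> S" "u \<in> N" using u by auto
        define T where "T = insert v (S - {u})"
        have vS: "v \<notin> S" using S by (auto simp: b_def)
        have S1: "S \<in> \<S>" "card S = M" using S by (auto simp: b_def MM_def)
        have "\<not> A v s" if "s \<in> S - {u}" for s using that u S1 by (auto simp: N_def nbrs_def \<S>_def)
        then have "T \<in> \<S>" using S1 v sym irr unfolding T_def \<S>_def stable_def
          by (auto simp: symp_def irreflp_def)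
        moreover have "card T = M"
          unfolding T_def using vS S1(2) card.remove[OF fin[OF S1(1)] uS(1)] fin[OF S1(1)] by simp
        ultimately have "T \<in> a" by (auto simp: a_def MM_def T_def)
        moreover have Su: "insert u (T - {v}) = S" using vS uS by (auto simp: T_def)
        ultimately have "(T, u) \<in> Y" "g (T, u) = S" using uS S1 by (auto simp: Y_def W_def g_def)
        then show "S \<in> g ` Y" by force
      qed
      then have "sum P b \<le> sum P (g ` Y)"
        using fY Ppos by (intro sum_mono2) (force simp: g_def Y_def W_def)+
      also have "\<dots> \<le> sum (P \<circ> g) Y"
        using fY Ppos by (intro sum_image_le) (force simp: g_def Y_def W_def)+
      also have "\<dots> = (\<Sum>T\<in>a. \<Sum>u\<in>W T. P (g (T, u)))"
        unfolding Y_def using fa fW by (subst sum.Sigma) (auto simp: comp_def case_prod_unfold)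
      also have "\<dots> = (\<Sum>T\<in>a. P T * (sum x (W T) / x v))"
        by (intro sum.cong refl) (simp add: gP W_def sum_divide_distrib sum_distrib_left)
      also have "\<dots> \<le> (\<Sum>T\<in>a. P T * (\<kappa> v / x v - 1))"
      proof (intro sum_mono mult_left_mono)
        fix T assume T: "T \<in> a"
        have "is_clique A (insert v (W T))"
        proof -
          have "A u u'" if u: "u \<in> W T" "u' \<in> W T" "u \<noteq> u'" for u u'
          proof (rule ccontr)
            \<comment> \<open>Two non-adjacent replacements could both be put in the place of
              \<open>v\<close>, giving a stable set larger than the maximum.\<close>
            assume nA: "\<not> A u u'"
            have uN: "u \<in> N" "u' \<in> N" using u by (auto simp: W_def)
            have "insert u (insert u' (T - {v})) \<in> \<S>"
              using u nA sym unfolding W_def \<S>_def stable_def symp_def by auto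
            then have "card (insert u (insert u' (T - {v}))) \<le> M" by (rule Mmax)
            moreover have "card (insert u (insert u' (T - {v}))) = card (T - {v}) + 2"
              using aS(3)[OF T] uT[OF T] uN u(3) by simp
            moreover have "M = Suc (card (T - {v}))" using card.remove[of T v] aS[OF T] by simp
            ultimately show False by simp
          qed
          moreover have "A v u \<and> A u v" if "u \<in> W T" for u
            using that sym by (auto simp: W_def N_def nbrs_def symp_def)
          ultimately show ?thesis unfolding is_clique_def by blast
        qed
        then have "sum x (insert v (W T)) \<le> \<kappa> v" using v NU by (intro \<kappa>) (auto simp: W_def)
        moreover have "v \<notin> W T" using vN by (auto simp: W_def)
        ultimately have "sum x (W T) \<le> \<kappa> v - x v" using fW by simp
        then show "sum x (W T) / x v \<le> \<kappa> v / x v - 1"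
          using x[OF v] by (simp add: field_simps)
        show "0 \<le> P T" using Ppos aS[OF T] by force
      qed
      also have "\<dots> = (\<kappa> v / x v - 1) * sum P a" by (subst sum_distrib_right[symmetric], rule mult.commute)
      finally show ?thesis .
    qed
    ultimately show ?thesis unfolding split by linarith
  qed
  have "sum p (Pow U) = 1" using sum_p[of "\<lambda>_. 1"] Z by (simp add: Z_def)
  moreover have "0 \<le> p S" for S using Ppos[of S] Z by (auto simp: p_def MM_def intro: less_imp_le)
  moreover have "S \<subseteq> U \<and> stable A S" if "p S \<noteq> 0" for S
    using that by (auto simp: p_def MM_def \<S>_def split: if_splits)
  ultimately show ?thesis using main Z unfolding sum_p[symmetric]
    by (intro exI[of _ p]) (simp add: sum_p)
qed

text \<open>Greedy saturation for time \<open>c\<close> with the strategy of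
  \<open>max_stable_distribution\<close>. If \<open>v\<close> ended below its demand, the
  accumulated requirement would bound 2c by the cover of N[v] plus \<open>\<kappa> v / x v\<close>
  times the cover of \<open>v\<close>, which is less than x(N[v]) + \<open>\<kappa> v\<close> =
  2c.\<close>

lemma weighted_local_reed:
  fixes x :: "'a \<Rightarrow> real"
  assumes fV: "finite V" and sym: "symp A" and irr: "irreflp A"
    and x0: "\<And>v. v \<in> V \<Longrightarrow> 0 \<le> x v" and c0: "0 \<le> c"
    and bound: "\<And>v K. v \<in> V \<Longrightarrow> 0 < x v \<Longrightarrow> K \<subseteq> V \<Longrightarrow> v \<in> K \<Longrightarrow> is_clique A K \<Longrightarrow>
        sum x (insert v (nbrs V A v)) + sum x K \<le> 2 * c"
  shows "\<exists>w. weight_colouring V A c w \<and> (\<forall>v\<in>V. x v \<le> cover (Pow V) w v)"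
proof -
  define W where "W = {v\<in>V. 0 < x v}"
  have fW: "finite W" and WV: "W \<subseteq> V" using fV by (auto simp: W_def)
  define \<S> where "\<S> = {S. S \<subseteq> W \<and> stable A S}"
  have fS: "finite \<S>" using fW by (auto simp: \<S>_def)
  define \<kappa> where "\<kappa> v = 2 * c - sum x (insert v (nbrs V A v))" for v
  define h where "h v S = real (card (S \<inter> insert v (nbrs V A v))) + \<kappa> v / x v * (if v \<in> S then 1 else 0) - 2" for v S
  have "\<exists>p. (\<forall>S. 0 \<le> p S) \<and> sum p \<S> = 1 \<and>
        (\<forall>S\<in>\<S>. p S \<noteq> 0 \<longrightarrow> S \<inter> W \<subseteq> U) \<and> (\<forall>h\<in>{}. 0 \<le> (\<Sum>S\<in>\<S>. p S * h S)) \<and>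
        (\<forall>v\<in>U. \<forall>g\<in>{h v}. 0 \<le> (\<Sum>S\<in>\<S>. p S * g S))" if UW: "U \<subseteq> W" for U
  proof -
    have fU: "finite U" using UW fW finite_subset by blast
    obtain p where p: "\<forall>S. 0 \<le> p S" "\<forall>S. p S \<noteq> 0 \<longrightarrow> S \<subseteq> U \<and> stable A S" "sum p (Pow U) = 1"
      "\<forall>v\<in>U. 0 \<le> (\<Sum>S\<in>Pow U. p S * (real (card (S \<inter> insert v (nbrs U A v)))
        + \<kappa> v / x v * (if v \<in> S then 1 else 0) - 2))"
    proof -
      have "\<exists>p. (\<forall>S. 0 \<le> p S) \<and> (\<forall>S. p S \<noteq> 0 \<longrightarrow> S \<subseteq> U \<and> stable A S) \<and> sum p (Pow U) = 1 \<and>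
        (\<forall>v\<in>U. 0 \<le> (\<Sum>S\<in>Pow U. p S * (real (card (S \<inter> insert v (nbrs U A v)))
        + \<kappa> v / x v * (if v \<in> S then 1 else 0) - 2)))"
      proof (rule max_stable_distribution[OF fU sym irr])
        show "0 < x v" if "v \<in> U" for v using that UW by (auto simp: W_def)
        show "sum x K \<le> \<kappa> v" if "v \<in> U" "K \<subseteq> U" "v \<in> K" "is_clique A K" for v K
          
        proof -
          have "v \<in> V" "0 < x v" "K \<subseteq> V" using that UW by (auto simp: W_def)
          from bound[OF this that(3,4)] show ?thesis by (simp add: \<kappa>_def)
        qed
      qed
      then show ?thesis using that by blast
    qed
    have tr: "(\<Sum>S\<in>Pow U. p S * g S) = (\<Sum>S\<in>\<S>. p S * g S)" for g
    proof -
      have "(\<Sum>S\<in>Pow U. p S * g S) = (\<Sum>S\<in>Pow U \<inter> \<S>. p S * g S)"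
        using fU p(2) UW by (intro sum.mono_neutral_right) (auto simp: \<S>_def)
      also have "\<dots> = (\<Sum>S\<in>\<S>. p S * g S)"
        using fS p(2) by (intro sum.mono_neutral_left) auto
      finally show ?thesis .
    qed
    have "0 \<le> (\<Sum>S\<in>\<S>. p S * h v S)" if v: "v \<in> U" for v
    proof -
      have "(\<Sum>S\<in>Pow U. p S * h v S) = (\<Sum>S\<in>Pow U. p S * (real (card (S \<inter> insert v (nbrs U A v)))
        + \<kappa> v / x v * (if v \<in> S then 1 else 0) - 2))"
      proof (rule sum.cong)
        fix S assume "S \<in> Pow U"
        then have "S \<inter> insert v (nbrs V A v) = S \<inter> insert v (nbrs U A v)" using UW WV by (auto simp: nbrs_def)
        then show "p S * h v S = p S * (real (card (S \<inter> insert v (nbrs U A v)))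
        + \<kappa> v / x v * (if v \<in> S then 1 else 0) - 2)" by (simp add: h_def)
      qed simp
      then show ?thesis using p(4) v tr by simp
    qed
    moreover have "sum p \<S> = 1" using tr[of "\<lambda>_. 1"] p(3) by simp
    ultimately show ?thesis using p(1,2) by (intro exI[of _ p]) auto
  qed
  from greedy_saturation[OF fS fW this, of c x] c0 x0 obtain w where
    w: "\<forall>S. 0 \<le> w S" "sum w \<S> = c" "\<forall>v\<in>W. cover \<S> w v \<le> x v"
      "\<forall>v\<in>W. cover \<S> w v < x v \<longrightarrow> 0 \<le> (\<Sum>S\<in>\<S>. w S * h v S)"
    unfolding W_def by auto
  have sat: "cover \<S> w v = x v" if v: "v \<in> W" for v
  proof (rule ccontr)
    assume "cover \<S> w v \<noteq> x v"
    then have lt: "cover \<S> w v < x v" using w(3) v by force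
    define N where "N = insert v (nbrs V A v)"
    have fN: "finite N" using fV by (auto simp: N_def)
    have NV: "N \<subseteq> V" using v WV by (auto simp: N_def nbrs_def)
    have xv: "0 < x v" using v by (auto simp: W_def)
    \<comment> \<open>The clique with the single vertex \<open>v\<close> makes
      \<open>\<kappa> v\<close> positive, as the strict inequality below requires.\<close>
    have "sum x (insert v (nbrs V A v)) + sum x {v} \<le> 2 * c"
      using v xv WV by (intro bound) (auto simp: is_clique_def)
    then have kx: "0 < \<kappa> v" using xv by (simp add: \<kappa>_def)
    have "(\<Sum>S\<in>\<S>. w S * real (card (S \<inter> N))) = (\<Sum>S\<in>\<S>. \<Sum>u\<in>N. w S * (if u \<in> S then 1 else 0))"
      using fN by (intro sum.cong refl) (simp add: sum_distrib_left[symmetric] sum.If_cases Int_commute)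
    also have "\<dots> = (\<Sum>u\<in>N. cover \<S> w u)" unfolding cover_alt[OF fS] by (rule sum.swap)
    also have "\<dots> \<le> sum x N"
    proof (rule sum_mono)
      fix u assume u: "u \<in> N"
      show "cover \<S> w u \<le> x u"
      proof (cases "u \<in> W")
        case False
        then have "cover \<S> w u = 0" unfolding cover_def by (intro sum.neutral) (auto simp: \<S>_def)
        then show ?thesis using x0 u NV by auto
      qed (use w in auto)
    qed
    finally have 1: "(\<Sum>S\<in>\<S>. w S * real (card (S \<inter> N))) \<le> sum x N" .
    have "(\<Sum>S\<in>\<S>. w S * h v S) = (\<Sum>S\<in>\<S>. w S * real (card (S \<inter> N))) + \<kappa> v / x v * cover \<S> w v - 2 * c"
      unfolding cover_alt[OF fS] w(2)[symmetric] h_def N_def[symmetric] sum_distrib_left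
        sum.distrib[symmetric] sum_subtractf[symmetric]
      by (intro sum.cong) (auto simp: algebra_simps)
    also have "\<kappa> v / x v * cover \<S> w v < \<kappa> v / x v * x v"
      using lt kx xv by (intro mult_strict_left_mono) auto
    finally have "(\<Sum>S\<in>\<S>. w S * h v S) < sum x N + \<kappa> v - 2 * c" using 1 xv by simp
    then have "(\<Sum>S\<in>\<S>. w S * h v S) < 0" by (simp add: \<kappa>_def N_def)
    then show False using w(4) v lt by force
  qed
  define w' where "w' S = (if S \<in> \<S> then w S else 0)" for S
  have SV: "\<S> \<subseteq> Pow V" using WV by (auto simp: \<S>_def)
  have "sum w' (Pow V) = sum w' \<S>" using SV fV by (intro sum.mono_neutral_right) (auto simp: w'_def)
  then have "sum w' (Pow V) = c" using w(2) by (simp add: w'_def)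
  then have "weight_colouring V A c w'" using w(1) WV by (auto simp: weight_colouring_def w'_def \<S>_def)
  moreover have "x v \<le> cover (Pow V) w' v" if v: "v \<in> V" for v
  proof -
    have "cover (Pow V) w' v = cover \<S> w v"
      unfolding cover_alt[OF fS] using fV SV
      by (subst cover_alt) (auto simp: w'_def intro!: sum.mono_neutral_cong_right)
    moreover have "0 \<le> cover \<S> w v" unfolding cover_def using w(1) by (intro sum_nonneg) auto
    ultimately show ?thesis using sat[of v] v by (cases "v \<in> W") (auto simp: W_def)
  qed
  ultimately show ?thesis by blast
qed

section \<open>Random maximal stable sets\<close>

text \<open>Image measure of a finite weighting; it turns distributions on tuples of choices into
  distributions on stable sets.\<close>

definition push :: "'i set \<Rightarrow> ('i \<Rightarrow> 's) \<Rightarrow> ('i \<Rightarrow> real) \<Rightarrow> 's \<Rightarrow> real" where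
  "push X f p S = (\<Sum>i\<in>{i\<in>X. f i = S}. p i)"

lemma sum_push:
  assumes "finite X" "finite Y" "f ` X \<subseteq> Y"
  shows "(\<Sum>S\<in>Y. push X f p S * g S) = (\<Sum>i\<in>X. p i * g (f i))"
proof -
  have "(\<Sum>S\<in>Y. push X f p S * g S) = (\<Sum>S\<in>Y. \<Sum>i\<in>{i\<in>X. f i = S}. p i * g (f i))"
    unfolding push_def sum_distrib_right by (intro sum.cong) auto
  also have "\<dots> = (\<Sum>i\<in>X. p i * g (f i))" by (rule sum.group[OF assms])
  finally show ?thesis .
qed

lemma push_nonneg: "(\<And>i. i \<in> X \<Longrightarrow> 0 \<le> p i) \<Longrightarrow> 0 \<le> push X f p S"
  unfolding push_def by (intro sum_nonneg) auto

lemma push_nonzero: "push X f p S \<noteq> 0 \<Longrightarrow> \<exists>i\<in>X. f i = S \<and> p i \<noteq> 0"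
  unfolding push_def by (metis (mono_tags, lifting) mem_Collect_eq sum.neutral)

lemma cover_push:
  assumes "finite X" "finite Y" "f ` X \<subseteq> Y"
  shows "cover Y (push X f p) v = (\<Sum>i\<in>X. p i * (if v \<in> f i then 1 else 0))"
  unfolding cover_alt[OF assms(2)] by (rule sum_push[OF assms])

definition maximal_stable :: "'a set \<Rightarrow> ('a \<Rightarrow> 'a \<Rightarrow> bool) \<Rightarrow> 'a set \<Rightarrow> bool" where
  "maximal_stable H A S \<longleftrightarrow> S \<subseteq> H \<and> stable A S \<and> (\<forall>v\<in>H. v \<in> S \<or> (\<exists>u\<in>S. A v u))"

text \<open>As for the Caro--Wei bound: choose the first vertex uniformly at random and continue with its
  non-neighbours.\<close>

lemma maximal_stable_distribution:
  assumes "finite H" and sym: "symp A" and irr: "irreflp A"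
  shows "\<exists>p. (\<forall>S. 0 \<le> p S) \<and> (\<forall>S. p S \<noteq> 0 \<longrightarrow> maximal_stable H A S) \<and> sum p (Pow H) = 1 \<and>
     (\<forall>v\<in>H. 1 / (real (card (nbrs H A v)) + 1) \<le> cover (Pow H) p v)"
  using assms(1)
proof (induction "card H" arbitrary: H rule: less_induct)
  case (less H)
  show ?case
  proof (cases "H = {}")
    case True
    then show ?thesis
      by (intro exI[of _ "\<lambda>S. if S = {} then 1 else 0"]) (auto simp: maximal_stable_def stable_def)
  next
    case False
    define n where "n = card H"
    have n: "0 < n" using False less.prems by (simp add: n_def card_gt_0_iff)
    define R where "R u = H - insert u (nbrs H A u)" for u
    have fR: "finite (R u)" for u using less.prems by (simp add: R_def)
    have "\<exists>p. (\<forall>S. 0 \<le> p S) \<and> (\<forall>S. p S \<noteq> 0 \<longrightarrow> maximal_stable (R u) A S) \<and> sum p (Pow (R u)) = 1 \<and>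
       (\<forall>v\<in>R u. 1 / (real (card (nbrs (R u) A v)) + 1) \<le> cover (Pow (R u)) p v)" if "u \<in> H" for u
      using that less.prems by (intro less.hyps psubset_card_mono) (auto simp: R_def)
    then obtain q where q: "\<And>u. u \<in> H \<Longrightarrow> (\<forall>S. 0 \<le> q u S) \<and> (\<forall>S. q u S \<noteq> 0 \<longrightarrow> maximal_stable (R u) A S) \<and>
       sum (q u) (Pow (R u)) = 1 \<and>
       (\<forall>v\<in>R u. 1 / (real (card (nbrs (R u) A v)) + 1) \<le> cover (Pow (R u)) (q u) v)"
      by metis
    define X where "X = (SIGMA u:H. Pow (R u))"
    have fX: "finite X" unfolding X_def using less.prems fR by auto
    define p where "p = push X (\<lambda>(u, T). insert u T) (\<lambda>(u, T). q u T / n)"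
    have im: "(\<lambda>(u, T). insert u T) ` X \<subseteq> Pow H" by (auto simp: X_def R_def)
    have fP: "finite (Pow H)" using less.prems by simp
    have sX: "(\<Sum>(u, T)\<in>X. q u T / n * g u T) = (\<Sum>u\<in>H. (\<Sum>T\<in>Pow (R u). q u T * g u T) / n)" for g :: "'a \<Rightarrow> 'a set \<Rightarrow> real"
      unfolding X_def using less.prems fR by (subst sum.Sigma[symmetric]) (auto simp: sum_divide_distrib)
    have "sum p (Pow H) = 1"
      using sum_push[OF fX fP im, of "\<lambda>(u, T). q u T / n" "\<lambda>_. 1"] sX[of "\<lambda>_ _. 1"] q n
      by (simp add: p_def case_prod_unfold n_def)
    moreover have "0 \<le> p S" for S
      unfolding p_def using q by (intro push_nonneg) (auto simp: X_def)
    moreover have "maximal_stable H A S" if pS: "p S \<noteq> 0" for S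
    proof -
      obtain u T where u: "u \<in> H" "T \<subseteq> R u" "S = insert u T" "q u T \<noteq> 0"
        using push_nonzero[OF pS[unfolded p_def]] by (auto simp: X_def)
      then have mT: "maximal_stable (R u) A T" using q by blast
      have "v \<in> S \<or> (\<exists>s\<in>S. A v s)" if "v \<in> H" for v
        using that mT sym u(1,3) unfolding maximal_stable_def R_def nbrs_def symp_def by blast
      moreover have "stable A S" unfolding stable_def
        using mT sym irr u unfolding maximal_stable_def stable_def R_def nbrs_def symp_def irreflp_def by blast
      moreover have "S \<subseteq> H" using u by (auto simp: R_def)
      ultimately show ?thesis by (auto simp: maximal_stable_def)
    qed
    moreover have "1 / (real (card (nbrs H A v)) + 1) \<le> cover (Pow H) p v" if v: "v \<in> H" for v
    proof -
      define d where "d = card (nbrs H A v)"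
      have vn: "v \<notin> nbrs H A v" using irr by (auto simp: nbrs_def irreflp_def)
      have cov: "cover (Pow H) p v = (\<Sum>u\<in>H. (\<Sum>T\<in>Pow (R u). q u T * (if v \<in> insert u T then 1 else 0)) / n)"
        unfolding p_def cover_push[OF fX fP im] using sX[of "\<lambda>u T. if v \<in> insert u T then 1 else 0"]
        by (simp add: case_prod_unfold)
      \<comment> \<open>Lower bound for the chance of \<open>v\<close> when \<open>u\<close> comes
        first: certain for \<open>v\<close> itself, lost for a neighbour, and otherwise given by
        induction, as the degree of \<open>v\<close> can only drop. The mean over \<open>u\<close>
        is exactly 1 / (d + 1).\<close>
      define g where "g u = (if u = v then 1 else if u \<in> nbrs H A v then 0 else 1 / (real d + 1))" for u
      have "g u \<le> (\<Sum>T\<in>Pow (R u). q u T * (if v \<in> insert u T then 1 else 0))" if u: "u \<in> H" for u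
      proof (cases "u = v \<or> u \<in> nbrs H A v")
        case True
        then show ?thesis using q[OF u] vn by (auto simp: g_def intro!: sum_nonneg)
      next
        case False
        then have vR: "v \<in> R u" using u v sym by (auto simp: R_def nbrs_def symp_def)
        have "card (nbrs (R u) A v) \<le> d" unfolding d_def using less.prems
          by (intro card_mono) (auto simp: nbrs_def R_def)
        then have "1 / (real d + 1) \<le> 1 / (real (card (nbrs (R u) A v)) + 1)" by (simp add: field_simps)
        also have "\<dots> \<le> cover (Pow (R u)) (q u) v" using q[OF u] vR by auto
        also have "\<dots> = (\<Sum>T\<in>Pow (R u). q u T * (if v \<in> insert u T then 1 else 0))"
          using False fR by (subst cover_alt) auto
        finally show ?thesis using False by (simp add: g_def)
      qed
      then have "(\<Sum>u\<in>H. g u / n) \<le> cover (Pow H) p v"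
        unfolding cov by (intro sum_mono divide_right_mono) auto
      moreover have "(\<Sum>u\<in>H. g u) = 1 + (real n - 1 - real d) / (real d + 1)"
      proof -
        have "(\<Sum>u\<in>H. g u) = g v + (\<Sum>u\<in>H - {v}. g u)" using v less.prems by (simp add: sum.remove)
        also have "(\<Sum>u\<in>H - {v}. g u) = (\<Sum>u\<in>H - {v} - nbrs H A v. 1 / (real d + 1))"
          using less.prems by (intro sum.mono_neutral_cong_right) (auto simp: g_def)
        also have "\<dots> = real (card (H - {v} - nbrs H A v)) / (real d + 1)" by simp
        also have "card (H - {v} - nbrs H A v) = n - 1 - d"
          unfolding d_def n_def using less.prems v vn
          by (subst card_Diff_subset) (auto simp: nbrs_def)
        also have "d \<le> n - 1" unfolding d_def n_def
          using less.prems v vn card_mono[of "H - {v}" "nbrs H A v"] by (auto simp: nbrs_def)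
        then have "real (n - 1 - d) = real n - 1 - real d" using n by simp
        finally show ?thesis by (simp add: g_def)
      qed
      moreover have "1 + (real n - 1 - real d) / (real d + 1) = real n / (real d + 1)"
        by (simp add: field_simps)
      ultimately show ?thesis using n by (simp add: sum_divide_distrib[symmetric] d_def)
    qed
    ultimately show ?thesis by (intro exI[of _ p]) blast
  qed
qed

section \<open>Fractional independent transversals\<close>

definition transversal :: "('a \<Rightarrow> 'a \<Rightarrow> bool) \<Rightarrow> ('a \<Rightarrow> 'i) \<Rightarrow> 'a set \<Rightarrow> 'i set \<Rightarrow> 'a set \<Rightarrow> bool" where
  "transversal A cl U I T \<longleftrightarrow> T \<subseteq> U \<and> inj_on cl T \<and> cl ` T = I \<and> stable A T"

text \<open>Choose a vertex \<open>x\<close> of class \<open>i0\<close> and a transversal of the other classes so that \<open>x\<close> has as few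
  neighbours \<open>Y\<close> in it as possible. Delete all vertices dominated by this star, merge the classes of \<open>Y\<close>
  into \<open>i0\<close>, and use induction.\<close>

lemma constellation:
  assumes "finite I" and "finite U" and sym: "symp A" and irr: "irreflp A"
    and "i0 \<in> I" and "\<nexists>T. transversal A cl U I T" and "\<exists>T. transversal A cl U (I - {i0}) T"
  shows "\<exists>B L D. i0 \<in> B \<and> B \<subseteq> I \<and> L \<subseteq> U \<and> inj_on cl L \<and> cl ` L = B - {i0} \<and> L \<subseteq> D \<and> D \<subseteq> U \<and>
    card D \<le> 2 * card L \<and> (\<forall>u\<in>U. cl u \<in> B \<longrightarrow> (\<exists>d\<in>D. A u d)) \<and> (\<forall>l\<in>L. \<exists>d\<in>D - L. nbrs D A l = {d})"
  using assms(1,2,5-)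
proof (induction "card I" arbitrary: I U cl rule: less_induct)
  case (less I U cl)
  have adj_sym: "A u v \<Longrightarrow> A v u" for u v using sym by (auto simp: symp_def)
  show ?case
  proof (cases "\<exists>x\<in>U. cl x = i0")
    case False
    \<comment> \<open>Without vertices of class \<open>i0\<close> the empty constellation dominates
      that class vacuously.\<close>
    then show ?thesis using less.prems(3)
      by (intro exI[of _ "{i0}"] exI[of _ "{}"]) auto
  next
    case True
    define Q where "Q = (\<lambda>(x, T). x \<in> U \<and> cl x = i0 \<and> transversal A cl U (I - {i0}) T)"
    have "\<exists>z. Q z" using True less.prems(5) by (auto simp: Q_def)
    then obtain z where z: "Q z" and zmin: "\<And>z'. Q z' \<Longrightarrow> card (nbrs (snd z) A (fst z)) \<le> card (nbrs (snd z') A (fst z'))"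
      using ex_has_least_nat[of Q _ "\<lambda>z. card (nbrs (snd z) A (fst z))"] by blast
    obtain x T where zxT: "z = (x, T)" by force
    have x: "x \<in> U" "cl x = i0" and T: "transversal A cl U (I - {i0}) T"
      using z by (auto simp: Q_def zxT)
    have mn: "card (nbrs T A x) \<le> card (nbrs T' A x)" if "transversal A cl U (I - {i0}) T'" for T'
      using zmin[of "(x, T')"] that x by (simp add: Q_def zxT)
    have TU: "T \<subseteq> U" "inj_on cl T" "cl ` T = I - {i0}" "stable A T" using T by (auto simp: transversal_def)
    have fT: "finite T" using TU less.prems(2) finite_subset by blast
    define Y where "Y = nbrs T A x"
    have YT: "Y \<subseteq> T" by (auto simp: Y_def nbrs_def)
    have fY: "finite Y" using YT fT finite_subset by blast
    have Yx: "A x y" "A y x" if "y \<in> Y" for y using that adj_sym by (auto simp: Y_def nbrs_def)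
    have Yne: "Y \<noteq> {}"
    proof
      assume e: "Y = {}"
      have "transversal A cl U I (insert x T)" unfolding transversal_def
      proof (intro conjI)
        show "inj_on cl (insert x T)" using TU x less.prems(3) by (auto simp: image_iff)
        show "cl ` insert x T = I" using TU x less.prems(3) by auto
        show "stable A (insert x T)" using TU(4) e adj_sym irr
          by (auto simp: stable_def Y_def nbrs_def irreflp_def)
      qed (use TU x in auto)
      then show False using less.prems(4) by blast
    qed
    define U' where "U' = {u\<in>U. \<not> A x u \<and> (\<forall>y\<in>Y. \<not> A y u)}"
    define cl' where "cl' u = (if cl u \<in> cl ` Y then i0 else cl u)" for u
    define I' where "I' = I - cl ` Y"
    have clY: "cl ` Y \<subseteq> I - {i0}" using image_mono[OF YT, of cl] TU by simp
    have i0I': "i0 \<in> I'" using clY less.prems(3) by (auto simp: I'_def)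
    have xU': "x \<notin> U'" using Yne Yx by (auto simp: U'_def)
    have YU': "Y \<inter> U' = {}" using Yx by (auto simp: U'_def)
    have lt: "card I' < card I" unfolding I'_def using Yne clY less.prems(1)
      by (intro psubset_card_mono) auto
    have stY: "\<not> A u v" if "u \<in> T" "v \<in> T" for u v using TU that by (auto simp: stable_def)
    \<comment> \<open>Let \<open>w\<close> represent the merged class. If its original class is
      \<open>i0\<close>, adding \<open>Y\<close> yields a full transversal. Otherwise it has the
      class of some \<open>y\<close> in \<open>Y\<close>, and adding \<open>Y - {y}\<close> yields a
      transversal of the other classes with fewer neighbours of \<open>x\<close>, against the choice
      of \<open>T\<close>.\<close>
    have noIT: "\<nexists>T'. transversal A cl' U' I' T'"
    proof
      assume "\<exists>T'. transversal A cl' U' I' T'"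
      then obtain T' where T': "T' \<subseteq> U'" "inj_on cl' T'" "cl' ` T' = I'" "stable A T'"
        by (auto simp: transversal_def)
      obtain w where w: "w \<in> T'" "cl' w = i0" using T'(3) i0I' by (auto simp: image_iff)
      have other: "cl v = cl' v" "cl v \<notin> cl ` Y" "cl v \<noteq> i0" if "v \<in> T'" "v \<noteq> w" for v
      proof -
        have "cl' v \<noteq> i0" using that w T'(2) by (auto simp: inj_on_def)
        then show "cl v = cl' v" "cl v \<notin> cl ` Y" "cl v \<noteq> i0" by (auto simp: cl'_def split: if_splits)
      qed
      have stab_un: "stable A (T' \<union> Y)"
        using T'(1,4) stY YT adj_sym unfolding stable_def U'_def by blast
      have T'U: "T' \<subseteq> U" using T'(1) by (auto simp: U'_def)
      show False
      proof (cases "cl w \<in> cl ` Y")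
        case False
        have cleq: "cl v = cl' v \<and> cl v \<notin> cl ` Y" if "v \<in> T'" for v
          using that other False by (cases "v = w") (auto simp: cl'_def)
        have "inj_on cl T'" using T'(2) cleq by (auto simp: inj_on_def)
        moreover have "cl ` T' = cl' ` T'" by (rule image_cong[OF refl]) (use cleq in blast)
        then have "cl ` T' = I'" using T'(3) by simp
        moreover have "cl ` (T' \<union> Y) = I" unfolding image_Un \<open>cl ` T' = I'\<close> using clY by (auto simp: I'_def)
        moreover have "inj_on cl Y" using TU(2) YT inj_on_subset by blast
        moreover have "\<forall>v\<in>T'. cl v \<notin> cl ` Y" using cleq by blast
        then have "cl ` (T' - Y) \<inter> cl ` (Y - T') = {}" by blast
        ultimately have "transversal A cl U I (T' \<union> Y)"
          unfolding transversal_def inj_on_Un using stab_un T'U YT TU(1) by simp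
        then show False using less.prems(4) by blast
      next
        case True
        then obtain y where y: "y \<in> Y" "cl y = cl w" by auto
        define T2 where "T2 = T' \<union> (Y - {y})"
        have inj': "inj_on cl T'"
        proof (rule inj_onI)
          fix u v assume uv: "u \<in> T'" "v \<in> T'" "cl u = cl v"
          then show "u = v" using other T'(2) True by (metis inj_onD)
        qed
        have injY: "inj_on cl Y" using TU(2) YT inj_on_subset by blast
        have im': "cl ` T' = insert (cl w) (I' - {i0})"
        proof -
          have "cl ` T' = insert (cl w) (cl ` (T' - {w}))" using w by auto
          also have "cl ` (T' - {w}) = cl' ` (T' - {w})" using other by (intro image_cong) auto
          also have "\<dots> = I' - {i0}" using T'(2,3) w by (auto simp: inj_on_def)
          finally show ?thesis .
        qed
        have imY: "cl ` (Y - {y}) = cl ` Y - {cl y}" using injY y by (auto simp: inj_on_def)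
        have dj: "cl ` T' \<inter> cl ` (Y - {y}) = {}" unfolding im' imY using y by (auto simp: I'_def)
        have "transversal A cl U (I - {i0}) T2"
          unfolding transversal_def
        proof (intro conjI)
          show "T2 \<subseteq> U" using T'U YT TU by (auto simp: T2_def)
          show "inj_on cl T2" unfolding T2_def inj_on_Un using inj' injY dj by (auto intro: inj_on_subset)
          show "cl ` T2 = I - {i0}" unfolding T2_def image_Un im' imY using clY y
            by (auto simp: I'_def)
          show "stable A T2" using stab_un by (rule stable_subset) (auto simp: T2_def)
        qed
        from mn[OF this] have "card Y \<le> card (nbrs T2 A x)" by (simp add: Y_def)
        also have "nbrs T2 A x \<subseteq> Y - {y}" using T'(1) by (auto simp: T2_def nbrs_def U'_def)
        then have "card (nbrs T2 A x) \<le> card (Y - {y})" using fY by (intro card_mono) auto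
        finally show False using y fY by (metis card_Diff1_less not_less)
      qed
    qed
    have "transversal A cl' U' (I' - {i0}) (T - Y)"
      unfolding transversal_def
    proof (intro conjI)
      have cleq: "cl' v = cl v \<and> cl v \<notin> cl ` Y" if "v \<in> T - Y" for v
        using that TU(2) YT by (auto simp: cl'_def inj_on_def)
      show "T - Y \<subseteq> U'" using TU stY YT by (auto simp: U'_def Y_def nbrs_def)
      show "inj_on cl' (T - Y)" using TU(2) cleq by (auto simp: inj_on_def)
      have "cl' ` (T - Y) = cl ` (T - Y)" using cleq by (intro image_cong) auto
      also have "\<dots> = cl ` T - cl ` Y" using TU(2) YT by (auto simp: inj_on_def)
      finally show "cl' ` (T - Y) = I' - {i0}" using TU by (auto simp: I'_def)
      show "stable A (T - Y)" using TU(4) by (rule stable_subset) auto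
    qed
    then have "\<exists>T. transversal A cl' U' (I' - {i0}) T" by blast
    from less.hyps[OF lt _ _ i0I' noIT this] less.prems(1,2)
    obtain B' L' D' where B': "i0 \<in> B'" "B' \<subseteq> I'" "L' \<subseteq> U'" "inj_on cl' L'" "cl' ` L' = B' - {i0}"
      "L' \<subseteq> D'" "D' \<subseteq> U'" "card D' \<le> 2 * card L'" "\<forall>u\<in>U'. cl' u \<in> B' \<longrightarrow> (\<exists>d\<in>D'. A u d)"
      "\<forall>l\<in>L'. \<exists>d\<in>D' - L'. nbrs D' A l = {d}" by (auto simp: I'_def U'_def)
    have U'U: "U' \<subseteq> U" by (auto simp: U'_def)
    have "finite D'" using finite_subset[OF B'(7)] finite_subset[OF U'U less.prems(2)] by blast
    then have fin: "finite L'" "finite D'" using finite_subset[OF B'(6)] by auto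
    have clL: "cl l = cl' l \<and> cl l \<notin> cl ` Y" if "l \<in> L'" for l
      using that B'(5) by (auto simp: cl'_def split: if_splits)
    have "cl ` L' = cl' ` L'" by (rule image_cong[OF refl]) (use clL in blast)
    then have clL': "cl ` L' = B' - {i0}" using B'(5) by simp
    define L where "L = L' \<union> Y"
    \<comment> \<open>One more star with centre \<open>x\<close> and leaves \<open>Y\<close>. As
      \<open>Y\<close> is nonempty, a star has at most twice as many vertices as leaves; as
      \<open>U'\<close> avoids all neighbours of the star, a leaf still sees only its own
      centre.\<close>
    define D where "D = D' \<union> insert x Y"
    define B where "B = B' \<union> cl ` Y"
    have D'x: "\<not> A d x" "\<not> A x d" "\<not> A d y" "\<not> A y d" if "d \<in> D'" "y \<in> Y" for d y
      using that B'(7) adj_sym by (auto simp: U'_def)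
    have "inj_on cl L" unfolding L_def inj_on_Un
    proof (intro conjI)
      show "inj_on cl L'" using B'(4) clL by (auto simp: inj_on_def)
      show "inj_on cl Y" using TU(2) YT inj_on_subset by blast
      have "\<forall>l\<in>L'. cl l \<notin> cl ` Y" using clL by blast
      then show "cl ` (L' - Y) \<inter> cl ` (Y - L') = {}" by blast
    qed
    moreover have "cl ` L = B - {i0}" unfolding L_def B_def image_Un clL' using clY by auto
    moreover have "card D \<le> 2 * card L"
    proof -
      have "card D \<le> card D' + card (insert x Y)" unfolding D_def by (rule card_Un_le)
      also have "card (insert x Y) \<le> card Y + 1" using fY by (simp add: card_insert_if)
      also have "1 \<le> card Y" using Yne fY by (simp add: Suc_le_eq card_gt_0_iff)
      then have "card D' + (card Y + 1) \<le> 2 * (card L' + card Y)" using B'(8) by simp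
      also have "card L' + card Y = card L" unfolding L_def
        using fin fY YU' B'(3) by (intro card_Un_disjoint[symmetric]) auto
      finally show ?thesis by simp
    qed
    moreover have "\<exists>d\<in>D. A u d" if u: "u \<in> U" "cl u \<in> B" for u
    proof (cases "u \<in> U'")
      case True
      have "cl' u \<in> B'" using u(2) B'(1) by (auto simp: B_def cl'_def)
      then show ?thesis using B'(9) True by (auto simp: D_def)
    next
      case False
      then show ?thesis using u adj_sym by (auto simp: U'_def D_def)
    qed
    moreover have "\<exists>d\<in>D - L. nbrs D A l = {d}" if l: "l \<in> L" for l
    proof (cases "l \<in> L'")
      case True
      then obtain d where d: "d \<in> D' - L'" "nbrs D' A l = {d}" using B'(10) by blast
      have "nbrs D A l = nbrs D' A l" using True D'x B'(6) Yne by (auto simp: D_def nbrs_def)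
      moreover have "d \<in> D - L" using d YU' B'(7) by (auto simp: D_def L_def)
      ultimately show ?thesis using d by auto
    next
      case False
      then have lY: "l \<in> Y" using l by (auto simp: L_def)
      have "nbrs D A l = {x}" using lY D'x Yx stY YT unfolding D_def nbrs_def by blast
      moreover have "x \<in> D - L" using xU' B'(3) irr Yx by (auto simp: D_def L_def irreflp_def)
      ultimately show ?thesis by auto
    qed
    moreover have "i0 \<in> B" using B'(1) by (simp add: B_def)
    moreover have "B \<subseteq> I" using B'(2) clY unfolding B_def I'_def by blast
    moreover have "L \<subseteq> U" using B'(3) U'U YT TU(1) unfolding L_def by blast
    moreover have "L \<subseteq> D" using B'(6) unfolding L_def D_def by blast
    moreover have "D \<subseteq> U" using B'(7) U'U YT TU(1) x(1) unfolding D_def by blast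
    ultimately show ?thesis by (intro exI[of _ B] exI[of _ L] exI[of _ D] conjI ballI impI)
  qed
qed

lemma sum_card_nbrs_swap:
  assumes "finite S" "finite D" "symp A"
  shows "(\<Sum>u\<in>S. card (nbrs D A u)) = (\<Sum>d\<in>D. card (nbrs S A d))"
proof -
  have "(\<Sum>u\<in>S. card (nbrs D A u)) = (\<Sum>u\<in>S. \<Sum>d\<in>D. if A u d then 1 else 0)"
    using assms(2) by (intro sum.cong refl) (simp add: nbrs_def sum.If_cases Collect_conj_eq)
  also have "\<dots> = (\<Sum>d\<in>D. \<Sum>u\<in>S. if A u d then 1 else 0)" by (rule sum.swap)
  also have "\<dots> = (\<Sum>d\<in>D. card (nbrs S A d))"
  proof (intro sum.cong refl)
    fix d
    have "(\<Sum>u\<in>S. if A u d then 1 else 0) = (\<Sum>u\<in>S. if A d u then 1 else (0::nat))"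
      using assms(3) by (intro sum.cong) (auto simp: symp_def)
    then show "(\<Sum>u\<in>S. if A u d then 1 else 0) = card (nbrs S A d)"
      using assms(1) by (simp add: nbrs_def sum.If_cases Collect_conj_eq)
  qed
  finally show ?thesis .
qed

text \<open>Every leaf outside of a transversal that cannot be swapped into it has a neighbour in it,
  so a suitable transversal sends at least as many edges to the constellation as there are leaves.\<close>

lemma transversal_int_weight:
  fixes w :: "'a \<Rightarrow> int"
  assumes fI: "finite I" and fU: "finite U" and sym: "symp A" and irr: "irreflp A"
    and clU: "cl ` U \<subseteq> I" and size: "\<And>i. i \<in> I \<Longrightarrow> card {u\<in>U. cl u = i} = 2 * D"
    and deg: "\<And>u. u \<in> U \<Longrightarrow> card (nbrs U A u) \<le> D" and D: "0 < D"
  shows "\<exists>T. transversal A cl U I T \<and> sum w U \<le> 2 * int D * sum w T"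
proof -
  define C where "C i = {u\<in>U. cl u = i}" for i
  have fC: "finite (C i)" for i using fU by (auto simp: C_def)
  have neC: "C i \<noteq> {}" if "i \<in> I" for i
  proof
    assume "C i = {}"
    then have "card {u\<in>U. cl u = i} = 0" unfolding C_def by (simp only: card.empty)
    then show False using size[OF that] D by simp
  qed
  define m where "m w i = Max (w ` C i)" for w :: "'a \<Rightarrow> int" and i
  have m_ge: "w u \<le> m w (cl u)" if "u \<in> U" for w u
    unfolding m_def using that fC by (intro Max_ge) (auto simp: C_def)
  have m_less: "m w i \<le> k" if "i \<in> I" "\<And>u. u \<in> U \<Longrightarrow> cl u = i \<Longrightarrow> w u \<le> k" for w i k
    unfolding m_def using that fC neC by (subst Max_le_iff) (auto simp: C_def)
  have sumC: "sum w U = (\<Sum>i\<in>I. sum w (C i))" for w :: "'a \<Rightarrow> int"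
    unfolding C_def by (rule sum.group[OF fU fI clU, symmetric])
  have sumle: "sum w U \<le> 2 * int D * (\<Sum>i\<in>I. m w i)" for w
  proof -
    have "sum w (C i) \<le> 2 * int D * m w i" if "i \<in> I" for i
    proof -
      have "sum w (C i) \<le> of_nat (card (C i)) * m w i"
        using m_ge by (intro sum_bounded_above) (auto simp: C_def)
      then show ?thesis using size[OF that] by (simp add: C_def)
    qed
    then show ?thesis unfolding sumC sum_distrib_left by (intro sum_mono)
  qed
  show ?thesis
  \<comment> \<open>The measure is the gap in \<open>sumle\<close>. It must be a natural number to
    descend on, hence the integer weights.\<close>
  proof (induction "nat (2 * int D * (\<Sum>i\<in>I. m w i) - sum w U)" arbitrary: w rule: less_induct)
    case (less w)
    define Us where "Us = {u\<in>U. w u = m w (cl u)}"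
    have UsU: "Us \<subseteq> U" and fUs: "finite Us" using fU by (auto simp: Us_def)
    show ?case
    proof (cases "\<exists>T. transversal A cl Us I T")
      case True
      then obtain T where T: "T \<subseteq> Us" "inj_on cl T" "cl ` T = I" "stable A T" by (auto simp: transversal_def)
      have "sum w T = (\<Sum>u\<in>T. m w (cl u))" using T(1) by (intro sum.cong) (auto simp: Us_def)
      also have "\<dots> = (\<Sum>i\<in>I. m w i)" using T by (metis sum.reindex_cong)
      finally show ?thesis using sumle[of w] T UsU by (auto simp: transversal_def intro!: exI[of _ T])
    next
      case False
      \<comment> \<open>A minimal set of classes without a transversal of vertices of maximum
        weight: dropping any class restores a transversal, as \<open>constellation\<close>
        requires.\<close>
      define fam where "fam = {J. J \<subseteq> I \<and> \<not> (\<exists>T. transversal A cl Us J T)}"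
      have "finite fam" "I \<in> fam" using fI False by (auto simp: fam_def)
      then obtain J where J: "J \<in> fam" and Jmin: "\<And>J'. J' \<in> fam \<Longrightarrow> J' \<subseteq> J \<Longrightarrow> J' = J"
        using finite_has_minimal2[of fam I] by blast
      have JI: "J \<subseteq> I" and noJ: "\<nexists>T. transversal A cl Us J T" using J by (auto simp: fam_def)
      have "transversal A cl Us {} {}" by (simp add: transversal_def stable_def)
      then have "J \<noteq> {}" using noJ by blast
      then obtain i0 where i0: "i0 \<in> J" by blast
      have "J - {i0} \<notin> fam" using Jmin[of "J - {i0}"] i0 by blast
      then have "\<exists>T. transversal A cl Us (J - {i0}) T" using JI by (auto simp: fam_def)
      from constellation[OF finite_subset[OF JI fI] fUs sym irr i0 noJ this]
      obtain B L Dm where con: "i0 \<in> B" "B \<subseteq> J" "L \<subseteq> Us" "inj_on cl L" "cl ` L = B - {i0}" "L \<subseteq> Dm"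
        "Dm \<subseteq> Us" "card Dm \<le> 2 * card L" "\<forall>u\<in>Us. cl u \<in> B \<longrightarrow> (\<exists>d\<in>Dm. A u d)"
        "\<forall>l\<in>L. \<exists>d\<in>Dm - L. nbrs Dm A l = {d}" by blast
      have fDm: "finite Dm" using finite_subset[OF con(7) fUs] .
      have fL: "finite L" using finite_subset[OF con(6) fDm] .
      have BI: "B \<subseteq> I" using con(2) JI by simp
      have fB: "finite B" using finite_subset[OF BI fI] .
      have cardB: "card B = card L + 1"
        using card_image[OF con(4)] card.remove[OF fB con(1)] con(5) by simp
      \<comment> \<open>Every vertex pays for its edges into the constellation. Each class in
        \<open>B\<close> loses at least one from its maximum, so the upper bound drops by at least
        2D(card L + 1), but the total weight by at most D card Dm, hence at most 2D card L. The gap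
        shrinks.\<close>
      define w' where "w' u = w u - int (card (nbrs Dm A u))" for u
      have "(\<Sum>u\<in>U. int (card (nbrs Dm A u))) = (\<Sum>d\<in>Dm. int (card (nbrs U A d)))"
        using sum_card_nbrs_swap[OF fU fDm sym] by (metis of_nat_sum)
      also have "\<dots> \<le> int (card Dm) * int D"
        using deg con(7) UsU by (intro sum_bounded_above) auto
      also have "\<dots> \<le> (2 * int (card L)) * int D" using con(8) by (intro mult_right_mono) auto
      finally have w'U: "sum w U - 2 * int D * int (card L) \<le> sum w' U"
        by (simp add: w'_def sum_subtractf algebra_simps)
      have mB: "m w' i \<le> m w i - (if i \<in> B then 1 else 0)" if i: "i \<in> I" for i
      proof (rule m_less[OF i])
        fix u assume u: "u \<in> U" "cl u = i"
        have le: "w u \<le> m w i" using m_ge[OF u(1)] u by simp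
        show "w' u \<le> m w i - (if i \<in> B then 1 else 0)"
        proof (cases "i \<in> B \<and> w u = m w i")
          case True
          then have "\<exists>d\<in>Dm. A u d" using con(9) u by (auto simp: Us_def)
          then have "nbrs Dm A u \<noteq> {}" by (auto simp: nbrs_def)
          then have "1 \<le> card (nbrs Dm A u)" using fDm by (simp add: Suc_le_eq card_gt_0_iff)
          then show ?thesis using le by (simp add: w'_def)
        next
          case False
          then show ?thesis using le by (auto simp: w'_def)
        qed
      qed
      have "(\<Sum>i\<in>I. m w' i) \<le> (\<Sum>i\<in>I. m w i - (if i \<in> B then 1 else 0))"
        using mB by (intro sum_mono)
      also have "\<dots> = (\<Sum>i\<in>I. m w i) - int (card B)"
        using fI BI by (simp add: sum_subtractf sum.If_cases Int_absorb1)
      finally have "2 * int D * (\<Sum>i\<in>I. m w' i) \<le> 2 * int D * ((\<Sum>i\<in>I. m w i) - (int (card L) + 1))"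
        using cardB by (intro mult_left_mono) auto
      then have "2 * int D * (\<Sum>i\<in>I. m w' i) - sum w' U < 2 * int D * (\<Sum>i\<in>I. m w i) - sum w U"
        using w'U D by (simp add: algebra_simps)
      moreover have "0 \<le> 2 * int D * (\<Sum>i\<in>I. m w' i) - sum w' U" using sumle[of w'] by simp
      ultimately have "nat (2 * int D * (\<Sum>i\<in>I. m w' i) - sum w' U) < nat (2 * int D * (\<Sum>i\<in>I. m w i) - sum w U)"
        by simp
      from less.hyps[OF this] obtain S0 where S0: "transversal A cl U I S0" "sum w' U \<le> 2 * int D * sum w' S0"
        by blast
      \<comment> \<open>Among the transversals that suffice for \<open>w'\<close>, take one with the
        most leaves. A leaf outside of it without neighbour in it could replace the vertex of its
        class without lowering \<open>w'\<close>, so there is no such leaf.\<close>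
      define good where "good S \<longleftrightarrow> transversal A cl U I S \<and> sum w' U \<le> 2 * int D * sum w' S" for S
      have "good S \<Longrightarrow> card (S \<inter> L) \<le> card L" for S using fL by (intro card_mono) auto
      then obtain S where S: "good S" and Smax: "\<And>S'. good S' \<Longrightarrow> card (S' \<inter> L) \<le> card (S \<inter> L)"
        using S0 ex_has_greatest_nat[of good S0 "\<lambda>S. card (S \<inter> L)" "card L + 1"]
        by (auto simp: good_def less_Suc_eq_le)
      have ST: "S \<subseteq> U" "inj_on cl S" "cl ` S = I" "stable A S" and Sw: "sum w' U \<le> 2 * int D * sum w' S"
        using S by (auto simp: good_def transversal_def)
      have fS: "finite S" using finite_subset[OF ST(1) fU] .
      have sw: "l \<in> S \<or> (\<exists>s\<in>S. A s l)" if l: "l \<in> L" for l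
      proof (rule ccontr)
        assume "\<not> ?thesis"
        then have n: "l \<notin> S" "\<forall>s\<in>S. \<not> A s l" by auto
        have lU: "l \<in> Us" "cl l \<in> B" using l con by auto
        then obtain s where s: "s \<in> S" "cl s = cl l" using ST BI by (metis image_iff subsetD)
        define S2 where "S2 = insert l (S - {s})"
        have "transversal A cl U I S2" unfolding transversal_def
        proof (intro conjI)
          show "S2 \<subseteq> U" using ST lU UsU by (auto simp: S2_def)
          show "inj_on cl S2" using ST(2) s by (auto simp: S2_def inj_on_def)
          have "cl ` S2 = cl ` insert s (S - {s})" unfolding S2_def image_insert s(2) ..
          then show "cl ` S2 = I" unfolding insert_Diff[OF s(1)] using ST(3) by simp
          show "stable A S2" using ST(4) n sym irr by (auto simp: S2_def stable_def symp_def irreflp_def)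
        qed
        \<comment> \<open>A leaf has one neighbour in \<open>Dm\<close>, so its weight is only one
          below the old class maximum, which is at least the new class maximum.\<close>
        moreover have "w' s \<le> w' l"
        proof -
          obtain d where "nbrs Dm A l = {d}" using con(10) l by blast
          then have "w' l = m w (cl l) - 1" using lU by (simp add: w'_def Us_def)
          moreover have "w' s \<le> m w' (cl l)" using m_ge[of s w'] s ST by auto
          ultimately show ?thesis using mB[of "cl l"] lU BI by auto
        qed
        then have "sum w' S \<le> sum w' S2"
          unfolding S2_def using n fS s by (simp add: sum.remove[of S s])
        then have "2 * int D * sum w' S \<le> 2 * int D * sum w' S2" by (intro mult_left_mono) auto
        ultimately have "good S2" using Sw by (auto simp: good_def)
        moreover have "s \<notin> L" using s l n con(4) by (auto simp: inj_on_def)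
        then have "S2 \<inter> L = insert l (S \<inter> L)" using l by (auto simp: S2_def)
        ultimately show False using Smax[of S2] n fS by simp
      qed
      \<comment> \<open>Edges from \<open>S\<close> into the constellation. A leaf in
        \<open>S\<close> is charged to the edge to its centre, a leaf outside to some edge ending in
        it; the second endpoint tells the two kinds apart, so there are at least
        \<open>card L\<close> edges, which make up for the passage from \<open>w\<close> to
        \<open>w'\<close>.\<close>
      define E where "E = (SIGMA s:S. nbrs Dm A s)"
      have fE: "finite E" unfolding E_def using fS fDm fL by auto
      have "\<exists>e\<in>E. (l \<in> S \<longrightarrow> fst e = l \<and> snd e \<notin> L) \<and> (l \<notin> S \<longrightarrow> snd e = l)" if l: "l \<in> L" for l
      proof (cases "l \<in> S")
        case True
        obtain d where "d \<in> Dm - L" "nbrs Dm A l = {d}" using con(10) l by blast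
        then show ?thesis using True by (intro bexI[of _ "(l, d)"]) (auto simp: E_def)
      next
        case False
        then obtain s where "s \<in> S" "A s l" using sw[OF l] by blast
        then show ?thesis using False l con(6) by (intro bexI[of _ "(s, l)"]) (auto simp: E_def nbrs_def)
      qed
      then obtain e where e: "\<And>l. l \<in> L \<Longrightarrow> e l \<in> E \<and> (l \<in> S \<longrightarrow> fst (e l) = l \<and> snd (e l) \<notin> L) \<and> (l \<notin> S \<longrightarrow> snd (e l) = l)"
        by metis
      have "inj_on e L"
        by (rule inj_onI) (metis e)
      then have "card L \<le> card E" using e fE by (intro card_inj_on_le[of e]) auto
      also have "card E = (\<Sum>s\<in>S. card (nbrs Dm A s))" unfolding E_def using fS fDm by (simp add: card_SigmaI)
      finally have "int (card L) \<le> (\<Sum>s\<in>S. int (card (nbrs Dm A s)))" by (metis of_nat_mono of_nat_sum)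
      then have "sum w' S + int (card L) \<le> sum w S" by (simp add: w'_def sum_subtractf)
      then have "2 * int D * (sum w' S + int (card L)) \<le> 2 * int D * sum w S" by (intro mult_left_mono) auto
      then have "sum w U \<le> 2 * int D * sum w S" using Sw w'U by (simp add: algebra_simps)
      then show ?thesis using S by (auto simp: good_def)
    qed
  qed
qed

text \<open>Rounding \<open>n * w\<close> down costs at most one per vertex, so after division by
  \<open>n\<close> the error is at most \<open>card U / n\<close>. There are finitely many
  transversals, so one of maximum weight serves all \<open>n\<close>, and the error
  vanishes.\<close>

lemma transversal_real_weight:
  fixes w :: "'a \<Rightarrow> real"
  assumes fI: "finite I" and fU: "finite U" and sym: "symp A" and irr: "irreflp A"
    and clU: "cl ` U \<subseteq> I" and size: "\<And>i. i \<in> I \<Longrightarrow> card {u\<in>U. cl u = i} = 2 * D"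
    and deg: "\<And>u. u \<in> U \<Longrightarrow> card (nbrs U A u) \<le> D" and D: "0 < D"
  shows "\<exists>T. transversal A cl U I T \<and> sum w U \<le> 2 * real D * sum w T"
proof -
  note int_weight = transversal_int_weight[OF fI fU sym irr clU size deg D]
  define X where "X = {T. transversal A cl U I T}"
  have fX: "finite X" using fU by (auto simp: X_def transversal_def intro: finite_subset[of _ "Pow U"])
  have neX: "X \<noteq> {}" using int_weight[of "\<lambda>_. 0"] by (auto simp: X_def)
  define m where "m = Max (sum w ` X)"
  have "m \<in> sum w ` X" unfolding m_def using fX neX by (intro Max_in) auto
  then obtain T where T: "T \<in> X" "sum w T = m" by auto
  have mge: "sum w S \<le> m" if "S \<in> X" for S unfolding m_def using fX that by auto
  have step: "real n * (sum w U - 2 * real D * m) \<le> real (card U)" for n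
  proof -
    obtain S where S: "S \<in> X" "(\<Sum>u\<in>U. \<lfloor>real n * w u\<rfloor>) \<le> 2 * int D * (\<Sum>u\<in>S. \<lfloor>real n * w u\<rfloor>)"
      using int_weight[of "\<lambda>u. \<lfloor>real n * w u\<rfloor>"] by (auto simp: X_def)
    have "real n * sum w U - real (card U) = (\<Sum>u\<in>U. real n * w u - 1)"
      by (simp add: sum_subtractf sum_distrib_left)
    also have "\<dots> \<le> (\<Sum>u\<in>U. real_of_int \<lfloor>real n * w u\<rfloor>)" by (intro sum_mono) linarith
    also have "\<dots> = real_of_int (\<Sum>u\<in>U. \<lfloor>real n * w u\<rfloor>)" by simp
    also have "\<dots> \<le> real_of_int (2 * int D * (\<Sum>u\<in>S. \<lfloor>real n * w u\<rfloor>))" using S(2) by (simp only: of_int_le_iff)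
    also have "\<dots> = 2 * real D * (\<Sum>u\<in>S. real_of_int \<lfloor>real n * w u\<rfloor>)" by simp
    also have "\<dots> \<le> 2 * real D * (\<Sum>u\<in>S. real n * w u)" by (intro mult_left_mono sum_mono) auto
    also have "\<dots> = 2 * real D * (real n * sum w S)" by (simp add: sum_distrib_left)
    also have "\<dots> \<le> 2 * real D * (real n * m)" using mge[OF S(1)] by (intro mult_left_mono) auto
    finally show ?thesis by (simp add: algebra_simps)
  qed
  have "sum w U - 2 * real D * m \<le> 0"
  proof (rule ccontr)
    assume "\<not> ?thesis"
    then obtain n where "real (card U) < real n * (sum w U - 2 * real D * m)"
      using reals_Archimedean3[of "sum w U - 2 * real D * m"] by auto
    then show False using step[of n] by simp
  qed
  then show ?thesis using T by (auto simp: X_def)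
qed

text \<open>Duality turns the inequality for all weights into a distribution that uses each vertex
  with probability at least 1 / (2D). A transversal meets each class once and a class has 2D
  vertices, so the probabilities in a class add up to one and equality holds.\<close>

lemma fractional_transversal:
  fixes U :: "'a set" and cl :: "'a \<Rightarrow> 'i"
  assumes fI: "finite I" and fU: "finite U" and sym: "symp A" and irr: "irreflp A"
    and clU: "cl ` U \<subseteq> I" and size: "\<And>i. i \<in> I \<Longrightarrow> card {u\<in>U. cl u = i} = 2 * D"
    and deg: "\<And>u. u \<in> U \<Longrightarrow> card (nbrs U A u) \<le> D" and D: "0 < D"
  shows "\<exists>p. (\<forall>T. 0 \<le> p T) \<and> sum p {T. transversal A cl U I T} = 1 \<and>
     (\<forall>u\<in>U. cover {T. transversal A cl U I T} p u = 1 / (2 * real D))"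
proof -
  define X where "X = {T. transversal A cl U I T}"
  have fX: "finite X" using fU by (auto simp: X_def transversal_def intro: finite_subset[of _ "Pow U"])
  define a where "a T u = (if u \<in> T then 1 else 0) - 1 / (2 * real D)" for T :: "'a set" and u
  have "\<exists>T\<in>X. 0 \<le> (\<Sum>u\<in>U. l u * a T u)" for l :: "'a \<Rightarrow> real"
  proof -
    obtain T where T: "transversal A cl U I T" "sum l U \<le> 2 * real D * sum l T"
      using transversal_real_weight[OF fI fU sym irr clU size deg D, of l] by blast
    have TU: "T \<subseteq> U" using T by (auto simp: transversal_def)
    have "(\<Sum>u\<in>U. l u * a T u) = (\<Sum>u\<in>U. if u \<in> T then l u else 0) - sum l U / (2 * real D)"
      unfolding a_def right_diff_distrib sum_subtractf sum_divide_distrib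
      by (intro arg_cong2[where f = "(-)"] sum.cong) auto
    also have "(\<Sum>u\<in>U. if u \<in> T then l u else 0) = sum l T"
      using fU TU by (simp add: sum.If_cases Int_absorb1)
    finally have "(\<Sum>u\<in>U. l u * a T u) = sum l T - sum l U / (2 * real D)" .
    moreover have "sum l U / (2 * real D) \<le> sum l T" using T(2) D by (simp add: field_simps)
    ultimately have "0 \<le> (\<Sum>u\<in>U. l u * a T u)" by simp
    then show ?thesis using T by (auto simp: X_def)
  qed
  then obtain p where p: "\<forall>T. 0 \<le> p T" "sum p X = 1" "\<forall>u\<in>U. 0 \<le> (\<Sum>T\<in>X. p T * a T u)"
    using minimax[OF fX fU, of a] by blast
  have ge: "1 / (2 * real D) \<le> cover X p u" if "u \<in> U" for u
  proof -
    have "(\<Sum>T\<in>X. p T * a T u) = cover X p u - 1 / (2 * real D)"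
      unfolding cover_alt[OF fX] a_def right_diff_distrib sum_subtractf sum_distrib_right[symmetric] p(2) by simp
    then show ?thesis using p(3) that by auto
  qed
  have eq: "cover X p u = 1 / (2 * real D)" if u: "u \<in> U" for u
  proof -
    define K where "K = {v\<in>U. cl v = cl u}"
    have fK: "finite K" using fU by (auto simp: K_def)
    have cK: "card K = 2 * D" using size clU u by (auto simp: K_def)
    have "(\<Sum>v\<in>K. cover X p v) = (\<Sum>T\<in>X. \<Sum>v\<in>K. p T * (if v \<in> T then 1 else 0))"
      unfolding cover_alt[OF fX] by (rule sum.swap)
    also have "\<dots> = (\<Sum>T\<in>X. p T)"
    proof (rule sum.cong)
      fix T assume "T \<in> X"
      then have T: "T \<subseteq> U" "inj_on cl T" "cl ` T = I" by (auto simp: X_def transversal_def)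
      have "cl u \<in> cl ` T" using T clU u by auto
      then obtain t where t: "t \<in> T" "cl t = cl u" by auto
      have "K \<inter> T = {t}" using t T by (auto simp: K_def inj_on_def)
      then show "(\<Sum>v\<in>K. p T * (if v \<in> T then 1 else 0)) = p T"
        using fK by (simp add: sum_distrib_left[symmetric] sum.If_cases Int_def)
    qed simp
    finally have "(\<Sum>v\<in>K. cover X p v - 1 / (2 * real D)) = 0"
      using p(2) cK D by (simp add: sum_subtractf)
    then have "\<forall>v\<in>K. cover X p v - 1 / (2 * real D) = 0"
      using fK ge by (subst (asm) sum_nonneg_eq_0_iff) (auto simp: K_def)
    then show ?thesis using u by (auto simp: K_def)
  qed
  show ?thesis using p eq unfolding X_def by blast
qed

section \<open>Colourings by sets of reals\<close>

definition colourable :: "'a set \<Rightarrow> ('a \<Rightarrow> 'a \<Rightarrow> bool) \<Rightarrow> real \<Rightarrow> bool" where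
  "colourable V A c \<longleftrightarrow> (\<exists>w. weight_colouring V A c w \<and> (\<forall>v\<in>V. 1 \<le> cover (Pow V) w v))"

text \<open>Points of an interval with Lebesgue measure serve as colours, since subsets of every
  intermediate measure exist; the interval is half-open so that pieces can be stacked without
  overlap.\<close>

definition colour_set :: "real \<Rightarrow> real set \<Rightarrow> bool" where
  "colour_set c X \<longleftrightarrow> X \<in> sets lborel \<and> X \<subseteq> {0..<c}"

abbreviation vol :: "real set \<Rightarrow> real" where
  "vol X \<equiv> measure lborel X"

lemma colour_set_ivl [simp]: "colour_set c {0..<c}"
  by (simp add: colour_set_def)

lemma colour_set_empty [simp]: "colour_set c {}"
  by (simp add: colour_set_def)

lemma colour_set_mono: "colour_set c X \<Longrightarrow> c \<le> d \<Longrightarrow> colour_set d X"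
proof -
  assume "colour_set c X" "c \<le> d"
  moreover from this have "{0..<c} \<subseteq> {0..<d}" by auto
  ultimately show ?thesis unfolding colour_set_def by blast
qed

lemma colour_set_Un: "colour_set c X \<Longrightarrow> colour_set c Y \<Longrightarrow> colour_set c (X \<union> Y)"
  by (auto simp: colour_set_def)

lemma colour_set_Int: "colour_set c X \<Longrightarrow> colour_set c Y \<Longrightarrow> colour_set c (X \<inter> Y)"
  by (auto simp: colour_set_def)

lemma colour_set_Diff: "colour_set c X \<Longrightarrow> colour_set c Y \<Longrightarrow> colour_set c (X - Y)"
  by (auto simp: colour_set_def)

lemma colour_set_UN: "finite I \<Longrightarrow> (\<And>i. i \<in> I \<Longrightarrow> colour_set c (X i)) \<Longrightarrow> colour_set c (\<Union>i\<in>I. X i)"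
  unfolding colour_set_def by (auto intro: sets.finite_UN)

lemma colour_set_fin: "colour_set c X \<Longrightarrow> emeasure lborel X \<noteq> \<infinity>"
proof -
  assume X: "colour_set c X"
  have "emeasure lborel X \<le> emeasure lborel {0..<c}" using X by (intro emeasure_mono) (auto simp: colour_set_def)
  also have "\<dots> < \<infinity>" by (cases "0 \<le> c") auto
  finally show ?thesis by simp
qed

lemma vol_ivl: "0 \<le> c \<Longrightarrow> vol {0..<c} = c"
  by simp

lemma vol_mono: "colour_set c Y \<Longrightarrow> colour_set c X \<Longrightarrow> X \<subseteq> Y \<Longrightarrow> vol X \<le> vol Y"
  using colour_set_fin[of c Y] by (intro measure_mono_fmeasurable) (auto simp: colour_set_def fmeasurable_def less_top)

lemma vol_split: "colour_set c X \<Longrightarrow> colour_set c Y \<Longrightarrow> vol X = vol (X \<inter> Y) + vol (X - Y)"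
proof -
  assume X: "colour_set c X" and Y: "colour_set c Y"
  have "vol ((X \<inter> Y) \<union> (X - Y)) = vol (X \<inter> Y) + vol (X - Y)"
    using X Y colour_set_fin[OF colour_set_Int[OF X Y]] colour_set_fin[OF colour_set_Diff[OF X Y]]
    by (intro measure_Union) (auto simp: colour_set_def)
  then show ?thesis by (simp add: Int_Diff_Un)
qed

lemma vol_disj: "colour_set c X \<Longrightarrow> colour_set c Y \<Longrightarrow> X \<inter> Y = {} \<Longrightarrow> vol (X \<union> Y) = vol X + vol Y"
  using colour_set_fin[of c X] colour_set_fin[of c Y] by (intro measure_Union) (auto simp: colour_set_def)

lemma vol_Un_le: "colour_set c X \<Longrightarrow> colour_set c Y \<Longrightarrow> vol (X \<union> Y) \<le> vol X + vol Y"
  using colour_set_fin[of c X] colour_set_fin[of c Y] by (intro measure_Un_le) (auto simp: colour_set_def)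

lemma vol_Un_Int: "colour_set c X \<Longrightarrow> colour_set c Y \<Longrightarrow> vol (X \<union> Y) = vol X + vol Y - vol (X \<inter> Y)"
proof -
  assume X: "colour_set c X" and Y: "colour_set c Y"
  have "vol (X \<union> (Y - X)) = vol X + vol (Y - X)" using X Y by (intro vol_disj colour_set_Diff) auto
  moreover have "X \<union> (Y - X) = X \<union> Y" by auto
  moreover have "vol Y = vol (Y \<inter> X) + vol (Y - X)" by (rule vol_split[OF Y X])
  ultimately show ?thesis by (simp add: Int_commute)
qed

lemma vol_Diff_ge: "colour_set c X \<Longrightarrow> colour_set c Y \<Longrightarrow> vol X - vol Y \<le> vol (X - Y)"
  using vol_split[of c X Y] vol_mono[of c Y "X \<inter> Y"] by (auto simp: colour_set_Int)

lemma vol_UN_le: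
  assumes "finite I" "\<And>i. i \<in> I \<Longrightarrow> colour_set c (X i)"
  shows "vol (\<Union>i\<in>I. X i) \<le> (\<Sum>i\<in>I. vol (X i))"
  using assms
proof (induction I)
  case (insert i I)
  have "vol (X i \<union> (\<Union>j\<in>I. X j)) \<le> vol (X i) + vol (\<Union>j\<in>I. X j)"
    using insert by (intro vol_Un_le colour_set_UN) auto
  then show ?case using insert by simp
qed simp

text \<open>Intermediate value theorem for the measure of the part of \<open>X\<close> below
  \<open>s\<close>, which is 1-Lipschitz in \<open>s\<close>.\<close>

lemma vol_subset_exists:
  assumes X: "colour_set c X" and t: "0 \<le> t" "t \<le> vol X"
  shows "\<exists>Z. colour_set c Z \<and> Z \<subseteq> X \<and> vol Z = t"
proof (cases "0 \<le> c")
  case False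
  then have "X = {}" using X by (auto simp: colour_set_def)
  then show ?thesis using t by (intro exI[of _ "{}"]) auto
next
  case True
  define f where "f s = vol (X \<inter> {0..<s})" for s
  have bmf: "colour_set c (X \<inter> {0..<s})" for s using X by (auto simp: colour_set_def)
  have step: "f s \<le> f r" "f r \<le> f s + (r - s)" if "s \<le> r" "0 \<le> s" for r s
  proof -
    show "f s \<le> f r" unfolding f_def using that bmf by (intro vol_mono) auto
    have b: "colour_set r (X \<inter> {0..<s})" "colour_set r {s..<r}" using that X by (auto simp: colour_set_def)
    have "f r \<le> vol ((X \<inter> {0..<s}) \<union> {s..<r})" unfolding f_def
      using X that by (intro vol_mono[of r] colour_set_Un b) (auto simp: colour_set_def)
    also have "\<dots> \<le> f s + vol {s..<r}" unfolding f_def by (rule vol_Un_le[OF b])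
    finally show "f r \<le> f s + (r - s)" using that by simp
  qed
  have lip: "\<bar>f s - f r\<bar> \<le> 1 * \<bar>s - r\<bar>" if "s \<in> {0..c}" "r \<in> {0..c}" for r s
    using step[of s r] step[of r s] that by (cases "s \<le> r") auto
  have "1-lipschitz_on {0..c} f"
    by (rule lipschitz_onI) (use lip in \<open>auto simp: dist_real_def\<close>)
  then have "continuous_on {0..c} f" by (rule lipschitz_on_continuous_on)
  moreover have "f 0 = 0" by (simp add: f_def)
  moreover have "f c = vol X" unfolding f_def using X by (metis Int_absorb2 colour_set_def)
  ultimately obtain s where "f s = t" using IVT'[of f 0 t c] t True by auto
  then show ?thesis using bmf by (intro exI[of _ "X \<inter> {0..<s}"]) (auto simp: f_def)
qed

text \<open>Use up \<open>X - Y\<close> before touching \<open>Y\<close>.\<close>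

lemma vol_subset_avoiding:
  assumes X: "colour_set c X" and Y: "colour_set c Y" and t: "0 \<le> t" "t \<le> vol X"
  shows "\<exists>Z. colour_set c Z \<and> Z \<subseteq> X \<and> vol Z = t \<and> vol (Z \<inter> Y) \<le> max 0 (t - vol (X - Y))"
proof (cases "t \<le> vol (X - Y)")
  case True
  then obtain Z where Z: "colour_set c Z" "Z \<subseteq> X - Y" "vol Z = t"
    using vol_subset_exists[OF colour_set_Diff[OF X Y] t(1)] by blast
  then have "Z \<inter> Y = {}" by auto
  then show ?thesis using Z by (intro exI[of _ Z]) auto
next
  case False
  have "vol X = vol (X \<inter> Y) + vol (X - Y)" by (rule vol_split[OF X Y])
  then obtain Z where Z: "colour_set c Z" "Z \<subseteq> X \<inter> Y" "vol Z = t - vol (X - Y)"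
    using vol_subset_exists[OF colour_set_Int[OF X Y], of "t - vol (X - Y)"] False t by auto
  have "vol (Z \<union> (X - Y)) = vol Z + vol (X - Y)" using Z X Y by (intro vol_disj colour_set_Diff) auto
  moreover have "(Z \<union> (X - Y)) \<inter> Y = Z" using Z by auto
  ultimately show ?thesis using Z X Y
    by (intro exI[of _ "Z \<union> (X - Y)"]) (auto intro: colour_set_Un colour_set_Diff)
qed

text \<open>Intervals of lengths \<open>w S\<close> laid end to end. Weight zero has to give the
  empty set, so that sets outside of the support, in particular unstable ones, never occur as colour
  classes.\<close>

lemma stacked_intervals:
  assumes "finite \<X>" and "\<And>S. S \<in> \<X> \<Longrightarrow> 0 \<le> w S"
  shows "\<exists>\<psi>. (\<forall>S\<in>\<X>. colour_set (sum w \<X>) (\<psi> S) \<and> vol (\<psi> S) = w S \<and> (w S = 0 \<longrightarrow> \<psi> S = {})) \<and>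
     disjoint_family_on \<psi> \<X> \<and> (\<Union>S\<in>\<X>. \<psi> S) = {0..<sum w \<X>}"
  using assms
proof (induction \<X>)
  case empty
  then show ?case by (auto simp: disjoint_family_on_def)
next
  case (insert x \<X>)
  then obtain \<psi> where \<psi>: "\<forall>S\<in>\<X>. colour_set (sum w \<X>) (\<psi> S) \<and> vol (\<psi> S) = w S \<and> (w S = 0 \<longrightarrow> \<psi> S = {})"
     "disjoint_family_on \<psi> \<X>" "(\<Union>S\<in>\<X>. \<psi> S) = {0..<sum w \<X>}" by auto
  define c where "c = sum w \<X>"
  have c: "0 \<le> c" "0 \<le> w x" using insert by (auto simp: c_def intro: sum_nonneg)
  define \<psi>' where "\<psi>' = \<psi>(x := {c..<c + w x})"
  have s: "sum w (insert x \<X>) = c + w x" using insert by (simp add: c_def)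
  have [simp]: "\<psi>' x = {c..<c + w x}" by (simp add: \<psi>'_def)
  have e: "\<psi>' S = \<psi> S" if "S \<in> \<X>" for S using that insert by (auto simp: \<psi>'_def)
  have sub: "\<psi> S \<subseteq> {0..<c}" if "S \<in> \<X>" for S using \<psi>(1) that by (auto simp: colour_set_def c_def)
  have "colour_set (c + w x) (\<psi>' S) \<and> vol (\<psi>' S) = w S \<and> (w S = 0 \<longrightarrow> \<psi>' S = {})" if "S \<in> insert x \<X>" for S
  proof (cases "S = x")
    case False
    then have "S \<in> \<X>" using that by auto
    then have "colour_set c (\<psi> S) \<and> vol (\<psi> S) = w S \<and> (w S = 0 \<longrightarrow> \<psi> S = {})" using \<psi>(1) by (simp add: c_def)
    then show ?thesis using colour_set_mono[of c "\<psi> S" "c + w x"] c e[OF \<open>S \<in> \<X>\<close>] by simp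
  qed (use c in \<open>auto simp: colour_set_def\<close>)
  moreover have "disjoint_family_on \<psi>' (insert x \<X>)"
    unfolding disjoint_family_on_def
  proof (intro ballI impI)
    fix S T assume ST: "S \<in> insert x \<X>" "T \<in> insert x \<X>" "S \<noteq> T"
    have d: "{c..<c + w x} \<inter> \<psi> S = {}" if "S \<in> \<X>" for S using sub[OF that] by fastforce
    show "\<psi>' S \<inter> \<psi>' T = {}"
    proof (cases "S = x")
      case True
      then show ?thesis using ST d[of T] e[of T] by auto
    next
      case False
      then have S: "S \<in> \<X>" using ST by simp
      show ?thesis
      proof (cases "T = x")
        case True
        then show ?thesis using d[OF S] e[OF S] by (simp add: Int_commute)
      next
        case False
        then have "T \<in> \<X>" using ST by simp
        then show ?thesis using disjoint_family_onD[OF \<psi>(2) S _ ST(3)] e[OF S] e[of T] by simp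
      qed
    qed
  qed
  moreover have "(\<Union>S\<in>insert x \<X>. \<psi>' S) = {c..<c + w x} \<union> {0..<c}"
    using e \<psi>(3) by (simp add: c_def)
  then have "(\<Union>S\<in>insert x \<X>. \<psi>' S) = {0..<c + w x}" using c by auto
  ultimately show ?case unfolding s by blast
qed

text \<open>Exactly one unit per vertex, so that volumes of blocked and free colours can be
  estimated from degrees.\<close>

definition set_colouring :: "'a set \<Rightarrow> ('a \<Rightarrow> 'a \<Rightarrow> bool) \<Rightarrow> real \<Rightarrow> ('a \<Rightarrow> real set) \<Rightarrow> bool" where
  "set_colouring V A c \<phi> \<longleftrightarrow> (\<forall>v\<in>V. colour_set c (\<phi> v) \<and> vol (\<phi> v) = 1) \<and> (\<forall>u\<in>V. \<forall>v\<in>V. A u v \<longrightarrow> \<phi> u \<inter> \<phi> v = {})"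

text \<open>The points of the interval belonging to \<open>S\<close> become colours of all vertices
  of \<open>S\<close>. Admitting every predicate \<open>P\<close> on colour classes records the
  joint law, from which measures of vertices and of overlaps can be read off.\<close>

lemma weights_to_sets:
  assumes fV: "finite V" and w: "weight_colouring V A c w"
  shows "\<exists>\<phi>. (\<forall>v\<in>V. colour_set c (\<phi> v)) \<and> (\<forall>t\<in>{0..<c}. stable A {v\<in>V. t \<in> \<phi> v}) \<and>
    (\<forall>P. vol {t\<in>{0..<c}. P {v\<in>V. t \<in> \<phi> v}} = sum w {S\<in>Pow V. P S})"
proof -
  have c: "sum w (Pow V) = c" and w0: "\<And>S. 0 \<le> w S"
    and st: "\<And>S. w S \<noteq> 0 \<Longrightarrow> stable A S" using w by (auto simp: weight_colouring_def)
  from stacked_intervals[of "Pow V" w] fV w0 c obtain \<psi> where \<psi>: "\<forall>S\<in>Pow V. colour_set c (\<psi> S) \<and> vol (\<psi> S) = w S \<and> (w S = 0 \<longrightarrow> \<psi> S = {})"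
     "disjoint_family_on \<psi> (Pow V)" "(\<Union>S\<in>Pow V. \<psi> S) = {0..<c}"
    by auto
  define \<phi> where "\<phi> v = (\<Union>S\<in>{S\<in>Pow V. v \<in> S}. \<psi> S)" for v
  have col: "{v\<in>V. t \<in> \<phi> v} = S" if "S \<in> Pow V" "t \<in> \<psi> S" for t S
  proof -
    have "S' = S" if "S' \<in> Pow V" "t \<in> \<psi> S'" for S'
      using disjoint_family_onD[OF \<psi>(2), of S' S] that \<open>S \<in> Pow V\<close> \<open>t \<in> \<psi> S\<close> by (cases "S' = S") auto
    note uniq = this
    show ?thesis
    proof (intro set_eqI iffI)
      fix v assume "v \<in> {v\<in>V. t \<in> \<phi> v}"
      then obtain S' where "S' \<in> Pow V" "v \<in> S'" "t \<in> \<psi> S'" by (auto simp: \<phi>_def)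
      with uniq show "v \<in> S" by blast
    next
      fix v assume "v \<in> S"
      then show "v \<in> {v\<in>V. t \<in> \<phi> v}" using that by (auto simp: \<phi>_def)
    qed
  qed
  have ev: "{t\<in>{0..<c}. P {v\<in>V. t \<in> \<phi> v}} = (\<Union>S\<in>{S\<in>Pow V. P S}. \<psi> S)" for P
  proof (intro set_eqI iffI)
    fix t assume t: "t \<in> {t\<in>{0..<c}. P {v\<in>V. t \<in> \<phi> v}}"
    then obtain S where "S \<in> Pow V" "t \<in> \<psi> S" using \<psi>(3) by blast
    then show "t \<in> (\<Union>S\<in>{S\<in>Pow V. P S}. \<psi> S)" using t col by auto
  next
    fix t assume "t \<in> (\<Union>S\<in>{S\<in>Pow V. P S}. \<psi> S)"
    then obtain S where S: "S \<in> Pow V" "P S" "t \<in> \<psi> S" by auto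
    then have "t \<in> {0..<c}" using \<psi>(3) by blast
    then show "t \<in> {t\<in>{0..<c}. P {v\<in>V. t \<in> \<phi> v}}" using S col[of S t] by auto
  qed
  have "vol {t\<in>{0..<c}. P {v\<in>V. t \<in> \<phi> v}} = sum w {S\<in>Pow V. P S}" for P
  proof -
    have "vol (\<Union>S\<in>{S\<in>Pow V. P S}. \<psi> S) = (\<Sum>S\<in>{S\<in>Pow V. P S}. vol (\<psi> S))"
    proof (rule measure_finite_Union)
      show "disjoint_family_on \<psi> {S\<in>Pow V. P S}" using \<psi>(2) by (auto simp: disjoint_family_on_def)
      show "emeasure lborel (\<psi> S) \<noteq> \<infinity>" if "S \<in> {S\<in>Pow V. P S}" for S
        using \<psi>(1) that by (intro colour_set_fin[of c]) auto
    qed (use fV \<psi>(1) in \<open>auto simp: colour_set_def\<close>)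
    then show ?thesis unfolding ev using \<psi>(1) by simp
  qed
  moreover have "colour_set c (\<phi> v)" for v unfolding \<phi>_def using fV \<psi>(1) by (intro colour_set_UN) auto
  moreover have "stable A {v\<in>V. t \<in> \<phi> v}" if "t \<in> {0..<c}" for t
  proof -
    have "t \<in> (\<Union>S\<in>Pow V. \<psi> S)" unfolding \<psi>(3) by (rule that)
    then obtain S where S: "S \<in> Pow V" "t \<in> \<psi> S" by auto
    then have "w S \<noteq> 0" using \<psi>(1) by blast
    then show ?thesis using col[OF S] st by simp
  qed
  ultimately show ?thesis by blast
qed

lemma cover_event: "cover (Pow V) w v = sum w {S\<in>Pow V. v \<in> S}"
  by (simp add: cover_def)

lemma colourable_imp_set_colouring:
  assumes fV: "finite V" and "colourable V A c"
  shows "\<exists>\<phi>. set_colouring V A c \<phi>"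
proof -
  obtain w where w: "weight_colouring V A c w" "\<forall>v\<in>V. 1 \<le> cover (Pow V) w v"
    using assms by (auto simp: colourable_def)
  obtain \<phi> where \<phi>: "\<forall>v\<in>V. colour_set c (\<phi> v)" "\<forall>t\<in>{0..<c}. stable A {v\<in>V. t \<in> \<phi> v}"
    "\<forall>P. vol {t\<in>{0..<c}. P {v\<in>V. t \<in> \<phi> v}} = sum w {S\<in>Pow V. P S}"
    using weights_to_sets[OF fV w(1)] by (elim exE conjE) (rule that)
  have "\<exists>Z. colour_set c Z \<and> Z \<subseteq> \<phi> v \<and> vol Z = 1" if v: "v \<in> V" for v
  proof -
    have "\<phi> v \<subseteq> {0..<c}" using \<phi>(1) v unfolding colour_set_def by blast
    then have "{t\<in>{0..<c}. v \<in> {v\<in>V. t \<in> \<phi> v}} = \<phi> v" using v by blast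
    then have "1 \<le> vol (\<phi> v)" using \<phi>(3)[rule_format, of "\<lambda>S. v \<in> S"] w(2) v by (simp add: cover_event)
    then show ?thesis using vol_subset_exists[of c "\<phi> v" 1] \<phi>(1) v by auto
  qed
  then obtain \<phi>' where \<phi>': "\<And>v. v \<in> V \<Longrightarrow> colour_set c (\<phi>' v) \<and> \<phi>' v \<subseteq> \<phi> v \<and> vol (\<phi>' v) = 1" by metis
  have "\<phi>' u \<inter> \<phi>' v = {}" if uv: "u \<in> V" "v \<in> V" "A u v" for u v
  proof (rule ccontr)
    assume "\<phi>' u \<inter> \<phi>' v \<noteq> {}"
    then obtain t where t: "t \<in> \<phi>' u" "t \<in> \<phi>' v" by blast
    have t': "t \<in> \<phi> u" "t \<in> \<phi> v" "t \<in> {0..<c}" using \<phi>'[OF uv(1)] \<phi>'[OF uv(2)] t unfolding colour_set_def by blast+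
    then have "stable A {v\<in>V. t \<in> \<phi> v}" using \<phi>(2) by blast
    then show False using t' uv unfolding stable_def by blast
  qed
  then show ?thesis using \<phi>' unfolding set_colouring_def by blast
qed

lemma colour_set_colour_class:
  assumes fV: "finite V" and \<phi>: "\<And>v. v \<in> V \<Longrightarrow> colour_set c (\<phi> v)"
  shows "colour_set c {t\<in>{0..<c}. {v\<in>V. t \<in> \<phi> v} = S}"
proof (cases "S \<subseteq> V")
  case True
  have "{t\<in>{0..<c}. {v\<in>V. t \<in> \<phi> v} = S} = {0..<c} - (\<Union>v\<in>S. {0..<c} - \<phi> v) - (\<Union>v\<in>V - S. \<phi> v)"
    using True by auto
  moreover have "colour_set c \<dots>" using True fV finite_subset[OF True fV] \<phi> by (intro colour_set_Diff colour_set_UN) auto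
  ultimately show ?thesis by simp
next
  case False
  then have "{t\<in>{0..<c}. {v\<in>V. t \<in> \<phi> v} = S} = {}" by auto
  then show ?thesis by (simp only: colour_set_empty)
qed

text \<open>The weight of \<open>S\<close> is the measure of the set of colours whose class is
  \<open>S\<close>.\<close>

lemma sets_to_weights:
  assumes fV: "finite V" and c: "0 \<le> c" and \<phi>: "set_colouring V A c \<phi>"
  shows "\<exists>w. weight_colouring V A c w \<and>
    (\<forall>P. sum w {S\<in>Pow V. P S} = vol {t\<in>{0..<c}. P {v\<in>V. t \<in> \<phi> v}})"
proof -
  define T where "T S = {t\<in>{0..<c}. {v\<in>V. t \<in> \<phi> v} = S}" for S
  define w where "w S = vol (T S)" for S
  have bT: "colour_set c (T S)" for S unfolding T_def using fV \<phi> by (intro colour_set_colour_class) (auto simp: set_colouring_def)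
  have ev: "sum w {S\<in>Pow V. P S} = vol {t\<in>{0..<c}. P {v\<in>V. t \<in> \<phi> v}}" for P
  proof -
    have "vol (\<Union>S\<in>{S\<in>Pow V. P S}. T S) = (\<Sum>S\<in>{S\<in>Pow V. P S}. vol (T S))"
      using fV bT colour_set_fin[OF bT] by (intro measure_finite_Union) (auto simp: disjoint_family_on_def T_def colour_set_def)
    moreover have "(\<Union>S\<in>{S\<in>Pow V. P S}. T S) = {t\<in>{0..<c}. P {v\<in>V. t \<in> \<phi> v}}"
      by (auto simp: T_def)
    ultimately show ?thesis by (simp add: w_def)
  qed
  have "S \<subseteq> V \<and> stable A S" if "w S \<noteq> 0" for S
  proof -
    have "T S \<noteq> {}" using that by (auto simp: w_def)
    then obtain t where "{v\<in>V. t \<in> \<phi> v} = S" by (auto simp: T_def)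
    then show ?thesis using \<phi> unfolding set_colouring_def stable_def by blast
  qed
  moreover have "{t\<in>{0..<c}. True} = {0..<c}" "{S\<in>Pow V. True} = Pow V" by auto
  then have "sum w (Pow V) = c" using ev[of "\<lambda>_. True"] vol_ivl[OF c] by simp
  moreover have "0 \<le> w S" for S by (simp add: w_def)
  ultimately show ?thesis using ev unfolding weight_colouring_def by blast
qed

text \<open>Linear programming duality for the fractional chromatic number: by
  \<open>minimax\<close>, one good stable set for each weighting \<open>b\<close> yields a
  distribution containing every vertex with probability at least 1 / c, and scaling by
  \<open>c\<close> gives the colouring.\<close>

lemma colourable_by_duality:
  assumes fV: "finite V" and c: "0 < c"
    and dual: "\<And>b. (\<And>v. v \<in> V \<Longrightarrow> 0 \<le> b v) \<Longrightarrow> \<exists>S\<subseteq>V. stable A S \<and> sum b V \<le> c * sum b S"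
  shows "colourable V A c"
proof -
  define X where "X = {S. S \<subseteq> V \<and> stable A S}"
  have fX: "finite X" using fV by (auto simp: X_def)
  have XP: "X \<subseteq> Pow V" by (auto simp: X_def)
  define a where "a S v = (if v \<in> S then 1 else 0) - 1 / c" for S :: "'a set" and v
  have "\<exists>S\<in>X. 0 \<le> (\<Sum>v\<in>V. b v * a S v)" if b: "\<forall>v\<in>V. 0 \<le> b v" for b
  proof -
    obtain S where S: "S \<subseteq> V" "stable A S" "sum b V \<le> c * sum b S" using dual b by blast
    have "(\<Sum>v\<in>V. b v * a S v) = (\<Sum>v\<in>V. if v \<in> S then b v else 0) - sum b V / c"
      unfolding a_def right_diff_distrib sum_subtractf sum_divide_distrib
      by (intro arg_cong2[where f = "(-)"] sum.cong) auto
    also have "(\<Sum>v\<in>V. if v \<in> S then b v else 0) = sum b S"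
      using fV S by (simp add: sum.If_cases Int_absorb1)
    finally have "(\<Sum>v\<in>V. b v * a S v) = sum b S - sum b V / c" .
    moreover have "sum b V / c \<le> sum b S" using S(3) c by (simp add: field_simps)
    ultimately show ?thesis using S by (intro bexI[of _ S]) (auto simp: X_def)
  qed
  then obtain p where p: "\<forall>S. 0 \<le> p S" "sum p X = 1" "\<forall>v\<in>V. 0 \<le> (\<Sum>S\<in>X. p S * a S v)"
    using minimax[OF fX fV, of a] by blast
  define w where "w S = (if S \<in> X then c * p S else 0)" for S
  have "sum w (Pow V) = sum w X" using fV XP by (intro sum.mono_neutral_right) (auto simp: w_def)
  also have "\<dots> = c" using p(2) by (simp add: w_def sum_distrib_left[symmetric])
  finally have "weight_colouring V A c w" using p(1) c by (auto simp: weight_colouring_def w_def X_def)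
  moreover have "1 \<le> cover (Pow V) w v" if v: "v \<in> V" for v
  proof -
    have "cover (Pow V) w v = cover X w v" using fV XP fX
      by (simp add: cover_alt) (intro sum.mono_neutral_right, auto simp: w_def)
    also have "\<dots> = c * cover X p v" unfolding cover_def sum_distrib_left
      by (intro sum.cong) (auto simp: w_def)
    finally have 1: "cover (Pow V) w v = c * cover X p v" .
    have "(\<Sum>S\<in>X. p S * a S v) = cover X p v - 1 / c"
      unfolding cover_alt[OF fX] a_def right_diff_distrib sum_subtractf sum_distrib_right[symmetric] p(2) by simp
    then have "1 / c \<le> cover X p v" using p(3) v by auto
    then show ?thesis unfolding 1 using c by (simp add: field_simps)
  qed
  ultimately show ?thesis unfolding colourable_def by blast
qed

text \<open>Slice the weights \<open>b\<close> into layers and apply Hall's condition to each of them.\<close>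

lemma hall_layers:
  fixes b :: "'a \<Rightarrow> real" and w :: "'s \<Rightarrow> real"
  assumes fC: "finite C" and fX: "finite X" and w0: "\<And>S. S \<in> X \<Longrightarrow> 0 \<le> w S"
    and hall: "\<And>T. T \<subseteq> C \<Longrightarrow> real (card T) \<le> sum w {S\<in>X. \<exists>u\<in>T. free u S}"
    and b: "\<And>u. u \<in> C \<Longrightarrow> 0 \<le> b u"
  shows "sum b C \<le> (\<Sum>S\<in>X. w S * Max (insert 0 (b ` {u\<in>C. free u S})))"
  using b
proof (induction "card {u\<in>C. 0 < b u}" arbitrary: b rule: less_induct)
  case (less b)
  define T where "T = {u\<in>C. 0 < b u}"
  define g where "g b S = Max (insert 0 (b ` {u\<in>C. free u S}))" for b :: "'a \<Rightarrow> real" and S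
  have g0: "0 \<le> g b S" for b S unfolding g_def using fC by auto
  have gge: "b u \<le> g b S" if "u \<in> C" "free u S" for b u S unfolding g_def using fC that by auto
  show ?case
  proof (cases "T = {}")
    case True
    then have "sum b C = 0" using less.prems by (intro sum.neutral) (force simp: T_def)
    then show ?thesis using g0 w0 unfolding g_def[symmetric] by (auto intro!: sum_nonneg)
  next
    case False
    have fT: "finite T" using fC by (auto simp: T_def)
    \<comment> \<open>Height of the lowest layer, which lies over \<open>T\<close>; Hall's condition
      for \<open>T\<close> pays for its removal, and the maximum over the free vertices loses
      \<open>m\<close> exactly when some vertex of \<open>T\<close> is free.\<close>
    define m where "m = Min (b ` T)"
    have "m \<in> b ` T" unfolding m_def using fT False by (intro Min_in) auto
    then obtain u0 where u0: "u0 \<in> T" "b u0 = m" by auto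
    have mle: "m \<le> b u" if "u \<in> T" for u unfolding m_def using fT that by auto
    have m0: "0 < m" using u0 by (auto simp: T_def)
    define b' where "b' u = (if u \<in> T then b u - m else 0)" for u
    have b'0: "0 \<le> b' u" for u using mle by (auto simp: b'_def)
    have "{u\<in>C. 0 < b' u} \<subset> T" using u0 by (auto simp: b'_def T_def)
    then have "card {u\<in>C. 0 < b' u} < card {u\<in>C. 0 < b u}"
      unfolding T_def[symmetric] using fT by (intro psubset_card_mono)
    from less.hyps[OF this b'0] have IH: "sum b' C \<le> (\<Sum>S\<in>X. w S * g b' S)" by (simp add: g_def)
    have TC: "T \<subseteq> C" by (auto simp: T_def)
    have "sum b C = (\<Sum>u\<in>C. b' u + m * (if u \<in> T then 1 else 0))"
      using less.prems by (intro sum.cong) (force simp: b'_def T_def)+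
    also have "\<dots> = sum b' C + m * card T"
      using fC TC by (simp add: sum.distrib sum_distrib_left[symmetric] sum.If_cases Int_absorb1)
    also have "\<dots> \<le> (\<Sum>S\<in>X. w S * g b' S) + m * sum w {S\<in>X. \<exists>u\<in>T. free u S}"
      using IH hall[OF TC] m0 by (intro add_mono mult_left_mono) auto
    also have "\<dots> = (\<Sum>S\<in>X. w S * (g b' S + m * (if \<exists>u\<in>T. free u S then 1 else 0)))"
      unfolding sum.inter_filter[OF fX] sum_distrib_left sum.distrib[symmetric]
      by (intro sum.cong) (auto simp: algebra_simps)
    also have "\<dots> \<le> (\<Sum>S\<in>X. w S * g b S)"
    proof (intro sum_mono mult_left_mono)
      fix S assume "S \<in> X"
      then show "0 \<le> w S" by (rule w0)
      have "g b' S \<in> insert 0 (b' ` {u\<in>C. free u S})" unfolding g_def using fC by (intro Max_in) auto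
      then consider "g b' S = 0" | u where "u \<in> C" "free u S" "g b' S = b' u" "u \<in> T"
        by (auto simp: b'_def)
      then show "g b' S + m * (if \<exists>u\<in>T. free u S then 1 else 0) \<le> g b S"
      proof cases
        case 1
        show ?thesis
        proof (cases "\<exists>u\<in>T. free u S")
          case True
          then obtain u where "u \<in> T" "free u S" by blast
          then show ?thesis using 1 True mle[of u] gge[of u S b] TC by auto
        qed (use 1 g0 in auto)
      next
        case 2
        have "b u \<le> g b S" using gge 2 by auto
        then show ?thesis using 2 m0 by (auto simp: b'_def)
      qed
    qed
    finally show ?thesis by (simp add: g_def)
  qed
qed

section \<open>The clique reductions\<close>

lemma set_colouring_mono: "set_colouring V A c \<phi> \<Longrightarrow> H \<subseteq> V \<Longrightarrow> set_colouring H A c \<phi>"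
  unfolding set_colouring_def by blast

lemma set_colouring_insert:
  assumes \<phi>: "set_colouring H A c \<phi>" and sym: "symp A" and irr: "irreflp A"
    and x: "x \<notin> H" and X: "colour_set c X" "vol X = 1" "\<And>a. a \<in> nbrs H A x \<Longrightarrow> X \<inter> \<phi> a = {}"
  shows "set_colouring (insert x H) A c (\<phi>(x := X))"
proof -
  have dj: "X \<inter> \<phi> a = {}" if "a \<in> H" "A x a \<or> A a x" for a
    using X(3)[of a] that sym by (auto simp: nbrs_def symp_def)
  have n: "\<not> A x x" using irr by (auto simp: irreflp_def)
  show ?thesis unfolding set_colouring_def
  proof (intro conjI ballI impI)
    fix v assume "v \<in> insert x H"
    then show "colour_set c ((\<phi>(x := X)) v)" "vol ((\<phi>(x := X)) v) = 1" using X \<phi> by (auto simp: set_colouring_def)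
  next
    fix u v assume uv: "u \<in> insert x H" "v \<in> insert x H" "A u v"
    then consider "u = x" "v \<in> H" "v \<noteq> x" | "v = x" "u \<in> H" "u \<noteq> x" | "u \<in> H" "v \<in> H" "u \<noteq> x" "v \<noteq> x"
      using n x by auto
    then show "(\<phi>(x := X)) u \<inter> (\<phi>(x := X)) v = {}"
    proof cases
      case 1
      then show ?thesis using uv dj[of v] by simp
    next
      case 2
      then show ?thesis using uv dj[of u] by (simp add: Int_commute)
    next
      case 3
      then show ?thesis using uv \<phi> by (simp add: set_colouring_def)
    qed
  qed
qed

text \<open>Average the stable set weights of both colourings and lay the result out again. Overlaps
  are linear in the weights of the colour classes, so they are averaged too.\<close>

lemma set_colouring_mix:
  assumes fH: "finite H" and c: "0 \<le> c" and \<phi>1: "set_colouring H A c \<phi>1" and \<phi>2: "set_colouring H A c \<phi>2"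
  shows "\<exists>\<phi>. set_colouring H A c \<phi> \<and> (\<forall>a\<in>H. \<forall>b\<in>H. vol (\<phi> a \<inter> \<phi> b) = (vol (\<phi>1 a \<inter> \<phi>1 b) + vol (\<phi>2 a \<inter> \<phi>2 b)) / 2)"
proof -
  have inter: "{t\<in>{0..<c}. a \<in> {v\<in>H. t \<in> \<phi> v} \<and> b \<in> {v\<in>H. t \<in> \<phi> v}} = \<phi> a \<inter> \<phi> b"
    if "\<forall>v\<in>H. colour_set c (\<phi> v)" "a \<in> H" "b \<in> H" for \<phi> and a b
    using that unfolding colour_set_def by blast
  obtain w1 where w1: "weight_colouring H A c w1" "\<forall>P. sum w1 {S\<in>Pow H. P S} = vol {t\<in>{0..<c}. P {v\<in>H. t \<in> \<phi>1 v}}"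
    using sets_to_weights[OF fH c \<phi>1] by (elim exE conjE) (rule that)
  obtain w2 where w2: "weight_colouring H A c w2" "\<forall>P. sum w2 {S\<in>Pow H. P S} = vol {t\<in>{0..<c}. P {v\<in>H. t \<in> \<phi>2 v}}"
    using sets_to_weights[OF fH c \<phi>2] by (elim exE conjE) (rule that)
  define w where "w S = (w1 S + w2 S) / 2" for S
  have w0: "0 \<le> w1 S" "0 \<le> w2 S" for S using w1(1) w2(1) by (auto simp: weight_colouring_def)
  have "S \<subseteq> H \<and> stable A S" if "w S \<noteq> 0" for S
  proof -
    have "w1 S \<noteq> 0 \<or> w2 S \<noteq> 0" using that by (auto simp: w_def)
    then show ?thesis using w1(1) w2(1) unfolding weight_colouring_def by blast
  qed
  then have w: "weight_colouring H A c w" using w0 w1(1) w2(1)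
    by (auto simp: weight_colouring_def w_def sum_divide_distrib[symmetric] sum.distrib)
  obtain \<phi> where \<phi>: "\<forall>v\<in>H. colour_set c (\<phi> v)" "\<forall>t\<in>{0..<c}. stable A {v\<in>H. t \<in> \<phi> v}"
    "\<forall>P. vol {t\<in>{0..<c}. P {v\<in>H. t \<in> \<phi> v}} = sum w {S\<in>Pow H. P S}"
    using weights_to_sets[OF fH w] by (elim exE conjE) (rule that)
  have b1: "\<forall>v\<in>H. colour_set c (\<phi>1 v)" and b2: "\<forall>v\<in>H. colour_set c (\<phi>2 v)" using \<phi>1 \<phi>2 by (auto simp: set_colouring_def)
  have ov: "vol (\<phi> a \<inter> \<phi> b) = (vol (\<phi>1 a \<inter> \<phi>1 b) + vol (\<phi>2 a \<inter> \<phi>2 b)) / 2" if "a \<in> H" "b \<in> H" for a b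
    using \<phi>(3)[rule_format, of "\<lambda>S. a \<in> S \<and> b \<in> S"] w1(2)[rule_format, of "\<lambda>S. a \<in> S \<and> b \<in> S"]
      w2(2)[rule_format, of "\<lambda>S. a \<in> S \<and> b \<in> S"]
    unfolding inter[OF \<phi>(1) that] inter[OF b1 that] inter[OF b2 that]
    by (simp add: w_def sum_divide_distrib[symmetric] sum.distrib)
  have one_neighbour: "vol (\<phi> a) = 1" if "a \<in> H" for a
    using ov[OF that that] \<phi>1 \<phi>2 that by (simp add: set_colouring_def)
  have "\<phi> u \<inter> \<phi> v = {}" if uv: "u \<in> H" "v \<in> H" "A u v" for u v
  proof (rule ccontr)
    assume "\<phi> u \<inter> \<phi> v \<noteq> {}"
    then obtain t where t: "t \<in> \<phi> u" "t \<in> \<phi> v" by blast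
    then have "t \<in> {0..<c}" using \<phi>(1) uv unfolding colour_set_def by blast
    then have "stable A {v\<in>H. t \<in> \<phi> v}" using \<phi>(2) by blast
    then show False using t uv unfolding stable_def by blast
  qed
  then show ?thesis using \<phi>(1) one_neighbour ov unfolding set_colouring_def by blast
qed

text \<open>The situation of a minimal counterexample. The saving is abstracted to a number
  \<open>e\<close> between 0 and 1/5, and \<open>IH\<close> admits arbitrary smaller graphs within
  the same bounds, so edges may be added after deleting vertices.\<close>

locale induction_step =
  fixes V :: "'a set" and A :: "'a \<Rightarrow> 'a \<Rightarrow> bool" and D :: nat and e :: real
  assumes fV: "finite V" and sym: "symp A" and irr: "irreflp A"
    and D6: "6 \<le> D" and e0: "0 \<le> e" and e5: "e \<le> 1/5"
    and deg: "\<And>v. v \<in> V \<Longrightarrow> card (nbrs V A v) \<le> D"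
    and clq: "\<And>K. K \<subseteq> V \<Longrightarrow> is_clique A K \<Longrightarrow> card K < D"
    and IH: "\<And>(V' :: 'a set) A'. card V' < card V \<Longrightarrow> finite V' \<Longrightarrow> symp A' \<Longrightarrow> irreflp A' \<Longrightarrow>
        (\<And>v. v \<in> V' \<Longrightarrow> card (nbrs V' A' v) \<le> D) \<Longrightarrow>
        (\<And>K. K \<subseteq> V' \<Longrightarrow> is_clique A' K \<Longrightarrow> card K < D) \<Longrightarrow> colourable V' A' (real D - e)"
begin

definition big_clique :: "'a set \<Rightarrow> bool" where
  "big_clique C \<longleftrightarrow> C \<subseteq> V \<and> is_clique A C \<and> card C = D - 1"

abbreviation palette :: real where "palette \<equiv> real D - e"

lemma adj_sym: "A u v \<Longrightarrow> A v u"
  using sym by (auto simp: symp_def)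

lemma adj_irrefl: "\<not> A u u"
  using irr by (auto simp: irreflp_def)

lemma cc0: "0 \<le> palette" "0 < palette"
  using D6 e5 by auto

end

section \<open>Deleting a big clique \<open>C\<close>, colouring the rest \<open>H\<close>, and
  extending to \<open>C\<close>\<close>

locale step_clique = induction_step +
  fixes C assumes C: "big_clique C"
begin

abbreviation H :: "'a set" where "H \<equiv> V - C"

definition blocked :: "('a \<Rightarrow> real set) \<Rightarrow> 'a \<Rightarrow> real set" where
  "blocked \<phi> u = (\<Union>a\<in>nbrs H A u. \<phi> a)"

lemma CV: "C \<subseteq> V" and Ccl: "is_clique A C" and Ccard: "card C = D - 1"
  using C by (auto simp: big_clique_def)

lemma fC: "finite C" and fH: "finite H"
  using CV fV finite_subset by auto

lemma card_nbrs_split: "card (nbrs V A a) = card (nbrs H A a) + card (nbrs C A a)"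
proof -
  have "nbrs V A a = nbrs H A a \<union> nbrs C A a" using CV by (auto simp: nbrs_def)
  then show ?thesis using fC fH by (simp add: card_Un_disjoint nbrs_def disjoint_iff)
qed

lemma card_nbrs_H: "a \<in> V \<Longrightarrow> card (nbrs H A a) + card (nbrs C A a) \<le> D"
  using deg[of a] card_nbrs_split[of a] by simp

lemma outside_degree: assumes u: "u \<in> C" shows "card (nbrs H A u) \<le> 2"
proof -
  have "nbrs C A u = C - {u}" using u Ccl adj_irrefl by (auto simp: nbrs_def is_clique_def)
  then have "card (nbrs C A u) = D - 2" using u fC Ccard by simp
  then show ?thesis using card_nbrs_H[of u] u CV D6 by auto
qed

lemma colour_set_bl: "set_colouring H A palette \<phi> \<Longrightarrow> colour_set palette (blocked \<phi> u)"
  unfolding blocked_def using fH by (intro colour_set_UN) (auto simp: set_colouring_def dest: subsetD[OF nbrs_subset])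

lemma vol_nb:
  assumes \<phi>: "set_colouring H' A palette \<phi>" and N: "finite N" "N \<subseteq> H'"
  shows "colour_set palette (\<Union>a\<in>N. \<phi> a)" "vol (\<Union>a\<in>N. \<phi> a) \<le> card N"
proof -
  have b: "\<forall>a\<in>N. colour_set palette (\<phi> a) \<and> vol (\<phi> a) = 1" using \<phi> N unfolding set_colouring_def by blast
  show "colour_set palette (\<Union>a\<in>N. \<phi> a)" using N b by (intro colour_set_UN) auto
  have "vol (\<Union>a\<in>N. \<phi> a) \<le> (\<Sum>a\<in>N. vol (\<phi> a))" using N b by (intro vol_UN_le[of _ palette]) auto
  then show "vol (\<Union>a\<in>N. \<phi> a) \<le> card N" using b by simp
qed

lemma vol_bl: assumes "set_colouring H A palette \<phi>" "u \<in> C" shows "vol (blocked \<phi> u) \<le> 2"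
  using vol_nb(2)[OF assms(1) finite_nbrs[OF fH] nbrs_subset, of A u] outside_degree[OF assms(2)]
  unfolding blocked_def by simp

definition free_colours :: "('a \<Rightarrow> real set) \<Rightarrow> 'a set \<Rightarrow> real set" where
  "free_colours \<phi> N = {0..<palette} - (\<Union>b\<in>N. \<phi> b)"

lemma free_colours:
  assumes "set_colouring H' A palette \<phi>" "finite N" "N \<subseteq> H'"
  shows "colour_set palette (free_colours \<phi> N)" "palette - card N \<le> vol (free_colours \<phi> N)"
proof -
  note b = vol_nb[OF assms]
  show "colour_set palette (free_colours \<phi> N)" unfolding free_colours_def by (intro colour_set_Diff b colour_set_ivl)
  have "palette - vol (\<Union>b\<in>N. \<phi> b) \<le> vol (free_colours \<phi> N)"
    unfolding free_colours_def using vol_Diff_ge[OF colour_set_ivl b(1)] vol_ivl[OF cc0(1)] by simp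
  then show "palette - card N \<le> vol (free_colours \<phi> N)" using b(2) by simp
qed

text \<open>A vertex has at most \<open>D\<close> neighbours, and each neighbour lost with
  \<open>C\<close> frees one unit of colour.\<close>

lemma free_colours_nbrs:
  assumes "set_colouring H A palette \<phi>" "a \<in> H"
  shows "colour_set palette (free_colours \<phi> (nbrs H A a))" "real (card (nbrs C A a)) - e \<le> vol (free_colours \<phi> (nbrs H A a))"
  using free_colours[OF assms(1) finite_nbrs[OF fH] nbrs_subset, of A a] card_nbrs_H[of a] assms(2) by auto

lemma recolour:
  assumes "set_colouring H A palette \<phi>" "a \<in> H" "colour_set palette X" "X \<subseteq> free_colours \<phi> (nbrs H A a)" "vol X = 1"
  shows "set_colouring H A palette (\<phi>(a := X))"
proof -
  have "set_colouring (insert a (H - {a})) A palette (\<phi>(a := X))"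
  proof (rule set_colouring_insert[OF _ sym irr])
    show "set_colouring (H - {a}) A palette \<phi>" using assms(1) by (rule set_colouring_mono) auto
    show "X \<inter> \<phi> b = {}" if "b \<in> nbrs (H - {a}) A a" for b
      using assms(4) that by (auto simp: free_colours_def nbrs_def)
  qed (use assms in auto)
  moreover have "insert a (H - {a}) = H" using assms(2) by auto
  ultimately show ?thesis by simp
qed

lemma blocked_upd: "a \<notin> nbrs H A u \<Longrightarrow> blocked (\<phi>(a := X)) u = blocked \<phi> u"
  unfolding blocked_def by (intro SUP_cong) auto

text \<open>New edges take the place of edges into \<open>C\<close>: if \<open>a\<close> gets at
  most as many as it has neighbours in \<open>C\<close>, the degree bound survives, and only a
  \<open>D\<close>-clique of old and new edges could prevent the use of \<open>IH\<close>. A new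
  edge forces disjoint colour sets.\<close>

lemma colour_with_edges:
  assumes sF: "\<And>a b. F a b \<Longrightarrow> F b a" and iF: "\<And>a. \<not> F a a"
    and dF: "\<And>a. a \<in> H \<Longrightarrow> card {b\<in>H. F a b} \<le> card (nbrs C A a)"
    and Q: "\<And>Q. Q \<subseteq> H \<Longrightarrow> card Q = D \<Longrightarrow> (\<forall>a\<in>Q. \<forall>b\<in>Q. a \<noteq> b \<longrightarrow> A a b \<or> F a b) \<Longrightarrow> False"
  shows "\<exists>\<phi>. set_colouring H A palette \<phi> \<and> (\<forall>a\<in>H. \<forall>b\<in>H. F a b \<longrightarrow> \<phi> a \<inter> \<phi> b = {})"
proof -
  define A' where "A' a b \<longleftrightarrow> A a b \<or> F a b" for a b
  have "colourable H A' palette"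
  proof (rule IH)
    have "C \<noteq> {}" using Ccard D6 by auto
    then show "card H < card V" using CV fV by (intro psubset_card_mono) auto
    show "symp A'" using adj_sym sF by (auto simp: symp_def A'_def)
    show "irreflp A'" using adj_irrefl iF by (auto simp: irreflp_def A'_def)
    show "card (nbrs H A' a) \<le> D" if "a \<in> H" for a
    proof -
      have "nbrs H A' a \<subseteq> nbrs H A a \<union> {b\<in>H. F a b}" by (auto simp: nbrs_def A'_def)
      then have "card (nbrs H A' a) \<le> card (nbrs H A a \<union> {b\<in>H. F a b})" using fV by (intro card_mono) auto
      also have "\<dots> \<le> card (nbrs H A a) + card {b\<in>H. F a b}" by (rule card_Un_le)
      also have "\<dots> \<le> D" using dF[OF that] card_nbrs_H[of a] that by auto
      finally show ?thesis .
    qed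
    show "card K < D" if K: "K \<subseteq> H" "is_clique A' K" for K
    proof (rule ccontr)
      assume "\<not> card K < D"
      then obtain Q where "Q \<subseteq> K" "card Q = D" using obtain_subset_with_card_n[of D K] by auto
      then show False using Q[of Q] K unfolding is_clique_def A'_def by blast
    qed
  qed (rule fH)
  then obtain \<phi> where \<phi>: "set_colouring H A' palette \<phi>" using colourable_imp_set_colouring[OF fH] by blast
  then show ?thesis unfolding set_colouring_def A'_def by blast
qed

lemma colour_rest: "\<exists>\<phi>. set_colouring H A palette \<phi>"
proof -
  have "\<exists>\<phi>. set_colouring H A palette \<phi> \<and> (\<forall>a\<in>H. \<forall>b\<in>H. (\<lambda>_ _. False) a b \<longrightarrow> \<phi> a \<inter> \<phi> b = {})"
  proof (rule colour_with_edges)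
    fix Q assume "Q \<subseteq> H" "card Q = D" "\<forall>a\<in>Q. \<forall>b\<in>Q. a \<noteq> b \<longrightarrow> A a b \<or> False"
    then show False using clq[of Q] by (auto simp: is_clique_def)
  qed auto
  then show ?thesis by blast
qed

text \<open>Hall's condition for a subset \<open>T\<close> of \<open>C\<close> says that the colours
  blocked for all of \<open>T\<close> measure at most \<open>palette - card T\<close>. If
  \<open>card T <= D - 3\<close> there is room for 3 - e, and a single vertex blocks at most 2. The
  remaining cases, \<open>C\<close> itself and \<open>C\<close> without one vertex, are the
  assumptions \<open>X\<close> and \<open>Y\<close>.\<close>

lemma extend_colouring:
  assumes \<phi>: "set_colouring H A palette \<phi>"
    and X: "colour_set palette X" "vol X \<le> 1 - e" "\<And>t. (\<forall>u\<in>C. t \<in> blocked \<phi> u) \<Longrightarrow> t \<in> X"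
    and Y: "\<And>w. w \<in> C \<Longrightarrow> \<exists>Y. colour_set palette Y \<and> vol Y \<le> 2 - e \<and> (\<forall>t. (\<forall>u\<in>C - {w}. t \<in> blocked \<phi> u) \<longrightarrow> t \<in> Y)"
  shows "colourable V A palette"
proof (rule colourable_by_duality[OF fV cc0(2)])
  fix b :: "'a \<Rightarrow> real" assume b: "\<And>v. v \<in> V \<Longrightarrow> 0 \<le> b v"
  obtain w where w: "weight_colouring H A palette w" "\<forall>P. sum w {S\<in>Pow H. P S} = vol {t\<in>{0..<palette}. P {v\<in>H. t \<in> \<phi> v}}"
    using sets_to_weights[OF fH cc0(1) \<phi>] by (elim exE conjE) (rule that)
  have w0: "0 \<le> w S" and wst: "w S \<noteq> 0 \<Longrightarrow> S \<subseteq> H \<and> stable A S" and wsum: "sum w (Pow H) = palette" for S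
    using w(1) by (auto simp: weight_colouring_def)
  define free where "free u S \<longleftrightarrow> S \<inter> nbrs H A u = {}" for u S
  have hall: "real (card T) \<le> sum w {S\<in>Pow H. \<exists>u\<in>T. free u S}" if T: "T \<subseteq> C" for T
  proof (cases "T = {}")
    case False
    define bad where "bad = {t\<in>{0..<palette}. \<forall>u\<in>T. t \<in> blocked \<phi> u}"
    have bad_eq: "bad = {0..<palette} - (\<Union>u\<in>T. {0..<palette} - blocked \<phi> u)" by (auto simp: bad_def)
    have bbad: "colour_set palette bad" unfolding bad_eq using finite_subset[OF T fC] colour_set_bl[OF \<phi>]
      by (intro colour_set_Diff colour_set_UN) auto
    have le: "vol bad \<le> vol Z" if "colour_set palette Z" "bad \<subseteq> Z" for Z using vol_mono[OF that(1) bbad that(2)] .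
    have "{t\<in>{0..<palette}. \<exists>u\<in>T. free u {v\<in>H. t \<in> \<phi> v}} = {0..<palette} - bad"
      unfolding bad_def free_def blocked_def nbrs_def by auto
    then have "sum w {S\<in>Pow H. \<exists>u\<in>T. free u S} = vol ({0..<palette} - bad)" using w(2) by simp
    also have "\<dots> \<ge> palette - vol bad" using vol_Diff_ge[OF colour_set_ivl bbad] vol_ivl[OF cc0(1)] by simp
    finally have ge: "palette - vol bad \<le> sum w {S\<in>Pow H. \<exists>u\<in>T. free u S}" .
    obtain u where u: "u \<in> T" using False by blast
    have cT: "card T \<le> D - 1" using card_mono[OF fC T] Ccard by simp
    consider "card T \<le> D - 3" | "card T = D - 2" | "card T = D - 1" using cT D6 by linarith
    then have "vol bad \<le> palette - card T"
    proof cases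
      case 1
      have "bad \<subseteq> blocked \<phi> u" using u by (auto simp: bad_def)
      then have "vol bad \<le> vol (blocked \<phi> u)" using colour_set_bl[OF \<phi>] by (intro le)
      also have "\<dots> \<le> 2" using u T by (intro vol_bl[OF \<phi>]) auto
      finally show ?thesis using 1 e5 D6 by linarith
    next
      case 2
      have "card (C - T) = 1" using card_Diff_subset[OF finite_subset[OF T fC] T] 2 Ccard D6 by simp
      then obtain z where z: "C - T = {z}" by (auto simp: card_1_singleton_iff)
      then have Tz: "T = C - {z}" "z \<in> C" using T by auto
      obtain Z where Z: "colour_set palette Z" "vol Z \<le> 2 - e" "\<forall>t. (\<forall>u\<in>C - {z}. t \<in> blocked \<phi> u) \<longrightarrow> t \<in> Z" using Y[OF Tz(2)] by blast
      have "bad \<subseteq> Z" unfolding bad_def Tz(1) using Z(3) by blast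
      then have "vol bad \<le> vol Z" using Z by (intro le)
      then show ?thesis using 2 Z(2) D6 by linarith
    next
      case 3
      then have "T = C" using card_subset_eq[OF fC T] Ccard by simp
      then have "bad \<subseteq> X" unfolding bad_def using X(3) by blast
      then have "vol bad \<le> vol X" using X by (intro le)
      then show ?thesis using 3 X(2) D6 by linarith
    qed
    then show ?thesis using ge by linarith
  qed (simp add: w0 sum_nonneg)
  \<comment> \<open>Gain from adding the best free vertex of \<open>C\<close> to the colour class
    \<open>S\<close>. By \<open>hall_layers\<close> the weighted gains make up for
    \<open>sum b C\<close>, so some enlarged class is heavy enough for the duality
    criterion.\<close>
  define g where "g S = Max (insert 0 (b ` {u\<in>C. free u S}))" for S
  have "sum b C \<le> (\<Sum>S\<in>Pow H. w S * g S)"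
    unfolding g_def by (rule hall_layers[OF fC _ w0 hall]) (use fH b CV in auto)
  moreover have "(\<Sum>S\<in>Pow H. w S * sum b S) = sum b H"
  proof -
    have "(\<Sum>S\<in>Pow H. w S * sum b S) = (\<Sum>S\<in>Pow H. \<Sum>v\<in>H. w S * (if v \<in> S then 1 else 0) * b v)"
    proof (intro sum.cong refl)
      fix S assume "S \<in> Pow H"
      then have "sum b S = (\<Sum>v\<in>H. if v \<in> S then b v else 0)" using fH by (simp add: sum.If_cases Int_absorb1)
      then show "w S * sum b S = (\<Sum>v\<in>H. w S * (if v \<in> S then 1 else 0) * b v)"
        by (simp add: sum_distrib_left) (intro sum.cong, auto)
    qed
    also have "\<dots> = (\<Sum>v\<in>H. cover (Pow H) w v * b v)"
      using fH by (subst sum.swap) (simp add: cover_alt sum_distrib_right)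
    also have "\<dots> = sum b H"
    proof (intro sum.cong refl)
      fix v assume v: "v \<in> H"
      have "\<phi> v \<subseteq> {0..<palette}" using \<phi> v unfolding set_colouring_def colour_set_def by blast
      then have "{t\<in>{0..<palette}. v \<in> {v\<in>H. t \<in> \<phi> v}} = \<phi> v" using v by blast
      then have "cover (Pow H) w v = vol (\<phi> v)"
        using w(2)[rule_format, of "\<lambda>S. v \<in> S"] by (simp add: cover_event)
      then show "cover (Pow H) w v * b v = b v" using \<phi> v by (simp add: set_colouring_def)
    qed
    finally show ?thesis .
  qed
  moreover have "sum b V = sum b H + sum b C" using CV fV by (simp add: sum.subset_diff)
  ultimately have tot: "sum b V \<le> (\<Sum>S\<in>Pow H. w S * (sum b S + g S))"
    by (simp add: distrib_left sum.distrib)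
  define X' where "X' = {S. S \<subseteq> V \<and> stable A S}"
  have fX': "finite X'" and neX': "X' \<noteq> {}" using fV by (auto simp: X'_def stable_def)
  define M where "M = Max (sum b ` X')"
  have "M \<in> sum b ` X'" unfolding M_def using fX' neX' by (intro Max_in) auto
  then obtain S0 where S0: "S0 \<in> X'" "sum b S0 = M" by auto
  have Mge: "sum b S \<le> M" if "S \<in> X'" for S unfolding M_def using fX' that by auto
  have "w S * (sum b S + g S) \<le> w S * M" if S: "S \<in> Pow H" for S
  proof (cases "w S = 0")
    case False
    then have st: "stable A S" "S \<subseteq> H" using wst by auto
    have fS: "finite S" using finite_subset[OF st(2) fH] .
    have "g S \<in> insert 0 (b ` {u\<in>C. free u S})" unfolding g_def using fC by (intro Max_in) auto
    then consider "g S = 0" | u where "u \<in> C" "free u S" "g S = b u" by auto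
    then have "sum b S + g S \<le> M"
    proof cases
      case 1
      then show ?thesis using Mge[of S] st by (auto simp: X'_def)
    next
      case 2
      have na: "\<not> A u s" "\<not> A s u" if "s \<in> S" for s
        using 2(2) that st(2) adj_sym unfolding free_def nbrs_def by blast+
      have "insert u S \<in> X'" using 2(1) CV st na adj_irrefl unfolding X'_def stable_def by blast
      then have "sum b (insert u S) \<le> M" by (rule Mge)
      moreover have "u \<notin> S" using 2(1) st by auto
      ultimately show ?thesis using 2(3) fS by simp
    qed
    then show ?thesis using w0 by (intro mult_left_mono)
  qed simp
  then have "(\<Sum>S\<in>Pow H. w S * (sum b S + g S)) \<le> (\<Sum>S\<in>Pow H. w S * M)" by (rule sum_mono)
  also have "\<dots> = palette * M" using wsum by (simp add: sum_distrib_right[symmetric])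
  finally have "sum b V \<le> palette * sum b S0" using tot S0 by simp
  then show "\<exists>S\<subseteq>V. stable A S \<and> sum b V \<le> palette * sum b S" using S0 by (auto simp: X'_def)
qed

end

lemma vol_le_add:
  assumes "colour_set c X" "colour_set c Y" "colour_set c Z" "Z \<subseteq> X \<union> Y"
  shows "vol Z \<le> vol X + vol Y"
  using vol_mono[OF colour_set_Un[OF assms(1,2)] assms(3,4)] vol_Un_le[OF assms(1,2)] by simp

text \<open>\<open>kmax\<close> ranges over all big cliques and outside vertices, not just over
  \<open>C\<close>: it is applied to cliques that come to light when added edges complete a set of
  \<open>D\<close> vertices.\<close>

locale step_vertex = step_clique +
  fixes x
  assumes xH: "x \<in> H" and k2: "2 \<le> card (nbrs C A x)"
    and kmax: "\<And>C' y. big_clique C' \<Longrightarrow> y \<in> V - C' \<Longrightarrow> card (nbrs C' A y) \<le> card (nbrs C A x)"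
begin

abbreviation K :: "'a set" where "K \<equiv> nbrs C A x"

lemma KC: "K \<subseteq> C"
  by (rule nbrs_subset)

lemma fK: "finite K"
  using fC by simp

lemma card_K_le: "card K \<le> D - 2"
proof (rule ccontr)
  assume "\<not> card K \<le> D - 2"
  then have "card C \<le> card K" using Ccard D6 by linarith
  then have "K = C" using card_seteq[OF fC KC] by simp
  then have "is_clique A (insert x C)" using Ccl adj_sym adj_irrefl unfolding is_clique_def nbrs_def by blast
  then have "card (insert x C) < D" using xH CV by (intro clq) auto
  then show False using xH fC Ccard D6 by simp
qed

lemma card_CK: "card (C - K) = D - 1 - card K"
  using card_Diff_subset[OF fK KC] Ccard by simp

lemma K_other: "\<exists>u\<in>K. u \<noteq> w"
proof (rule ccontr)
  assume "\<not> ?thesis"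
  then have "K \<subseteq> {w}" by blast
  then have "card K \<le> card {w}" by (intro card_mono) auto
  then show False using k2 by simp
qed

text \<open>All missing edges of \<open>Q\<close> lie at \<open>y\<close>, so \<open>Q - {y}\<close>
  is a big clique and \<open>kmax\<close> bounds the neighbours of \<open>y\<close> in it by
  \<open>card K\<close>; the others lie in \<open>Y\<close>. For small \<open>Y\<close> this
  excludes \<open>D\<close>-cliques completed by new edges at one vertex.\<close>

lemma clique_plus_star:
  assumes Q: "Q \<subseteq> V" "card Q = D" and y: "y \<in> Q"
    and adj: "\<And>u v. u \<in> Q \<Longrightarrow> v \<in> Q \<Longrightarrow> u \<noteq> v \<Longrightarrow> u \<noteq> y \<Longrightarrow> v \<noteq> y \<Longrightarrow> A u v"
    and Y: "\<And>u. u \<in> Q \<Longrightarrow> u \<noteq> y \<Longrightarrow> \<not> A y u \<Longrightarrow> u \<in> Y" and fY: "finite Y"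
  shows "D \<le> card K + 1 + card Y"
proof -
  have fQ: "finite Q" using finite_subset[OF Q(1) fV] .
  have "big_clique (Q - {y})" unfolding big_clique_def
    using Q y fQ adj by (auto simp: is_clique_def)
  then have le: "card (nbrs (Q - {y}) A y) \<le> card K" using y Q by (intro kmax) auto
  have "card (Q - {y}) - card Y \<le> card (Q - {y} - Y)" by (rule diff_card_le_card_Diff[OF fY])
  also have "\<dots> \<le> card (nbrs (Q - {y}) A y)" using fQ Y by (intro card_mono) (auto simp: nbrs_def)
  finally show ?thesis using le Q y fQ by simp
qed

end

section \<open>Twins: a second outside vertex \<open>z\<close> adjacent to all of
  \<open>K\<close>\<close>

locale step_twins = step_vertex +
  fixes z
  assumes zH: "z \<in> H" and zx: "z \<noteq> x" and Kz: "K \<subseteq> nbrs C A z"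
begin

lemma nbrs_z: "nbrs C A z = K"
  using card_seteq[OF _ Kz] kmax[OF C] zH fC by auto

lemma nbrs_K: assumes u: "u \<in> K" shows "nbrs H A u = {x, z}"
proof -
  have "{x, z} \<subseteq> nbrs H A u" using u Kz xH zH adj_sym by (auto simp: nbrs_def)
  moreover have "card (nbrs H A u) \<le> card {x, z}" using outside_degree[of u] u KC zx by auto
  ultimately show ?thesis using card_seteq[of "nbrs H A u" "{x, z}"] fH by simp
qed

lemma blocked_K: "u \<in> K \<Longrightarrow> blocked \<phi> u = \<phi> x \<union> \<phi> z"
  by (simp add: blocked_def nbrs_K)

lemma nbrs_CK: assumes "v \<in> C - K" shows "x \<notin> nbrs H A v" "z \<notin> nbrs H A v"
  using assms nbrs_z adj_sym by (auto simp: nbrs_def)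

lemma blocked_CK: "v \<in> C - K \<Longrightarrow> blocked (\<phi>(x := X)) v = blocked \<phi> v" "v \<in> C - K \<Longrightarrow> blocked (\<phi>(z := X)) v = blocked \<phi> v"
  using nbrs_CK blocked_upd by auto

text \<open>Every vertex of \<open>K\<close> has the blocked set
  \<open>\<phi> x \<union> \<phi> z\<close>, and \<open>v1\<close> and \<open>v2\<close> cut its two
  parts down to \<open>e\<close> each, with 2e <= 1 - e. If one vertex of \<open>C\<close> is left
  out, a vertex of \<open>K\<close> and one of \<open>v1\<close>, \<open>v2\<close> remain, which
  leaves at most 1 + e <= 2 - e.\<close>

lemma twins_extend:
  assumes \<phi>: "set_colouring H A palette \<phi>" and v: "v1 \<in> C - K" "v2 \<in> C - K" "v1 \<noteq> v2"
    and le: "vol (\<phi> x \<inter> blocked \<phi> v1) \<le> e" "vol (\<phi> z \<inter> blocked \<phi> v2) \<le> e"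
  shows "colourable V A palette"
proof (rule extend_colouring[OF \<phi>])
  have b: "colour_set palette (\<phi> x)" "colour_set palette (\<phi> z)" "vol (\<phi> x) = 1" "vol (\<phi> z) = 1" using \<phi> xH zH by (auto simp: set_colouring_def)
  note bb = colour_set_bl[OF \<phi>]
  have bi: "colour_set palette (\<phi> x \<inter> blocked \<phi> v1)" "colour_set palette (\<phi> z \<inter> blocked \<phi> v2)" using b bb by (auto intro: colour_set_Int)
  let ?X = "(\<phi> x \<inter> blocked \<phi> v1) \<union> (\<phi> z \<inter> blocked \<phi> v2)"
  show "colour_set palette ?X" using bi by (rule colour_set_Un)
  show "vol ?X \<le> 1 - e" using vol_Un_le[OF bi] le e5 by linarith
  obtain u0 where u0: "u0 \<in> K" using K_other by blast
  show "t \<in> ?X" if "\<forall>u\<in>C. t \<in> blocked \<phi> u" for t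
    using that u0 KC v blocked_K[OF u0, of \<phi>] by blast
  fix w
  obtain u where u: "u \<in> K" "u \<noteq> w" using K_other by blast
  show "\<exists>Y. colour_set palette Y \<and> vol Y \<le> 2 - e \<and> (\<forall>t. (\<forall>u\<in>C - {w}. t \<in> blocked \<phi> u) \<longrightarrow> t \<in> Y)"
  proof (cases "w = v1")
    case False
    have "vol ((\<phi> x \<inter> blocked \<phi> v1) \<union> \<phi> z) \<le> 2 - e" using vol_Un_le[OF bi(1) b(2)] le b(4) e5 by linarith
    moreover have "t \<in> (\<phi> x \<inter> blocked \<phi> v1) \<union> \<phi> z" if "\<forall>u\<in>C - {w}. t \<in> blocked \<phi> u" for t
    proof -
      have "t \<in> blocked \<phi> u" "t \<in> blocked \<phi> v1" using that u KC v(1) False by blast+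
      then show ?thesis using blocked_K[OF u(1)] by blast
    qed
    ultimately show ?thesis using colour_set_Un[OF bi(1) b(2)] by blast
  next
    case True
    have "vol ((\<phi> z \<inter> blocked \<phi> v2) \<union> \<phi> x) \<le> 2 - e" using vol_Un_le[OF bi(2) b(1)] le b(3) e5 by linarith
    moreover have "t \<in> (\<phi> z \<inter> blocked \<phi> v2) \<union> \<phi> x" if "\<forall>u\<in>C - {w}. t \<in> blocked \<phi> u" for t
    proof -
      have "t \<in> blocked \<phi> u" "t \<in> blocked \<phi> v2" using that u KC v True by blast+
      then show ?thesis using blocked_K[OF u(1)] by blast
    qed
    ultimately show ?thesis using colour_set_Un[OF bi(2) b(1)] by blast
  qed
qed

text \<open>A single vertex \<open>v\<close> of \<open>C - K\<close> remains to cut down both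
  \<open>x\<close> and \<open>z\<close>. These are not adjacent, so they can share half a unit
  \<open>Y\<close>, while their other halves avoid \<open>blocked \<phi> v\<close>. Then colours
  blocked everywhere lie in \<open>Y\<close>, and both colour sets together measure at most
  3/2.\<close>

lemma triple_diamond:
  assumes k: "card K = D - 2"
  shows "colourable V A palette"
proof -
  have "card (C - K) = 1" using card_CK k D6 by simp
  then obtain v where v: "C - K = {v}" by (auto simp: card_1_singleton_iff)
  have vC: "v \<in> C - K" using v by auto
  have xz: "\<not> A x z"
  proof
    assume "A x z"
    then have "is_clique A (insert x (insert z K))"
      using Ccl KC Kz adj_sym unfolding is_clique_def nbrs_def by blast
    then have "card (insert x (insert z K)) < D" using xH zH KC CV by (intro clq) auto
    moreover have "x \<notin> K" "z \<notin> K" using xH zH KC by auto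
    ultimately show False using k fK zx D6 by simp
  qed
  obtain \<phi> where \<phi>: "set_colouring H A palette \<phi>" using colour_rest by blast
  define Lx where "Lx = free_colours \<phi> (nbrs H A x)"
  define Lz where "Lz = free_colours \<phi> (nbrs H A z)"
  have Lx: "colour_set palette Lx" "real (D - 2) - e \<le> vol Lx" using free_colours_nbrs[OF \<phi> xH] k by (auto simp: Lx_def)
  have Lz: "colour_set palette Lz" "real (D - 2) - e \<le> vol Lz" using free_colours_nbrs[OF \<phi> zH] k nbrs_z by (auto simp: Lz_def)
  have D2: "real (D - 2) = real D - 2" using D6 by simp
  have "vol (Lx \<union> Lz) \<le> palette" using vol_mono[OF colour_set_ivl, of palette "Lx \<union> Lz"] colour_set_Un[OF Lx(1) Lz(1)] vol_ivl[OF cc0(1)]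
    by (auto simp: colour_set_def)
  then have "1/2 \<le> vol (Lx \<inter> Lz)" using vol_Un_Int[OF Lx(1) Lz(1)] Lx(2) Lz(2) D2 D6 e5 by linarith
  then obtain Y where Y: "colour_set palette Y" "Y \<subseteq> Lx \<inter> Lz" "vol Y = 1/2"
    using vol_subset_exists[OF colour_set_Int[OF Lx(1) Lz(1)], of "1/2"] by auto
  have bv: "colour_set palette (blocked \<phi> v)" "vol (blocked \<phi> v) \<le> 2" using colour_set_bl[OF \<phi>] vol_bl[OF \<phi>] vC by auto
  have bvY: "colour_set palette (blocked \<phi> v \<union> Y)" "vol (blocked \<phi> v \<union> Y) \<le> 5/2"
    using colour_set_Un[OF bv(1) Y(1)] vol_Un_le[OF bv(1) Y(1)] bv(2) Y(3) by auto
  have "1/2 \<le> vol (Lx - (blocked \<phi> v \<union> Y))" using vol_Diff_ge[OF Lx(1) bvY(1)] bvY(2) Lx(2) D2 D6 e5 by linarith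
  then obtain X' where X': "colour_set palette X'" "X' \<subseteq> Lx - (blocked \<phi> v \<union> Y)" "vol X' = 1/2"
    using vol_subset_exists[OF colour_set_Diff[OF Lx(1) bvY(1)], of "1/2"] by auto
  have "1/2 \<le> vol (Lz - (blocked \<phi> v \<union> Y))" using vol_Diff_ge[OF Lz(1) bvY(1)] bvY(2) Lz(2) D2 D6 e5 by linarith
  then obtain Z' where Z': "colour_set palette Z'" "Z' \<subseteq> Lz - (blocked \<phi> v \<union> Y)" "vol Z' = 1/2"
    using vol_subset_exists[OF colour_set_Diff[OF Lz(1) bvY(1)], of "1/2"] by auto
  have mX: "vol (Y \<union> X') = 1" using vol_disj[OF Y(1) X'(1)] X' Y by auto
  have mZ: "vol (Y \<union> Z') = 1" using vol_disj[OF Y(1) Z'(1)] Z' Y by auto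
  define \<phi>1 where "\<phi>1 = \<phi>(x := Y \<union> X')"
  have \<phi>1: "set_colouring H A palette \<phi>1" unfolding \<phi>1_def
    using X' Y by (intro recolour[OF \<phi> xH colour_set_Un[OF Y(1) X'(1)] _ mX]) (auto simp: Lx_def)
  have "free_colours \<phi>1 (nbrs H A z) = Lz"
  proof -
    have "x \<notin> nbrs H A z" using xz adj_sym by (auto simp: nbrs_def)
    then show ?thesis unfolding free_colours_def \<phi>1_def Lz_def by (intro arg_cong2[where f = "(-)"] SUP_cong) auto
  qed
  define \<phi>2 where "\<phi>2 = \<phi>1(z := Y \<union> Z')"
  have \<phi>2: "set_colouring H A palette \<phi>2" unfolding \<phi>2_def
    using Z' Y \<open>free_colours \<phi>1 (nbrs H A z) = Lz\<close> by (intro recolour[OF \<phi>1 zH colour_set_Un[OF Y(1) Z'(1)] _ mZ]) auto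
  have vals: "\<phi>2 x = Y \<union> X'" "\<phi>2 z = Y \<union> Z'" "blocked \<phi>2 v = blocked \<phi> v"
    using zx blocked_CK[OF vC] by (auto simp: \<phi>2_def \<phi>1_def)
  show ?thesis
  proof (rule extend_colouring[OF \<phi>2 Y(1)])
    show "vol Y \<le> 1 - e" using Y e5 by simp
    obtain u0 where u0: "u0 \<in> K" using K_other by blast
    show "t \<in> Y" if "\<forall>u\<in>C. t \<in> blocked \<phi>2 u" for t
    proof -
      have "t \<in> blocked \<phi>2 u0" "t \<in> blocked \<phi> v" using that u0 KC vC vals by blast+
      then have "t \<in> Y \<union> X' \<or> t \<in> Y \<union> Z'" "t \<in> blocked \<phi> v" using blocked_K[OF u0, of \<phi>2] vals by auto
      then show ?thesis using X'(2) Z'(2) by blast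
    qed
    fix w
    obtain u where u: "u \<in> K" "u \<noteq> w" using K_other by blast
    have "vol ((Y \<union> X') \<union> Z') \<le> vol (Y \<union> X') + vol Z'" by (intro vol_Un_le[of palette] colour_set_Un Y X' Z')
    then have "vol ((Y \<union> X') \<union> Z') \<le> 2 - e" using mX Z' e5 by simp
    moreover have "t \<in> (Y \<union> X') \<union> Z'" if "\<forall>u\<in>C - {w}. t \<in> blocked \<phi>2 u" for t
    proof -
      have "t \<in> blocked \<phi>2 u" using that u KC by blast
      then show ?thesis using blocked_K[OF u(1), of \<phi>2] vals by auto
    qed
    moreover have "colour_set palette ((Y \<union> X') \<union> Z')" by (intro colour_set_Un Y X' Z')
    ultimately show "\<exists>Y. colour_set palette Y \<and> vol Y \<le> 2 - e \<and> (\<forall>t. (\<forall>u\<in>C - {w}. t \<in> blocked \<phi>2 u) \<longrightarrow> t \<in> Y)" by blast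
  qed
qed

text \<open>Colour \<open>x\<close> before \<open>z\<close>, ignoring the edge between them, if there is one.\<close>

lemma recolour_two:
  assumes \<phi>: "set_colouring H A palette \<phi>" and X: "colour_set palette X" "X \<subseteq> free_colours \<phi> (nbrs (H - {z}) A x)" "vol X = 1"
    and B: "colour_set palette B"
  shows "\<exists>Z. set_colouring H A palette (\<phi>(x := X, z := Z)) \<and> colour_set palette Z \<and> vol Z = 1 \<and> vol (Z \<inter> B) \<le> max 0 (1 - (real (card K) - e - vol B))"
proof -
  define \<phi>1 where "\<phi>1 = \<phi>(x := X)"
  have "set_colouring (insert x (H - {z} - {x})) A palette \<phi>1" unfolding \<phi>1_def
  proof (rule set_colouring_insert[OF _ sym irr])
    show "set_colouring (H - {z} - {x}) A palette \<phi>" using \<phi> by (rule set_colouring_mono) auto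
    show "X \<inter> \<phi> b = {}" if "b \<in> nbrs (H - {z} - {x}) A x" for b
      using X(2) that by (auto simp: free_colours_def nbrs_def)
  qed (use X in auto)
  moreover have "insert x (H - {z} - {x}) = H - {z}" using xH zx by auto
  ultimately have \<phi>1: "set_colouring (H - {z}) A palette \<phi>1" by simp
  have sub: "nbrs H A z \<subseteq> H - {z}" using adj_irrefl by (auto simp: nbrs_def)
  define L where "L = free_colours \<phi>1 (nbrs H A z)"
  have L: "colour_set palette L" "palette - card (nbrs H A z) \<le> vol L" unfolding L_def by (rule free_colours[OF \<phi>1 finite_nbrs[OF fH] sub])+
  have "card (nbrs H A z) + card K \<le> D" using card_nbrs_H[of z] zH nbrs_z by auto
  then have Lk: "real (card K) - e \<le> vol L" using L(2) by linarith
  have "2 \<le> real (card K)" using k2 by simp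
  then have "1 \<le> vol L" using Lk e5 by linarith
  then obtain Z where Z: "colour_set palette Z" "Z \<subseteq> L" "vol Z = 1" "vol (Z \<inter> B) \<le> max 0 (1 - vol (L - B))"
    using vol_subset_avoiding[OF L(1) B, of 1] by auto
  have "vol (Z \<inter> B) \<le> max 0 (1 - (real (card K) - e - vol B))"
    using Z(4) vol_Diff_ge[OF L(1) B] Lk by linarith
  moreover have "set_colouring (insert z (H - {z})) A palette (\<phi>1(z := Z))"
  proof (rule set_colouring_insert[OF \<phi>1 sym irr])
    show "Z \<inter> \<phi>1 b = {}" if "b \<in> nbrs (H - {z}) A z" for b
      using Z(2) that by (auto simp: L_def free_colours_def nbrs_def)
  qed (use Z in auto)
  moreover have "insert z (H - {z}) = H" using zH by auto
  ultimately show ?thesis using Z by (auto simp: \<phi>1_def)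
qed

text \<open>From \<open>card K >= 3\<close> both \<open>x\<close> and \<open>z\<close> can choose
  from 3 - e colours, of which \<open>v1\<close> or \<open>v2\<close> blocks at most 2, so an
  overlap of at most \<open>e\<close> remains. From \<open>card K <= D - 3\<close> there are two
  such vertices.\<close>

lemma twins_mid:
  assumes k: "3 \<le> card K" "card K \<le> D - 3"
  shows "colourable V A palette"
proof -
  have "2 \<le> card (C - K)" using card_CK k D6 by simp
  then obtain T where "T \<subseteq> C - K" "card T = 2" by (metis obtain_subset_with_card_n)
  then obtain v1 v2 where v: "v1 \<in> C - K" "v2 \<in> C - K" "v1 \<noteq> v2" by (auto simp: card_2_iff)
  obtain \<phi> where \<phi>: "set_colouring H A palette \<phi>" using colour_rest by blast
  have bv: "colour_set palette (blocked \<phi> v1)" "colour_set palette (blocked \<phi> v2)" "vol (blocked \<phi> v1) \<le> 2" "vol (blocked \<phi> v2) \<le> 2"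
    using colour_set_bl[OF \<phi>] vol_bl[OF \<phi>] v by auto
  define L where "L = free_colours \<phi> (nbrs (H - {z}) A x)"
  have "nbrs (H - {z}) A x \<subseteq> nbrs H A x" by (auto simp: nbrs_def)
  then have "card (nbrs (H - {z}) A x) \<le> card (nbrs H A x)" using fH by (intro card_mono) auto
  moreover have "card (nbrs H A x) + card K \<le> D" using card_nbrs_H[of x] xH by auto
  moreover have fL: "finite (nbrs (H - {z}) A x)" "nbrs (H - {z}) A x \<subseteq> H" using fH by simp (auto simp: nbrs_def)
  moreover have L: "colour_set palette L" "palette - card (nbrs (H - {z}) A x) \<le> vol L" unfolding L_def by (rule free_colours[OF \<phi> fL])+
  ultimately have L3: "3 - e \<le> vol L" using k(1) by linarith
  then have "1 \<le> vol L" using e5 by linarith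
  then obtain X where X: "colour_set palette X" "X \<subseteq> L" "vol X = 1" "vol (X \<inter> blocked \<phi> v1) \<le> max 0 (1 - vol (L - blocked \<phi> v1))"
    using vol_subset_avoiding[OF L(1) bv(1), of 1] by auto
  have Xe: "vol (X \<inter> blocked \<phi> v1) \<le> e" using X(4) vol_Diff_ge[OF L(1) bv(1)] bv(3) L3 e0 by linarith
  obtain Z where Z: "set_colouring H A palette (\<phi>(x := X, z := Z))" "colour_set palette Z" "vol Z = 1"
    "vol (Z \<inter> blocked \<phi> v2) \<le> max 0 (1 - (real (card K) - e - vol (blocked \<phi> v2)))"
    using recolour_two[OF \<phi> X(1) _ X(3) bv(2)] X(2) unfolding L_def by blast
  have Ze: "vol (Z \<inter> blocked \<phi> v2) \<le> e" using Z(4) bv(4) k(1) e0 by linarith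
  show ?thesis
    by (rule twins_extend[OF Z(1) v]) (use Xe Ze zx blocked_CK[OF v(1)] blocked_CK[OF v(2)] in auto)
qed

text \<open>For \<open>card K = 2\<close> there are only 2 - e free colours and recolouring is too
  weak; instead \<open>x\<close> is joined to the outside neighbours of \<open>v1\<close> and
  \<open>z\<close> to those of \<open>v2\<close>, which makes the overlaps in
  \<open>twins_extend\<close> empty. The edges that \<open>x\<close> and \<open>z\<close> lost pay
  for this.\<close>

definition twin_edges :: "'a \<Rightarrow> 'a \<Rightarrow> 'a \<Rightarrow> 'a \<Rightarrow> bool" where
  "twin_edges v1 v2 a b \<longleftrightarrow> (a = x \<and> b \<in> nbrs H A v1) \<or> (b = x \<and> a \<in> nbrs H A v1) \<or>
     (a = z \<and> b \<in> nbrs H A v2) \<or> (b = z \<and> a \<in> nbrs H A v2)"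

lemma twin_edges_colourable:
  assumes k: "card K = 2" and v: "v1 \<in> C - K" "v2 \<in> C - K" "v1 \<noteq> v2"
    and Q: "\<And>Q. Q \<subseteq> H \<Longrightarrow> card Q = D \<Longrightarrow> (\<forall>a\<in>Q. \<forall>b\<in>Q. a \<noteq> b \<longrightarrow> A a b \<or> twin_edges v1 v2 a b) \<Longrightarrow> False"
  shows "colourable V A palette"
proof -
  note n = nbrs_CK[OF v(1)] nbrs_CK[OF v(2)]
  have c2: "card (nbrs H A v1) \<le> 2" "card (nbrs H A v2) \<le> 2" using outside_degree v by auto
  have "\<exists>\<phi>. set_colouring H A palette \<phi> \<and> (\<forall>a\<in>H. \<forall>b\<in>H. twin_edges v1 v2 a b \<longrightarrow> \<phi> a \<inter> \<phi> b = {})"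
  proof (rule colour_with_edges[OF _ _ _ Q])
    show "twin_edges v1 v2 b a" if "twin_edges v1 v2 a b" for a b using that by (auto simp: twin_edges_def)
    show "\<not> twin_edges v1 v2 a a" for a using n by (auto simp: twin_edges_def)
    show "card {b\<in>H. twin_edges v1 v2 a b} \<le> card (nbrs C A a)" if a: "a \<in> H" for a
    proof -
      consider "a = x" | "a = z" | "a \<noteq> x" "a \<noteq> z" by blast
      then show ?thesis
      proof cases
        case 1
        have "{b\<in>H. twin_edges v1 v2 a b} \<subseteq> nbrs H A v1" using 1 n zx by (auto simp: twin_edges_def)
        then have "card {b\<in>H. twin_edges v1 v2 a b} \<le> card (nbrs H A v1)" using fH by (intro card_mono) auto
        then show ?thesis using c2 k 1 by simp
      next
        case 2
        have "{b\<in>H. twin_edges v1 v2 a b} \<subseteq> nbrs H A v2" using 2 n zx by (auto simp: twin_edges_def)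
        then have "card {b\<in>H. twin_edges v1 v2 a b} \<le> card (nbrs H A v2)" using fH by (intro card_mono) auto
        then show ?thesis using c2 k 2 nbrs_z by simp
      next
        case 3
        define S where "S = (if a \<in> nbrs H A v1 then {x} else {}) \<union> (if a \<in> nbrs H A v2 then {z} else {})"
        define T where "T = (if a \<in> nbrs H A v1 then {v1} else {}) \<union> (if a \<in> nbrs H A v2 then {v2} else {})"
        have "{b\<in>H. twin_edges v1 v2 a b} \<subseteq> S" using 3 by (auto simp: twin_edges_def S_def)
        then have "card {b\<in>H. twin_edges v1 v2 a b} \<le> card S" by (intro card_mono) (auto simp: S_def)
        also have "card S = card T" using v(3) zx by (auto simp: S_def T_def)
        also have "T \<subseteq> nbrs C A a" using v adj_sym by (auto simp: T_def nbrs_def)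
        then have "card T \<le> card (nbrs C A a)" using fC by (intro card_mono) auto
        finally show ?thesis .
      qed
    qed
  qed
  then obtain \<phi> where \<phi>: "set_colouring H A palette \<phi>" "\<forall>a\<in>H. \<forall>b\<in>H. twin_edges v1 v2 a b \<longrightarrow> \<phi> a \<inter> \<phi> b = {}" by blast
  have "\<phi> x \<inter> blocked \<phi> v1 = {}" using \<phi>(2) xH unfolding blocked_def twin_edges_def nbrs_def by blast
  moreover have "\<phi> z \<inter> blocked \<phi> v2 = {}" using \<phi>(2) zH unfolding blocked_def twin_edges_def nbrs_def by blast
  ultimately show ?thesis using twins_extend[OF \<phi>(1) v] e0 by simp
qed

lemma twin_edges_obstruction:
  assumes "card K = 2" "v1 \<in> C - K" "v2 \<in> C - K" "v1 \<noteq> v2" and nc: "\<not> colourable V A palette"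
  shows "\<exists>Q. Q \<subseteq> H \<and> card Q = D \<and> (\<forall>a\<in>Q. \<forall>b\<in>Q. a \<noteq> b \<longrightarrow> A a b \<or> twin_edges v1 v2 a b)"
proof (rule ccontr)
  assume n: "\<not> ?thesis"
  have "colourable V A palette" by (rule twin_edges_colourable[OF assms(1-4)]) (use n in blast)
  then show False using nc by blast
qed

text \<open>If all missing edges of \<open>Q\<close> were at one of \<open>x\<close> and
  \<open>z\<close>, then \<open>clique_plus_star\<close> with at most two exceptions would give D <=
  2 + 1 + 2, against \<open>D6\<close>. So both vertices are in \<open>Q\<close>, and each of them
  really uses a new edge.\<close>

lemma twin_edges_obstruction_shape:
  assumes k: "card K = 2" and v: "v1 \<in> C - K" "v2 \<in> C - K"
    and Q: "Q \<subseteq> H" "card Q = D" "\<forall>a\<in>Q. \<forall>b\<in>Q. a \<noteq> b \<longrightarrow> A a b \<or> twin_edges v1 v2 a b"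
  shows "x \<in> Q \<and> z \<in> Q \<and> A x z \<and> (\<exists>a\<in>Q. a \<in> nbrs H A v1 \<and> \<not> A x a) \<and> (\<exists>a\<in>Q. a \<in> nbrs H A v2 \<and> \<not> A z a)"
proof -
  note n = nbrs_CK[OF v(1)] nbrs_CK[OF v(2)]
  have QV: "Q \<subseteq> V" using Q by auto
  have c2: "card (nbrs H A v1) \<le> 2" "card (nbrs H A v2) \<le> 2" using outside_degree v by auto
  have Qx: "A a b" if "a \<in> Q" "b \<in> Q" "a \<noteq> b" "a \<noteq> x" "b \<noteq> x" "a \<noteq> z" "b \<noteq> z" for a b
    using Q(3) that by (auto simp: twin_edges_def)
  have no_x: False if "\<And>a. a \<in> Q \<Longrightarrow> x \<in> Q \<Longrightarrow> a \<noteq> x \<Longrightarrow> A x a"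
  proof (cases "z \<in> Q")
    case True
    have ad: "A u w" if "u \<in> Q" "w \<in> Q" "u \<noteq> w" "u \<noteq> z" "w \<noteq> z" for u w
      using \<open>\<And>a. a \<in> Q \<Longrightarrow> x \<in> Q \<Longrightarrow> a \<noteq> x \<Longrightarrow> A x a\<close>[of u] \<open>\<And>a. a \<in> Q \<Longrightarrow> x \<in> Q \<Longrightarrow> a \<noteq> x \<Longrightarrow> A x a\<close>[of w] Qx[of u w] that adj_sym
      by (cases "u = x"; cases "w = x") auto
    have "u \<in> nbrs H A v2" if "u \<in> Q" "u \<noteq> z" "\<not> A z u" for u
      using Q(3) True that n zx by (auto simp: twin_edges_def)
    from clique_plus_star[OF QV Q(2) True ad this finite_nbrs[OF fH]] show False using k c2 D6 by simp
  next
    case False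
    have "is_clique A Q" unfolding is_clique_def
    proof (intro ballI impI)
      fix u w assume uw: "u \<in> Q" "w \<in> Q" "u \<noteq> w"
      show "A u w"
        using \<open>\<And>a. a \<in> Q \<Longrightarrow> x \<in> Q \<Longrightarrow> a \<noteq> x \<Longrightarrow> A x a\<close>[of u] \<open>\<And>a. a \<in> Q \<Longrightarrow> x \<in> Q \<Longrightarrow> a \<noteq> x \<Longrightarrow> A x a\<close>[of w] Qx[of u w] uw adj_sym False
        by (cases "u = x"; cases "w = x") auto
    qed
    then show False using clq[OF QV] Q(2) by simp
  qed
  have no_z: False if hz: "\<And>a. a \<in> Q \<Longrightarrow> z \<in> Q \<Longrightarrow> a \<noteq> z \<Longrightarrow> A z a"
  proof (cases "x \<in> Q")
    case True
    have ad: "A u w" if "u \<in> Q" "w \<in> Q" "u \<noteq> w" "u \<noteq> x" "w \<noteq> x" for u w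
      using hz[of u] hz[of w] Qx[of u w] that adj_sym by (cases "u = z"; cases "w = z") auto
    have "u \<in> nbrs H A v1" if "u \<in> Q" "u \<noteq> x" "\<not> A x u" for u
      using Q(3) True that n zx hz[of x] adj_sym by (auto simp: twin_edges_def)
    from clique_plus_star[OF QV Q(2) True ad this finite_nbrs[OF fH]] show False using k c2 D6 by simp
  next
    case False
    then show False using no_x by blast
  qed
  have xQ: "x \<in> Q" using no_x by blast
  have zQ: "z \<in> Q" using no_z by blast
  have xz: "A x z" using Q(3) xQ zQ zx n by (auto simp: twin_edges_def)
  have "\<exists>a\<in>Q. a \<in> nbrs H A v1 \<and> \<not> A x a"
  proof (rule ccontr)
    assume h: "\<not> ?thesis"
    show False
    proof (rule no_x)
      fix a assume "a \<in> Q" "x \<in> Q" "a \<noteq> x"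
      then have "A x a \<or> twin_edges v1 v2 x a" "a \<in> nbrs H A v1 \<longrightarrow> A x a" using Q(3) h by auto
      then show "A x a" using xz n zx by (auto simp: twin_edges_def)
    qed
  qed
  moreover have "\<exists>a\<in>Q. a \<in> nbrs H A v2 \<and> \<not> A z a"
  proof (rule ccontr)
    assume h: "\<not> ?thesis"
    show False
    proof (rule no_z)
      fix a assume "a \<in> Q" "z \<in> Q" "a \<noteq> z"
      then have "A z a \<or> twin_edges v1 v2 z a" "a \<in> nbrs H A v2 \<longrightarrow> A z a" using Q(3) h by auto
      then show "A z a" using adj_sym[OF xz] n zx by (auto simp: twin_edges_def)
    qed
  qed
  ultimately show ?thesis using xQ zQ xz by blast
qed

text \<open>Obstructions for both orders give \<open>v1\<close> two outside neighbours:
  \<open>a\<close> in \<open>Q\<close>, not adjacent to \<open>x\<close>, and \<open>b\<close> in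
  \<open>Q'\<close>, adjacent to \<open>x\<close> but not to \<open>z\<close>. Then
  \<open>b\<close>, \<open>z\<close> and all of \<open>Q\<close> except \<open>x\<close>,
  \<open>z\<close>, \<open>a\<close> are D - 1 neighbours of \<open>x\<close> in \<open>H\<close>,
  one too many next to the two in \<open>K\<close>.\<close>

lemma twin_edges_swap:
  assumes k: "card K = 2" and v: "v1 \<in> C - K" "v2 \<in> C - K"
    and dj: "nbrs H A v1 \<inter> nbrs H A v2 = {}"
    and Q: "Q \<subseteq> H" "card Q = D" "\<forall>a\<in>Q. \<forall>b\<in>Q. a \<noteq> b \<longrightarrow> A a b \<or> twin_edges v1 v2 a b"
    and Q': "Q' \<subseteq> H" "card Q' = D" "\<forall>a\<in>Q'. \<forall>b\<in>Q'. a \<noteq> b \<longrightarrow> A a b \<or> twin_edges v2 v1 a b"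
  shows False
proof -
  note n = nbrs_CK[OF v(1)] nbrs_CK[OF v(2)]
  note T = twin_edges_obstruction_shape[OF k v Q] and T' = twin_edges_obstruction_shape[OF k v(2,1) Q']
  have xz: "A x z" and xQ: "x \<in> Q" and zQ: "z \<in> Q" using T by auto
  obtain a where a: "a \<in> Q" "a \<in> nbrs H A v1" "\<not> A x a" using T by blast
  obtain b where b: "b \<in> Q'" "b \<in> nbrs H A v1" "\<not> A z b" using T' by blast
  have "A x b"
  proof -
    have "x \<in> Q'" "b \<noteq> x" "b \<noteq> z" using T' b n by auto
    then have "A x b \<or> twin_edges v2 v1 x b" using Q'(3) b by auto
    moreover have "b \<notin> nbrs H A v2" using dj b by blast
    ultimately show ?thesis using n \<open>b \<noteq> z\<close> zx by (auto simp: twin_edges_def)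
  qed
  then have ab: "a \<noteq> b" using a by auto
  have ax: "a \<noteq> x" "a \<noteq> z" using a n by auto
  have bx: "b \<noteq> x" "b \<noteq> z" using b n by auto
  have N1: "nbrs H A v1 = {a, b}"
  proof -
    have "card (nbrs H A v1) \<le> card {a, b}" using outside_degree[of v1] v ab by auto
    then show ?thesis using card_seteq[of "nbrs H A v1" "{a, b}"] fH a b by auto
  qed
  have bQ: "b \<notin> Q"
  proof
    assume "b \<in> Q"
    then have "A z b \<or> twin_edges v1 v2 z b" using Q(3) zQ bx by auto
    moreover have "b \<notin> nbrs H A v2" using dj b by blast
    ultimately show False using b n bx zx by (auto simp: twin_edges_def)
  qed
  have sub: "insert b (insert z (Q - {x, z, a})) \<subseteq> nbrs H A x"
  proof
    fix q assume "q \<in> insert b (insert z (Q - {x, z, a}))"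
    then consider "q = b" | "q = z" | "q \<in> Q" "q \<noteq> x" "q \<noteq> z" "q \<noteq> a" by blast
    then show "q \<in> nbrs H A x"
    proof cases
      case 3
      then have "A x q \<or> twin_edges v1 v2 x q" using Q(3) xQ by auto
      then have "A x q" using N1 3 bQ n zx by (auto simp: twin_edges_def)
      then show ?thesis using 3 Q by (auto simp: nbrs_def)
    qed (use \<open>A x b\<close> b xz zH in \<open>auto simp: nbrs_def\<close>)
  qed
  have fQ: "finite Q" using finite_subset[OF Q(1) fH] .
  have "card {x, z, a} = 3" using zx ax by auto
  moreover have "card (Q - {x, z, a}) = card Q - card {x, z, a}"
    using xQ zQ a by (intro card_Diff_subset) auto
  ultimately have "card (Q - {x, z, a}) = D - 3" using Q(2) by simp
  moreover have "card (insert b (insert z (Q - {x, z, a}))) = card (Q - {x, z, a}) + 2"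
    using fQ bQ bx by simp
  moreover have "card (insert b (insert z (Q - {x, z, a}))) \<le> card (nbrs H A x)"
    using sub fH by (intro card_mono) auto
  moreover have "card (nbrs H A x) + card K \<le> D" using card_nbrs_H[of x] xH by auto
  ultimately show False using k D6 by linarith
qed

text \<open>With at most one extra edge, the colours blocked at both \<open>v1\<close> and
  \<open>v2\<close> are colours of the common neighbour \<open>b\<close>. Ignoring its neighbour
  \<open>z\<close>, the vertex \<open>x\<close> can choose from 3 - e colours: it takes 2/5 off the
  blocked set of \<open>v1\<close>, 2/5 off that of \<open>v2\<close> and 1/5 anywhere. Then
  \<open>z\<close> avoids the colours blocked at both, up to \<open>e\<close>.\<close>

lemma twins_two_shared:
  assumes k: "card K = 2" and xz: "A x z" and v: "v1 \<in> C - K" "v2 \<in> C - K" "v1 \<noteq> v2"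
    and ne: "nbrs H A v1 \<noteq> nbrs H A v2" and int: "nbrs H A v1 \<inter> nbrs H A v2 \<noteq> {}"
  shows "colourable V A palette"
proof -
  have c2: "card (nbrs H A v1) \<le> 2" "card (nbrs H A v2) \<le> 2" using outside_degree v by auto
  have fN: "finite (nbrs H A u)" for u using fH by simp
  obtain b where b: "b \<in> nbrs H A v1" "b \<in> nbrs H A v2" using int by blast
  have "\<exists>\<phi>. set_colouring H A palette \<phi> \<and> blocked \<phi> v1 \<inter> blocked \<phi> v2 \<subseteq> \<phi> b"
  proof (cases "nbrs H A v1 = {b} \<or> nbrs H A v2 = {b}")
    case True
    obtain \<phi> where "set_colouring H A palette \<phi>" using colour_rest by blast
    moreover have "blocked \<phi> v1 \<inter> blocked \<phi> v2 \<subseteq> \<phi> b" using True by (auto simp: blocked_def)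
    ultimately show ?thesis by blast
  next
    case False
    obtain a where a: "a \<in> nbrs H A v1" "a \<noteq> b" using False b by blast
    obtain d where d: "d \<in> nbrs H A v2" "d \<noteq> b" using False b by blast
    have "card {a, b} = 2" "card {d, b} = 2" using a d by auto
    then have N: "nbrs H A v1 = {a, b}" "nbrs H A v2 = {d, b}"
      using card_seteq[OF fN, of "{a, b}" v1] card_seteq[OF fN, of "{d, b}" v2] a b d c2 by auto
    have ad: "a \<noteq> d" using ne N by auto
    define F where "F u w \<longleftrightarrow> (u = a \<and> w = d) \<or> (u = d \<and> w = a)" for u w
    have "\<exists>\<phi>. set_colouring H A palette \<phi> \<and> (\<forall>u\<in>H. \<forall>w\<in>H. F u w \<longrightarrow> \<phi> u \<inter> \<phi> w = {})"
    proof (rule colour_with_edges)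
      show "card {w\<in>H. F u w} \<le> card (nbrs C A u)" if "u \<in> H" for u
      proof (cases "u = a \<or> u = d")
        case True
        have "v1 \<in> nbrs C A a" "v2 \<in> nbrs C A d" using a d v adj_sym by (auto simp: nbrs_def)
        then have "nbrs C A u \<noteq> {}" using True by auto
        then have "1 \<le> card (nbrs C A u)" using fC by (simp add: Suc_le_eq card_gt_0_iff)
        moreover have "{w\<in>H. F u w} \<subseteq> {if u = a then d else a}" using ad by (auto simp: F_def)
        then have "card {w\<in>H. F u w} \<le> card {if u = a then d else a}" by (intro card_mono) auto
        ultimately show ?thesis by simp
      next
        case False
        then have "{w\<in>H. F u w} = {}" by (auto simp: F_def)
        then show ?thesis by (simp only: card.empty)
      qed
      fix Q assume Q: "Q \<subseteq> H" "card Q = D" "\<forall>u\<in>Q. \<forall>w\<in>Q. u \<noteq> w \<longrightarrow> A u w \<or> F u w"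
      have QV: "Q \<subseteq> V" using Q by auto
      show False
      proof (cases "a \<in> Q")
        case True
        have "D \<le> card K + 1 + card {d}"
          by (rule clique_plus_star[OF QV Q(2) True]) (use Q(3) True in \<open>auto simp: F_def\<close>)
        then show False using k D6 by simp
      next
        case False
        then have "is_clique A Q" using Q(3) unfolding is_clique_def F_def by blast
        then show False using clq[OF QV] Q(2) by simp
      qed
    qed (use ad in \<open>auto simp: F_def\<close>)
    then obtain \<phi> where \<phi>: "set_colouring H A palette \<phi>" "\<forall>u\<in>H. \<forall>w\<in>H. F u w \<longrightarrow> \<phi> u \<inter> \<phi> w = {}" by blast
    have "\<phi> a \<inter> \<phi> d = {}" using \<phi>(2) a d unfolding F_def nbrs_def by blast
    then have "blocked \<phi> v1 \<inter> blocked \<phi> v2 \<subseteq> \<phi> b" unfolding blocked_def N by blast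
    then show ?thesis using \<phi>(1) by blast
  qed
  then obtain \<phi> where \<phi>: "set_colouring H A palette \<phi>" and sb: "blocked \<phi> v1 \<inter> blocked \<phi> v2 \<subseteq> \<phi> b" by blast
  define B1 where "B1 = blocked \<phi> v1"
  define B2 where "B2 = blocked \<phi> v2"
  have B: "colour_set palette B1" "colour_set palette B2" "vol B1 \<le> 2" "vol B2 \<le> 2" unfolding B1_def B2_def
    using colour_set_bl[OF \<phi>] vol_bl[OF \<phi>] v by auto
  have bi: "colour_set palette (B1 \<inter> B2)" using colour_set_Int B by auto
  have "b \<in> H" using b by (auto simp: nbrs_def)
  then have "vol (B1 \<inter> B2) \<le> vol (\<phi> b)" using \<phi> sb bi unfolding B1_def B2_def set_colouring_def by (intro vol_mono) auto
  then have mi: "vol (B1 \<inter> B2) \<le> 1" using \<phi> \<open>b \<in> H\<close> by (auto simp: set_colouring_def)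
  define L where "L = free_colours \<phi> (nbrs (H - {z}) A x)"
  have fL: "finite (nbrs (H - {z}) A x)" "nbrs (H - {z}) A x \<subseteq> H" using fH by simp (auto simp: nbrs_def)
  have L: "colour_set palette L" "palette - card (nbrs (H - {z}) A x) \<le> vol L" unfolding L_def by (rule free_colours[OF \<phi> fL])+
  have "nbrs (H - {z}) A x = nbrs H A x - {z}" by (auto simp: nbrs_def)
  moreover have "z \<in> nbrs H A x" using xz zH by (auto simp: nbrs_def)
  ultimately have "card (nbrs (H - {z}) A x) + 1 = card (nbrs H A x)"
    using card.remove[OF fN, of z x] by simp
  moreover have "card (nbrs H A x) + card K \<le> D" using card_nbrs_H[of x] xH by auto
  ultimately have L3: "3 - e \<le> vol L" using L(2) k by linarith
  have "2/5 \<le> vol (L - B1)" using vol_Diff_ge[OF L(1) B(1)] B(3) L3 e5 by linarith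
  then obtain X1 where X1: "colour_set palette X1" "X1 \<subseteq> L - B1" "vol X1 = 2/5"
    using vol_subset_exists[OF colour_set_Diff[OF L(1) B(1)], of "2/5"] by auto
  have b2: "colour_set palette (B2 \<union> X1)" "vol (B2 \<union> X1) \<le> 12/5"
    using colour_set_Un[OF B(2) X1(1)] vol_Un_le[OF B(2) X1(1)] B(4) X1(3) by auto
  \<comment> \<open>The size 2/5 is tight: 3 - e - 12/5 is at least 2/5 exactly for e <=
    1/5.\<close>
  have "2/5 \<le> vol (L - (B2 \<union> X1))" using vol_Diff_ge[OF L(1) b2(1)] b2(2) L3 e5 by linarith
  then obtain X2 where X2: "colour_set palette X2" "X2 \<subseteq> L - (B2 \<union> X1)" "vol X2 = 2/5"
    using vol_subset_exists[OF colour_set_Diff[OF L(1) b2(1)], of "2/5"] by auto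
  have b3: "colour_set palette (X1 \<union> X2)" "vol (X1 \<union> X2) = 4/5"
    using colour_set_Un[OF X1(1) X2(1)] vol_disj[OF X1(1) X2(1)] X1(3) X2(2,3) by auto
  have "1/5 \<le> vol (L - (X1 \<union> X2))" using vol_Diff_ge[OF L(1) b3(1)] b3(2) L3 e5 by linarith
  then obtain X3 where X3: "colour_set palette X3" "X3 \<subseteq> L - (X1 \<union> X2)" "vol X3 = 1/5"
    using vol_subset_exists[OF colour_set_Diff[OF L(1) b3(1)], of "1/5"] by auto
  define X where "X = (X1 \<union> X2) \<union> X3"
  have bX: "colour_set palette X" unfolding X_def by (rule colour_set_Un[OF b3(1) X3(1)])
  have mX: "vol X = 1" unfolding X_def using vol_disj[OF b3(1) X3(1)] b3(2) X3(2,3) by auto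
  have XL: "X \<subseteq> L" using X1 X2 X3 by (auto simp: X_def)
  obtain Z where Z: "set_colouring H A palette (\<phi>(x := X, z := Z))" "colour_set palette Z" "vol Z = 1"
    "vol (Z \<inter> (B1 \<inter> B2)) \<le> max 0 (1 - (real (card K) - e - vol (B1 \<inter> B2)))"
    using recolour_two[OF \<phi> bX _ mX bi] XL unfolding L_def by blast
  have Ze: "vol (Z \<inter> (B1 \<inter> B2)) \<le> e" using Z(4) mi k e0 by simp
  define \<phi>2 where "\<phi>2 = \<phi>(x := X, z := Z)"
  have vals: "\<phi>2 x = X" "\<phi>2 z = Z" "blocked \<phi>2 v1 = B1" "blocked \<phi>2 v2 = B2"
    using zx blocked_CK[OF v(1)] blocked_CK[OF v(2)] by (auto simp: \<phi>2_def B1_def B2_def)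
  have bZ: "colour_set palette (Z \<inter> (B1 \<inter> B2))" using colour_set_Int[OF Z(2) bi] .
  show ?thesis
  proof (rule extend_colouring)
    show "set_colouring H A palette \<phi>2" using Z(1) by (simp add: \<phi>2_def)
    let ?X = "X3 \<union> (Z \<inter> (B1 \<inter> B2))"
    show "colour_set palette ?X" by (rule colour_set_Un[OF X3(1) bZ])
    show "vol ?X \<le> 1 - e" using vol_Un_le[OF X3(1) bZ] Ze X3(3) e5 by linarith
    obtain u0 where u0: "u0 \<in> K" using K_other by blast
    show "t \<in> ?X" if t: "\<forall>u\<in>C. t \<in> blocked \<phi>2 u" for t
    proof -
      have "t \<in> blocked \<phi>2 u0" "t \<in> B1" "t \<in> B2" using t u0 KC v vals by blast+
      moreover have "blocked \<phi>2 u0 = X \<union> Z" using blocked_K[OF u0, of \<phi>2] vals by simp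
      ultimately show ?thesis using X1(2) X2(2) unfolding X_def by blast
    qed
    fix w
    obtain u where u: "u \<in> K" "u \<noteq> w" using K_other by blast
    have blu: "blocked \<phi>2 u = X \<union> Z" using blocked_K[OF u(1), of \<phi>2] vals by simp
    show "\<exists>Y. colour_set palette Y \<and> vol Y \<le> 2 - e \<and> (\<forall>t. (\<forall>u\<in>C - {w}. t \<in> blocked \<phi>2 u) \<longrightarrow> t \<in> Y)"
    proof (cases "w = v1")
      case False
      have 1: "colour_set palette (X2 \<union> X3)" "vol (X2 \<union> X3) \<le> 3/5"
        using colour_set_Un[OF X2(1) X3(1)] vol_Un_le[OF X2(1) X3(1)] X2(3) X3(3) by auto
      have "vol ((X2 \<union> X3) \<union> Z) \<le> 2 - e" using vol_Un_le[OF 1(1) Z(2)] 1(2) Z(3) e5 by linarith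
      moreover have "t \<in> (X2 \<union> X3) \<union> Z" if "\<forall>u\<in>C - {w}. t \<in> blocked \<phi>2 u" for t
      proof -
        have "t \<in> blocked \<phi>2 u" "t \<in> blocked \<phi>2 v1" using that u KC v(1) False by blast+
        then have "t \<in> X \<union> Z" "t \<in> B1" using blu vals by auto
        then show ?thesis using X1(2) unfolding X_def by blast
      qed
      ultimately show ?thesis using colour_set_Un[OF 1(1) Z(2)] by blast
    next
      case True
      have 1: "colour_set palette (X1 \<union> X3)" "vol (X1 \<union> X3) \<le> 3/5"
        using colour_set_Un[OF X1(1) X3(1)] vol_Un_le[OF X1(1) X3(1)] X1(3) X3(3) by auto
      have "vol ((X1 \<union> X3) \<union> Z) \<le> 2 - e" using vol_Un_le[OF 1(1) Z(2)] 1(2) Z(3) e5 by linarith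
      moreover have "t \<in> (X1 \<union> X3) \<union> Z" if "\<forall>u\<in>C - {w}. t \<in> blocked \<phi>2 u" for t
      proof -
        have "t \<in> blocked \<phi>2 u" "t \<in> blocked \<phi>2 v2" using that u KC v True by blast+
        then have "t \<in> X \<union> Z" "t \<in> B2" using blu vals by auto
        then show ?thesis using X2(2) unfolding X_def by blast
      qed
      ultimately show ?thesis using colour_set_Un[OF 1(1) Z(2)] by blast
    qed
  qed
qed

text \<open>If \<open>x\<close> and \<open>z\<close> are not adjacent, or some two vertices of
  \<open>C - K\<close> have disjoint outside neighbourhoods, the obstructions for both orders cannot
  coexist. Otherwise these neighbourhoods meet pairwise; were they all equal, a common neighbour
  would see the at least three vertices of \<open>C - K\<close>, against
  \<open>kmax\<close>.\<close>

lemma twins_two: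
  assumes k: "card K = 2"
  shows "colourable V A palette"
proof -
  have c3: "3 \<le> card (C - K)" using card_CK k D6 by simp
  show ?thesis
  proof (cases "A x z \<and> \<not> (\<exists>v1\<in>C - K. \<exists>v2\<in>C - K. v1 \<noteq> v2 \<and> nbrs H A v1 \<inter> nbrs H A v2 = {})")
    case True
    then have xz: "A x z" and int: "\<And>v1 v2. v1 \<in> C - K \<Longrightarrow> v2 \<in> C - K \<Longrightarrow> v1 \<noteq> v2 \<Longrightarrow> nbrs H A v1 \<inter> nbrs H A v2 \<noteq> {}"
      by auto
    have "\<exists>v1\<in>C - K. \<exists>v2\<in>C - K. v1 \<noteq> v2 \<and> nbrs H A v1 \<noteq> nbrs H A v2"
    proof (rule ccontr)
      assume "\<not> ?thesis"
      then have eq: "\<And>v1 v2. v1 \<in> C - K \<Longrightarrow> v2 \<in> C - K \<Longrightarrow> nbrs H A v1 = nbrs H A v2" by metis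
      obtain T where "T \<subseteq> C - K" "card T = 2" using obtain_subset_with_card_n[of 2 "C - K"] c3 by auto
      then obtain v1 v2 where v: "v1 \<in> C - K" "v2 \<in> C - K" "v1 \<noteq> v2" by (auto simp: card_2_iff)
      obtain y where y: "y \<in> nbrs H A v1" using int[OF v] by blast
      have yn: "y \<in> nbrs H A v" if "v \<in> C - K" for v using eq[OF that v(1)] y by simp
      have "C - K \<subseteq> nbrs C A y"
      proof
        fix v assume "v \<in> C - K"
        then show "v \<in> nbrs C A y" using yn[of v] adj_sym by (auto simp: nbrs_def)
      qed
      then have "card (C - K) \<le> card (nbrs C A y)" using fC by (intro card_mono) auto
      moreover have "card (nbrs C A y) \<le> card K" using y by (intro kmax[OF C]) (auto simp: nbrs_def)
      ultimately show False using c3 k by simp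
    qed
    then obtain v1 v2 where "v1 \<in> C - K" "v2 \<in> C - K" "v1 \<noteq> v2" "nbrs H A v1 \<noteq> nbrs H A v2" by blast
    then show ?thesis using twins_two_shared[OF k xz] int by blast
  next
    case False
    obtain v1 v2 where v: "v1 \<in> C - K" "v2 \<in> C - K" "v1 \<noteq> v2" "A x z \<longrightarrow> nbrs H A v1 \<inter> nbrs H A v2 = {}"
    proof (cases "A x z")
      case True
      then show ?thesis using False that by blast
    next
      case xz: False
      obtain T where "T \<subseteq> C - K" "card T = 2" using obtain_subset_with_card_n[of 2 "C - K"] c3 by auto
      then obtain v1 v2 where "v1 \<in> C - K" "v2 \<in> C - K" "v1 \<noteq> v2" by (auto simp: card_2_iff)
      then show ?thesis using that xz by blast
    qed
    show ?thesis
    proof (rule ccontr)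
      assume nc: "\<not> colourable V A palette"
      obtain Q where Q: "Q \<subseteq> H" "card Q = D" "\<forall>a\<in>Q. \<forall>b\<in>Q. a \<noteq> b \<longrightarrow> A a b \<or> twin_edges v1 v2 a b"
        using twin_edges_obstruction[OF k v(1,2,3) nc] by blast
      obtain Q' where Q': "Q' \<subseteq> H" "card Q' = D" "\<forall>a\<in>Q'. \<forall>b\<in>Q'. a \<noteq> b \<longrightarrow> A a b \<or> twin_edges v2 v1 a b"
        using twin_edges_obstruction[OF k v(2,1) v(3)[symmetric] nc] by blast
      have "A x z" using twin_edges_obstruction_shape[OF k v(1,2) Q] by blast
      then show False using twin_edges_swap[OF k v(1,2) _ Q Q'] v(4) by blast
    qed
  qed
qed

lemma twins: "colourable V A palette"
proof -
  consider "card K = D - 2" | "3 \<le> card K" "card K \<le> D - 3" | "card K = 2" using card_K_le k2 by linarith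
  then show ?thesis using triple_diamond twins_mid twins_two by cases auto
qed

end

section \<open>No twins: a neighbourhood of maximum size in a big clique is contained in no other
  one\<close>

locale step_no_twins = step_vertex +
  assumes no_twins: "\<And>C' x' z'. big_clique C' \<Longrightarrow> x' \<in> V - C' \<Longrightarrow> z' \<in> V - C' \<Longrightarrow> x' \<noteq> z' \<Longrightarrow>
      card (nbrs C' A x') = card (nbrs C A x) \<Longrightarrow> \<not> nbrs C' A x' \<subseteq> nbrs C' A z'"
begin

text \<open>A vertex of \<open>K\<close> has at most one outside neighbour besides \<open>x\<close>,
  so this set measures at most one there; recolouring \<open>x\<close> does not affect it.\<close>

definition side_colours :: "('a \<Rightarrow> real set) \<Rightarrow> 'a \<Rightarrow> real set" where
  "side_colours \<phi> u = (\<Union>a\<in>nbrs H A u - {x}. \<phi> a)"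

lemma x_in_nbrs_K: "u \<in> K \<Longrightarrow> x \<in> nbrs H A u"
  using xH adj_sym by (auto simp: nbrs_def)

lemma x_notin_nbrs_CK: "v \<in> C - K \<Longrightarrow> x \<notin> nbrs H A v"
  using adj_sym by (auto simp: nbrs_def)

lemma blocked_side: "u \<in> K \<Longrightarrow> blocked \<phi> u = \<phi> x \<union> side_colours \<phi> u"
  using x_in_nbrs_K[of u] unfolding blocked_def side_colours_def by blast

lemma side_colours_set: "set_colouring H A palette \<phi> \<Longrightarrow> colour_set palette (side_colours \<phi> u)"
  unfolding side_colours_def using fH by (intro colour_set_UN) (auto simp: set_colouring_def dest: subsetD[OF nbrs_subset])

lemma side_colours_le: assumes "set_colouring H A palette \<phi>" "u \<in> K" shows "vol (side_colours \<phi> u) \<le> 1"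
proof -
  have "card (nbrs H A u - {x}) \<le> 1" using outside_degree[of u] assms(2) KC x_in_nbrs_K[of u] by auto
  moreover have "nbrs H A u - {x} \<subseteq> H" using nbrs_subset[of H A u] by blast
  ultimately show ?thesis using vol_nb(2)[OF assms(1), of "nbrs H A u - {x}"] fH unfolding side_colours_def by simp
qed

lemma side_colours_upd: "side_colours (\<phi>(x := X)) u = side_colours \<phi> u"
  unfolding side_colours_def by (intro SUP_cong) auto

lemma nbrs_K_cases:
  assumes "u \<in> K"
  obtains "nbrs H A u = {x}" | z where "z \<in> H" "z \<noteq> x" "nbrs H A u = {x, z}"
proof (cases "nbrs H A u = {x}")
  case False
  then obtain z where z: "z \<in> nbrs H A u" "z \<noteq> x" using x_in_nbrs_K[OF assms] by blast
  have "card (nbrs H A u) \<le> card {x, z}" using outside_degree[of u] assms KC z by auto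
  then have "{x, z} = nbrs H A u" using card_seteq[of "nbrs H A u" "{x, z}"] fH z x_in_nbrs_K[OF assms] by simp
  then show ?thesis using that(2)[of z] z by (auto simp: nbrs_def)
qed (use that in auto)

lemma side_colours_single: "nbrs H A u = {x, z} \<Longrightarrow> z \<noteq> x \<Longrightarrow> side_colours \<phi> u = \<phi> z"
  unfolding side_colours_def by auto

text \<open>If \<open>u1\<close> has a second outside neighbour \<open>z\<close>, then
  \<open>z\<close> misses some vertex of \<open>K\<close>, for it would be a twin of
  \<open>x\<close> otherwise. If it has none, any other vertex of \<open>K\<close> will do.\<close>

lemma pair_exists: "\<exists>u1\<in>K. \<exists>u2\<in>K. u1 \<noteq> u2 \<and> nbrs H A u1 \<inter> nbrs H A u2 = {x}"
proof -
  obtain u1 where u1: "u1 \<in> K" using K_other by blast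
  show ?thesis
  proof (rule nbrs_K_cases[OF u1])
    assume n: "nbrs H A u1 = {x}"
    obtain u2 where u2: "u2 \<in> K" "u2 \<noteq> u1" using K_other by blast
    have "nbrs H A u1 \<inter> nbrs H A u2 = {x}" using n x_in_nbrs_K[OF u2(1)] by auto
    then show ?thesis using u1 u2 by blast
  next
    fix z assume z: "z \<in> H" "z \<noteq> x" "nbrs H A u1 = {x, z}"
    have "\<not> K \<subseteq> nbrs C A z" using no_twins[OF C, of x z] xH z by auto
    then obtain u2 where u2: "u2 \<in> K" "\<not> A z u2" using KC by (auto simp: nbrs_def)
    have "z \<notin> nbrs H A u2" using u2 adj_sym by (auto simp: nbrs_def)
    then have "nbrs H A u1 \<inter> nbrs H A u2 = {x}" using z x_in_nbrs_K[OF u2(1)] by auto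
    moreover have "u2 \<noteq> u1" using z \<open>z \<notin> nbrs H A u2\<close> by auto
    ultimately show ?thesis using u1 u2 by blast
  qed
qed

text \<open>Both \<open>u1\<close> and \<open>u2\<close> block only \<open>\<phi> x\<close> and the
  common side colours, and \<open>v\<close> cuts this down further. The bounds \<open>h1\<close>,
  \<open>h2\<close>, \<open>h3\<close> serve the cases where no vertex is left out, a vertex other
  than \<open>u1\<close> and \<open>u2\<close>, or one of these two.\<close>

lemma pair_extend:
  assumes \<phi>: "set_colouring H A palette \<phi>" and u: "u1 \<in> K" "u2 \<in> K" "u1 \<noteq> u2" and v: "v \<in> C - K"
    and h1: "vol ((\<phi> x \<union> (side_colours \<phi> u1 \<inter> side_colours \<phi> u2)) \<inter> blocked \<phi> v) \<le> 1 - e"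
    and h2: "vol (side_colours \<phi> u1 \<inter> side_colours \<phi> u2) \<le> 1 - e" and h3: "vol (\<phi> x \<inter> blocked \<phi> v) \<le> 1 - e"
  shows "colourable V A palette"
proof (rule extend_colouring[OF \<phi>])
  have bx: "colour_set palette (\<phi> x)" "vol (\<phi> x) = 1" using \<phi> xH by (auto simp: set_colouring_def)
  note bv = colour_set_bl[OF \<phi>, of v] and b1 = side_colours_set[OF \<phi>, of u1] and b2 = side_colours_set[OF \<phi>, of u2]
  note l1 = side_colours_le[OF \<phi> u(1)] and l2 = side_colours_le[OF \<phi> u(2)]
  note bb = blocked_side[OF u(1), of \<phi>] blocked_side[OF u(2), of \<phi>]
  have uC: "u1 \<in> C" "u2 \<in> C" "v \<in> C" "v \<noteq> u1" "v \<noteq> u2" using u v KC by auto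
  show "colour_set palette ((\<phi> x \<union> (side_colours \<phi> u1 \<inter> side_colours \<phi> u2)) \<inter> blocked \<phi> v)" by (intro colour_set_Int colour_set_Un bx bv b1 b2)
  show "vol ((\<phi> x \<union> (side_colours \<phi> u1 \<inter> side_colours \<phi> u2)) \<inter> blocked \<phi> v) \<le> 1 - e" by (rule h1)
  show "t \<in> (\<phi> x \<union> (side_colours \<phi> u1 \<inter> side_colours \<phi> u2)) \<inter> blocked \<phi> v" if "\<forall>u\<in>C. t \<in> blocked \<phi> u" for t
    using that uC bb by blast
  fix w
  show "\<exists>Y. colour_set palette Y \<and> vol Y \<le> 2 - e \<and> (\<forall>t. (\<forall>u\<in>C - {w}. t \<in> blocked \<phi> u) \<longrightarrow> t \<in> Y)"
  proof (cases "w = u1 \<or> w = u2")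
    case False
    have bi: "colour_set palette (side_colours \<phi> u1 \<inter> side_colours \<phi> u2)" by (intro colour_set_Int b1 b2)
    show ?thesis
    proof (intro exI conjI allI impI)
      show "colour_set palette (\<phi> x \<union> (side_colours \<phi> u1 \<inter> side_colours \<phi> u2))" by (rule colour_set_Un[OF bx(1) bi])
      show "vol (\<phi> x \<union> (side_colours \<phi> u1 \<inter> side_colours \<phi> u2)) \<le> 2 - e" using vol_Un_le[OF bx(1) bi] bx(2) h2 by linarith
      show "t \<in> \<phi> x \<union> (side_colours \<phi> u1 \<inter> side_colours \<phi> u2)" if "\<forall>u\<in>C - {w}. t \<in> blocked \<phi> u" for t
        using that uC bb False by blast
    qed
  next
    case True
    define u' where "u' = (if w = u1 then u2 else u1)"
    have u': "u' \<in> C - {w}" "blocked \<phi> u' = \<phi> x \<union> side_colours \<phi> u'" "colour_set palette (side_colours \<phi> u')" "vol (side_colours \<phi> u') \<le> 1"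
      using True u uC bb b1 b2 l1 l2 by (auto simp: u'_def)
    have vw: "v \<in> C - {w}" using True uC by auto
    have bi: "colour_set palette (\<phi> x \<inter> blocked \<phi> v)" by (intro colour_set_Int bx bv)
    show ?thesis
    proof (intro exI conjI allI impI)
      show "colour_set palette ((\<phi> x \<inter> blocked \<phi> v) \<union> side_colours \<phi> u')" by (rule colour_set_Un[OF bi u'(3)])
      show "vol ((\<phi> x \<inter> blocked \<phi> v) \<union> side_colours \<phi> u') \<le> 2 - e" using vol_Un_le[OF bi u'(3)] h3 u'(4) by linarith
      show "t \<in> (\<phi> x \<inter> blocked \<phi> v) \<union> side_colours \<phi> u'" if "\<forall>u\<in>C - {w}. t \<in> blocked \<phi> u" for t
        using that u'(1,2) vw by blast
    qed
  qed
qed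

definition pair_ok :: "'a \<Rightarrow> 'a \<Rightarrow> bool" where
  "pair_ok u1 u2 \<longleftrightarrow> (\<exists>\<phi>. set_colouring H A palette \<phi> \<and> vol (side_colours \<phi> u1 \<inter> side_colours \<phi> u2) \<le> e)"

text \<open>There are 3 - e colours for \<open>x\<close> and \<open>v\<close> blocks at most 2, so
  \<open>x\<close> can be recoloured with an overlap of at most \<open>e\<close>. The common side
  colours add another \<open>e\<close>, and 2e <= 1 - e.\<close>

lemma pair_ok_large:
  assumes k: "3 \<le> card K" and u: "u1 \<in> K" "u2 \<in> K" "u1 \<noteq> u2" and ok: "pair_ok u1 u2"
  shows "colourable V A palette"
proof -
  obtain \<phi> where \<phi>: "set_colouring H A palette \<phi>" and le: "vol (side_colours \<phi> u1 \<inter> side_colours \<phi> u2) \<le> e" using ok by (auto simp: pair_ok_def)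
  have "card (C - K) \<noteq> 0" using card_CK card_K_le D6 by linarith
  then obtain v where v: "v \<in> C - K" by (metis card.empty ex_in_conv)
  have bv: "colour_set palette (blocked \<phi> v)" "vol (blocked \<phi> v) \<le> 2" using colour_set_bl[OF \<phi>] vol_bl[OF \<phi>] v by auto
  define L where "L = free_colours \<phi> (nbrs H A x)"
  have L: "colour_set palette L" "3 - e \<le> vol L" using free_colours_nbrs[OF \<phi> xH] k by (auto simp: L_def)
  then have "1 \<le> vol L" using e5 by linarith
  then obtain X where X: "colour_set palette X" "X \<subseteq> L" "vol X = 1" "vol (X \<inter> blocked \<phi> v) \<le> max 0 (1 - vol (L - blocked \<phi> v))"
    using vol_subset_avoiding[OF L(1) bv(1), of 1] by auto
  have Xe: "vol (X \<inter> blocked \<phi> v) \<le> e" using X(4) vol_Diff_ge[OF L(1) bv(1)] bv(2) L(2) e0 by linarith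
  have \<phi>2: "set_colouring H A palette (\<phi>(x := X))" using X by (intro recolour[OF \<phi> xH]) (auto simp: L_def)
  have blv: "blocked (\<phi>(x := X)) v = blocked \<phi> v" by (rule blocked_upd[OF x_notin_nbrs_CK[OF v]])
  have bP: "colour_set palette (side_colours \<phi> u1 \<inter> side_colours \<phi> u2)" using side_colours_set[OF \<phi>] by (intro colour_set_Int)
  show ?thesis
  proof (rule pair_extend[OF \<phi>2 u v], unfold blv side_colours_upd fun_upd_same)
    have "vol ((X \<union> (side_colours \<phi> u1 \<inter> side_colours \<phi> u2)) \<inter> blocked \<phi> v) \<le> vol (X \<inter> blocked \<phi> v) + vol (side_colours \<phi> u1 \<inter> side_colours \<phi> u2)"
      by (rule vol_le_add[of palette]) (use X bv bP colour_set_Int colour_set_Un in auto)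
    then show "vol ((X \<union> (side_colours \<phi> u1 \<inter> side_colours \<phi> u2)) \<inter> blocked \<phi> v) \<le> 1 - e" using Xe le e5 by linarith
    show "vol (side_colours \<phi> u1 \<inter> side_colours \<phi> u2) \<le> 1 - e" "vol (X \<inter> blocked \<phi> v) \<le> 1 - e" using le Xe e5 by auto
  qed
qed

lemma recolour_avoiding:
  assumes \<phi>: "set_colouring H A palette \<phi>" and z: "z \<in> H" "2 \<le> card (nbrs C A z)" and B: "colour_set palette B" "vol B \<le> 1"
  shows "\<exists>X. set_colouring H A palette (\<phi>(z := X)) \<and> vol (X \<inter> B) \<le> e"
proof -
  define L where "L = free_colours \<phi> (nbrs H A z)"
  have L: "colour_set palette L" "2 - e \<le> vol L" using free_colours_nbrs[OF \<phi> z(1)] z(2) by (auto simp: L_def)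
  then have "1 \<le> vol L" using e5 by linarith
  then obtain X where X: "colour_set palette X" "X \<subseteq> L" "vol X = 1" "vol (X \<inter> B) \<le> max 0 (1 - vol (L - B))"
    using vol_subset_avoiding[OF L(1) B(1), of 1] by auto
  have "vol (X \<inter> B) \<le> e" using X(4) vol_Diff_ge[OF L(1) B(1)] B(2) L(2) e0 by linarith
  moreover have "set_colouring H A palette (\<phi>(z := X))" using X by (intro recolour[OF \<phi> z(1)]) (auto simp: L_def)
  ultimately show ?thesis by blast
qed

lemma pair_ok_none: "nbrs H A u1 = {x} \<Longrightarrow> pair_ok u1 u2"
  using colour_rest e0 unfolding pair_ok_def side_colours_def by auto

lemma pair_ok_recolour:
  assumes u: "u2 \<in> K" and z: "z \<in> H" "z \<noteq> x" "nbrs H A u1 = {x, z}" "z \<notin> nbrs H A u2" "2 \<le> card (nbrs C A z)"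
  shows "pair_ok u1 u2"
proof -
  obtain \<phi> where \<phi>: "set_colouring H A palette \<phi>" using colour_rest by blast
  obtain X where X: "set_colouring H A palette (\<phi>(z := X))" "vol (X \<inter> side_colours \<phi> u2) \<le> e"
    using recolour_avoiding[OF \<phi> z(1,5) side_colours_set[OF \<phi>] side_colours_le[OF \<phi> u]] by blast
  have "side_colours (\<phi>(z := X)) u2 = side_colours \<phi> u2" unfolding side_colours_def using z(4) by (intro SUP_cong) auto
  moreover have "side_colours (\<phi>(z := X)) u1 = X" using side_colours_single[OF z(3,2)] by simp
  ultimately show ?thesis using X unfolding pair_ok_def by (intro exI[of _ "\<phi>(z := X)"]) simp
qed

text \<open>The added edge is harmful only if it completes a \<open>D\<close>-clique. With a single
  missing edge \<open>clique_plus_star\<close> forces \<open>card K = D - 2\<close>, and the other D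
  - 2 vertices of that clique see both ends.\<close>

lemma colour_add_edge:
  assumes z: "z1 \<in> H" "z2 \<in> H" "z1 \<noteq> z2" "nbrs C A z1 \<noteq> {}" "nbrs C A z2 \<noteq> {}"
  shows "(\<exists>\<phi>. set_colouring H A palette \<phi> \<and> \<phi> z1 \<inter> \<phi> z2 = {}) \<or>
    (card K = D - 2 \<and> \<not> A z1 z2 \<and> (\<exists>K1\<subseteq>H. card K1 = D - 2 \<and> is_clique A K1 \<and> K1 \<subseteq> nbrs H A z1 \<and> K1 \<subseteq> nbrs H A z2))"
proof (rule disjCI)
  assume neg: "\<not> (card K = D - 2 \<and> \<not> A z1 z2 \<and> (\<exists>K1\<subseteq>H. card K1 = D - 2 \<and> is_clique A K1 \<and> K1 \<subseteq> nbrs H A z1 \<and> K1 \<subseteq> nbrs H A z2))"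
  define F where "F u w \<longleftrightarrow> (u = z1 \<and> w = z2) \<or> (u = z2 \<and> w = z1)" for u w
  have "\<exists>\<phi>. set_colouring H A palette \<phi> \<and> (\<forall>u\<in>H. \<forall>w\<in>H. F u w \<longrightarrow> \<phi> u \<inter> \<phi> w = {})"
  proof (rule colour_with_edges)
    show "card {w\<in>H. F u w} \<le> card (nbrs C A u)" if "u \<in> H" for u
    proof (cases "u = z1 \<or> u = z2")
      case True
      then have "1 \<le> card (nbrs C A u)" using z fC by (auto simp: Suc_le_eq card_gt_0_iff)
      moreover have "{w\<in>H. F u w} \<subseteq> {if u = z1 then z2 else z1}" using z by (auto simp: F_def)
      then have "card {w\<in>H. F u w} \<le> card {if u = z1 then z2 else z1}" by (intro card_mono) auto
      ultimately show ?thesis by simp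
    next
      case False
      then have "{w\<in>H. F u w} = {}" by (auto simp: F_def)
      then show ?thesis by (simp only: card.empty)
    qed
    fix Q assume Q: "Q \<subseteq> H" "card Q = D" "\<forall>u\<in>Q. \<forall>w\<in>Q. u \<noteq> w \<longrightarrow> A u w \<or> F u w"
    have QV: "Q \<subseteq> V" using Q by auto
    have fQ: "finite Q" using finite_subset[OF QV fV] .
    show False
    proof (cases "z1 \<in> Q \<and> z2 \<in> Q \<and> \<not> A z1 z2")
      case True
      then have zQ: "z1 \<in> Q" "z2 \<in> Q" by auto
      have "D \<le> card K + 1 + card {z2}"
        by (rule clique_plus_star[OF QV Q(2) zQ(1)]) (use Q(3) zQ(1) in \<open>auto simp: F_def\<close>)
      then have "card K = D - 2" using card_K_le D6 by simp
      moreover define K1 where "K1 = Q - {z1, z2}"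
      have "card K1 = D - 2" unfolding K1_def using zQ z(3) Q(2) fQ by (simp add: card_Diff_subset)
      moreover have "A a b" if "a \<in> Q" "b \<in> K1" "a \<noteq> b" for a b
        using Q(3) that by (auto simp: F_def K1_def)
      then have "is_clique A K1" "K1 \<subseteq> nbrs H A z1" "K1 \<subseteq> nbrs H A z2"
        using zQ Q(1) unfolding is_clique_def nbrs_def K1_def by auto
      moreover have "K1 \<subseteq> H" using Q(1) by (auto simp: K1_def)
      ultimately show False using neg True by blast
    next
      case False
      then have "is_clique A Q" using Q(3) adj_sym unfolding is_clique_def F_def by blast
      then show False using clq[OF QV] Q(2) by simp
    qed
  qed (use z in \<open>auto simp: F_def\<close>)
  then show "\<exists>\<phi>. set_colouring H A palette \<phi> \<and> \<phi> z1 \<inter> \<phi> z2 = {}" using z unfolding F_def by blast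
qed

lemma nbrs_C_memI: "u \<in> K \<Longrightarrow> nbrs H A u = {x, z} \<Longrightarrow> u \<in> nbrs C A z"
  using KC adj_sym by (auto simp: nbrs_def)

text \<open>If all pairs fail, three vertices of \<open>K\<close> have distinct second neighbours
  \<open>z1\<close>, \<open>z2\<close>, \<open>z3\<close>, and any two of these are joined to a
  common clique with D - 2 vertices. Degree bounds at \<open>z1\<close> and at a common vertex
  \<open>s\<close> show that \<open>z1\<close> and \<open>z2\<close> share the same clique as
  \<open>z1\<close> and \<open>z3\<close>. With \<open>z2\<close> it forms a big clique at which
  \<open>z1\<close> and \<open>z3\<close> are twins.\<close>

lemma no_twins_large:
  assumes k: "3 \<le> card K"
  shows "colourable V A palette"
proof (rule ccontr)
  assume nc: "\<not> colourable V A palette"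
  have no: "\<not> pair_ok u u'" if "u \<in> K" "u' \<in> K" "u \<noteq> u'" for u u'
    using pair_ok_large[OF k that] nc by blast
  have nox: "nbrs H A u \<noteq> {x}" if "u \<in> K" for u
    using pair_ok_none[of u] no[OF that] K_other[of u] by blast
  obtain u1 u2 where u: "u1 \<in> K" "u2 \<in> K" "u1 \<noteq> u2" and ui: "nbrs H A u1 \<inter> nbrs H A u2 = {x}"
    using pair_exists by blast
  obtain z1 where z1: "z1 \<in> H" "z1 \<noteq> x" "nbrs H A u1 = {x, z1}" using nbrs_K_cases[OF u(1)] nox[OF u(1)] by metis
  obtain z2 where z2: "z2 \<in> H" "z2 \<noteq> x" "nbrs H A u2 = {x, z2}" using nbrs_K_cases[OF u(2)] nox[OF u(2)] by metis
  have z12: "z1 \<noteq> z2" using ui z1 z2 by auto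
  have one_neighbour: "u = u'" if u: "u \<in> K" "nbrs H A u = {x, z}" "z \<in> H" "z \<noteq> x" and u': "u' \<in> nbrs C A z"
    and w: "w \<in> K" "z \<notin> nbrs H A w" "u \<noteq> w" for u u' z w
  proof (rule ccontr)
    assume "u \<noteq> u'"
    then have "card {u, u'} = 2" by simp
    moreover have "{u, u'} \<subseteq> nbrs C A z" using u' nbrs_C_memI[OF u(1,2)] by auto
    then have "card {u, u'} \<le> card (nbrs C A z)" using fC by (intro card_mono) auto
    ultimately have "pair_ok u w" using pair_ok_recolour[OF w(1) u(3,4,2) w(2)] by simp
    then show False using no[OF u(1) w(1,3)] by blast
  qed
  have nz: "z1 \<notin> nbrs H A u2" "z2 \<notin> nbrs H A u1" using z1 z2 z12 by auto
  have trouble: "card K = D - 2 \<and> \<not> A z z' \<and> (\<exists>K1\<subseteq>H. card K1 = D - 2 \<and> is_clique A K1 \<and> K1 \<subseteq> nbrs H A z \<and> K1 \<subseteq> nbrs H A z')"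
    if w: "w \<in> K" "w' \<in> K" "w \<noteq> w'" and z: "nbrs H A w = {x, z}" "nbrs H A w' = {x, z'}" "z \<in> H" "z' \<in> H" "z \<noteq> x" "z' \<noteq> x" "z \<noteq> z'"
    for w w' z z'
  proof -
    have ne: "nbrs C A z \<noteq> {}" "nbrs C A z' \<noteq> {}" using nbrs_C_memI[OF w(1) z(1)] nbrs_C_memI[OF w(2) z(2)] by auto
    have "\<not> (\<exists>\<phi>. set_colouring H A palette \<phi> \<and> \<phi> z \<inter> \<phi> z' = {})"
    proof
      assume "\<exists>\<phi>. set_colouring H A palette \<phi> \<and> \<phi> z \<inter> \<phi> z' = {}"
      then obtain \<phi> where "set_colouring H A palette \<phi>" "\<phi> z \<inter> \<phi> z' = {}" by blast
      then have "pair_ok w w'" unfolding pair_ok_def using side_colours_single[OF z(1,5), of \<phi>] side_colours_single[OF z(2,6), of \<phi>] e0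
        by (intro exI[of _ \<phi>]) simp
      then show False using no[OF w] by blast
    qed
    then show ?thesis using colour_add_edge[OF z(3,4,7) ne] by blast
  qed
  obtain K1 where kD2: "card K = D - 2" and nA: "\<not> A z1 z2" and K1: "K1 \<subseteq> H" "card K1 = D - 2" "is_clique A K1" "K1 \<subseteq> nbrs H A z1" "K1 \<subseteq> nbrs H A z2"
    using trouble[OF u z1(3) z2(3) z1(1) z2(1) z1(2) z2(2) z12] by blast
  have "\<not> K \<subseteq> {u1, u2}"
  proof
    assume "K \<subseteq> {u1, u2}"
    then have "card K \<le> card {u1, u2}" by (intro card_mono) auto
    then show False using u(3) kD2 D6 by simp
  qed
  then obtain u3 where u3: "u3 \<in> K" "u3 \<noteq> u1" "u3 \<noteq> u2" by blast
  obtain z3 where z3: "z3 \<in> H" "z3 \<noteq> x" "nbrs H A u3 = {x, z3}" using nbrs_K_cases[OF u3(1)] nox[OF u3(1)] by metis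
  have z31: "z3 \<noteq> z1"
    using one_neighbour[OF u(1) z1(3,1,2) _ u(2) nz(1) u(3), of u3] nbrs_C_memI[OF u3(1) z3(3)] u3 by auto
  have z32: "z3 \<noteq> z2"
    using one_neighbour[OF u(2) z2(3,1,2) _ u(1) nz(2) u(3)[symmetric], of u3] nbrs_C_memI[OF u3(1) z3(3)] u3 by auto
  obtain K3 where nA3: "\<not> A z1 z3" and K3: "K3 \<subseteq> H" "card K3 = D - 2" "is_clique A K3" "K3 \<subseteq> nbrs H A z1" "K3 \<subseteq> nbrs H A z3"
    using trouble[OF u(1) u3(1) u3(2)[symmetric] z1(3) z3(3) z1(1) z3(1) z1(2) z3(2) z31[symmetric]] by blast
  have fK: "finite K1" "finite K3" using finite_subset[OF K1(1) fH] finite_subset[OF K3(1) fH] .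
  have u1z1: "u1 \<in> nbrs C A z1" by (rule nbrs_C_memI[OF u(1) z1(3)])
  have "card (nbrs C A z1) \<noteq> 0" using u1z1 fC by auto
  then have "card (nbrs H A z1) \<le> D - 1" using card_nbrs_H[of z1] z1(1) by simp
  moreover have "card (K1 \<union> K3) \<le> card (nbrs H A z1)" using K1(4) K3(4) fH by (intro card_mono) auto
  ultimately have un: "card (K1 \<union> K3) \<le> D - 1" by simp
  have "card K1 + card K3 = card (K1 \<union> K3) + card (K1 \<inter> K3)" by (rule card_Un_Int[OF fK])
  then have "card (K1 \<inter> K3) \<noteq> 0" using un K1(2) K3(2) D6 by linarith
  then obtain s where s: "s \<in> K1" "s \<in> K3" by (metis card.empty disjoint_iff)
  have notin: "z1 \<notin> K1 \<union> K3" "z2 \<notin> K1 \<union> K3" "z3 \<notin> K1 \<union> K3"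
  proof -
    show "z1 \<notin> K1 \<union> K3" using K1(4) K3(4) adj_irrefl by (auto simp: nbrs_def)
    show "z2 \<notin> K1 \<union> K3" using K1(5) K3(4) adj_irrefl nA by (auto simp: nbrs_def)
    show "z3 \<notin> K1 \<union> K3" using K1(4) K3(5) adj_irrefl nA3 by (auto simp: nbrs_def)
  qed
  \<comment> \<open>Known neighbours of \<open>s\<close>: the three second neighbours and the rest
    of \<open>K1 \<union> K3\<close>. The degree bound leaves no room for \<open>K1\<close> and
    \<open>K3\<close> to differ.\<close>
  define R where "R = insert z1 (insert z2 (insert z3 (K1 \<union> K3 - {s})))"
  have "A s z1" "A s z2" "A s z3"
    using s K1(4,5) K3(5) adj_sym by (auto simp: nbrs_def)
  moreover have "A s b" if "b \<in> K1" "b \<noteq> s" for b using K1(3) s(1) that by (auto simp: is_clique_def)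
  moreover have "A s b" if "b \<in> K3" "b \<noteq> s" for b using K3(3) s(2) that by (auto simp: is_clique_def)
  ultimately have "A s b" if "b \<in> R" for b using that by (auto simp: R_def)
  moreover have "R \<subseteq> H" using z1 z2 z3 K1 K3 by (auto simp: R_def)
  ultimately have "R \<subseteq> nbrs V A s" by (auto simp: nbrs_def)
  then have "card R \<le> card (nbrs V A s)" using fV by (intro card_mono) auto
  also have "\<dots> \<le> D" using s K1 by (intro deg) auto
  finally have "card R \<le> D" .
  moreover have "card R = 3 + (card (K1 \<union> K3) - 1)"
    unfolding R_def using notin z12 z31 z32 fK s by simp
  ultimately have "card (K1 \<union> K3) \<le> D - 2" using D6 by simp
  then have "K1 = K1 \<union> K3" "K3 = K1 \<union> K3"
    using card_seteq[of "K1 \<union> K3" K1] card_seteq[of "K1 \<union> K3" K3] fK K1(2) K3(2) by auto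
  then have eq: "K1 = K3" by simp
  define C' where "C' = insert z2 K1"
  have bC': "big_clique C'"
  proof -
    have "is_clique A C'" using K1(3,5) adj_sym unfolding C'_def is_clique_def nbrs_def by blast
    moreover have "card C' = D - 1" unfolding C'_def using notin fK K1(2) D6 by simp
    ultimately show ?thesis using K1(1) z2(1) unfolding big_clique_def C'_def by auto
  qed
  have n1: "nbrs C' A z1 = K1" using K1(4) nA unfolding C'_def nbrs_def by auto
  have "nbrs C' A z1 \<subseteq> nbrs C' A z3" unfolding n1 using K3(5) eq unfolding C'_def nbrs_def by auto
  \<comment> \<open>The twins occur at \<open>C'\<close> instead of \<open>C\<close>; for this step
    \<open>no_twins\<close> is assumed for all big cliques.\<close>
  moreover have "\<not> nbrs C' A z1 \<subseteq> nbrs C' A z3"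
  proof (rule no_twins[OF bC'])
    show "z1 \<in> V - C'" using z1 notin z12 by (auto simp: C'_def)
    show "z3 \<in> V - C'" using z3 notin z32 by (auto simp: C'_def)
    show "card (nbrs C' A z1) = card K" using n1 K1(2) kD2 by simp
  qed (use z31 in simp)
  ultimately show False by blast
qed

text \<open>The two edges that \<open>x\<close> lost pay for edges to the at most two outside
  neighbours of \<open>v\<close>. The set \<open>G\<close> optionally adds the edge between
  \<open>z1\<close> and \<open>z2\<close>. As \<open>x\<close> is not adjacent to both of them, no
  new \<open>D\<close>-clique uses edges of both kinds, and \<open>clique_plus_star\<close> excludes
  each kind alone.\<close>

lemma colour_off_x:
  assumes k: "card K = 2" and v: "v \<in> C - K"
    and F: "G = {} \<or> (G = {z1, z2} \<and> z1 \<in> H \<and> z2 \<in> H \<and> z1 \<noteq> z2 \<and> z1 \<noteq> x \<and> z2 \<noteq> x \<and> z1 \<notin> nbrs H A v \<and> z2 \<notin> nbrs H A v \<and>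
        nbrs C A z1 \<noteq> {} \<and> nbrs C A z2 \<noteq> {} \<and> \<not> (A x z1 \<and> A x z2))"
  shows "\<exists>\<phi>. set_colouring H A palette \<phi> \<and> \<phi> x \<inter> blocked \<phi> v = {} \<and> (\<forall>a\<in>G. \<forall>b\<in>G. a \<noteq> b \<longrightarrow> \<phi> a \<inter> \<phi> b = {})"
proof -
  note xv = x_notin_nbrs_CK[OF v]
  have c2: "card (nbrs H A v) \<le> 2" using outside_degree v by auto
  define E where "E a b \<longleftrightarrow> (a = x \<and> b \<in> nbrs H A v) \<or> (b = x \<and> a \<in> nbrs H A v) \<or> (a \<in> G \<and> b \<in> G \<and> a \<noteq> b)" for a b
  have Gx: "x \<notin> G" and Gv: "G \<inter> nbrs H A v = {}" and GH: "G \<subseteq> H" and Gn: "\<And>a. a \<in> G \<Longrightarrow> nbrs C A a \<noteq> {}"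
    using F by auto
  have "\<exists>\<phi>. set_colouring H A palette \<phi> \<and> (\<forall>a\<in>H. \<forall>b\<in>H. E a b \<longrightarrow> \<phi> a \<inter> \<phi> b = {})"
  proof (rule colour_with_edges)
    show "E b a" if "E a b" for a b using that by (auto simp: E_def)
    show "\<not> E a a" for a using xv by (auto simp: E_def)
    show "card {b\<in>H. E a b} \<le> card (nbrs C A a)" if a: "a \<in> H" for a
    proof -
      consider "a = x" | "a \<noteq> x" "a \<in> nbrs H A v" | "a \<in> G" | "a \<noteq> x" "a \<notin> nbrs H A v" "a \<notin> G" by blast
      then show ?thesis
      proof cases
        case 1
        have "{b\<in>H. E a b} \<subseteq> nbrs H A v" using 1 xv Gx by (auto simp: E_def)
        then have "card {b\<in>H. E a b} \<le> card (nbrs H A v)" using fH by (intro card_mono) auto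
        then show ?thesis using c2 k 1 by simp
      next
        case 2
        have "a \<notin> G" using Gv 2 by blast
        then have "{b\<in>H. E a b} \<subseteq> {x}" using 2 by (auto simp: E_def)
        then have "card {b\<in>H. E a b} \<le> card {x}" by (intro card_mono) auto
        moreover have "v \<in> nbrs C A a" using 2 v adj_sym by (auto simp: nbrs_def)
        then have "1 \<le> card (nbrs C A a)" using fC by (auto simp: Suc_le_eq card_gt_0_iff)
        ultimately show ?thesis by simp
      next
        case 3
        have "a \<noteq> x" "a \<notin> nbrs H A v" using 3 Gx Gv by auto
        then have "{b\<in>H. E a b} \<subseteq> G - {a}" by (auto simp: E_def)
        then have "card {b\<in>H. E a b} \<le> card (G - {a})" using F by (intro card_mono) auto
        moreover have "card (G - {a}) \<le> 1" using F 3 by auto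
        moreover have "1 \<le> card (nbrs C A a)" using Gn[OF 3] fC by (auto simp: Suc_le_eq card_gt_0_iff)
        ultimately show ?thesis by linarith
      next
        case 4
        then have "{b\<in>H. E a b} = {}" by (auto simp: E_def)
        then show ?thesis by (simp only: card.empty)
      qed
    qed
    fix Q assume Q: "Q \<subseteq> H" "card Q = D" "\<forall>u\<in>Q. \<forall>w\<in>Q. u \<noteq> w \<longrightarrow> A u w \<or> E u w"
    have QV: "Q \<subseteq> V" using Q by auto
    show False
    proof (cases "\<exists>a b. a \<in> G \<and> b \<in> G \<and> a \<noteq> b \<and> a \<in> Q \<and> b \<in> Q")
      case False
      have ad: "A u w" if "u \<in> Q" "w \<in> Q" "u \<noteq> w" "u \<noteq> x" "w \<noteq> x" for u w
        using Q(3) that False unfolding E_def by blast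
      show False
      proof (cases "x \<in> Q")
        case True
        have "u \<in> nbrs H A v" if u: "u \<in> Q" "u \<noteq> x" "\<not> A x u" for u
        proof -
          have "A x u \<or> E x u" using Q(3) True u by auto
          then show ?thesis using u Gx by (auto simp: E_def)
        qed
        from clique_plus_star[OF QV Q(2) True ad this finite_nbrs[OF fH]] show False using k c2 D6 by simp
      next
        case nx: False
        have "is_clique A Q" unfolding is_clique_def using ad nx by blast
        then show False using clq[OF QV] Q(2) by simp
      qed
    next
      case True
      then have G: "G = {z1, z2}" "z1 \<in> Q" "z2 \<in> Q" "z1 \<noteq> z2" using F by auto
      have xQ: "x \<notin> Q"
      proof
        assume "x \<in> Q"
        then have "A x z1 \<or> E x z1" "A x z2 \<or> E x z2" using Q(3) G Gx by auto
        moreover have "\<not> E x z1" "\<not> E x z2" using G Gx Gv xv unfolding E_def by blast+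
        ultimately show False using F G(1) by blast
      qed
      have "D \<le> card K + 1 + card {z2}"
      proof (rule clique_plus_star[OF QV Q(2) G(2)])
        have Q3: "A u w \<or> (u \<in> {z1, z2} \<and> w \<in> {z1, z2})" if "u \<in> Q" "w \<in> Q" "u \<noteq> w" for u w
        proof -
          have "A u w \<or> E u w" using Q(3) that by auto
          moreover have "u \<noteq> x" "w \<noteq> x" using that xQ by auto
          ultimately show ?thesis using G(1) by (auto simp: E_def)
        qed
        show "A u w" if "u \<in> Q" "w \<in> Q" "u \<noteq> w" "u \<noteq> z1" "w \<noteq> z1" for u w
          using Q3[OF that(1-3)] that by auto
        show "u \<in> {z2}" if "u \<in> Q" "u \<noteq> z1" "\<not> A z1 u" for u
          using Q3[OF G(2) that(1)] that by auto
      qed auto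
      then show False using k D6 by simp
    qed
  qed
  then obtain \<phi> where \<phi>: "set_colouring H A palette \<phi>" "\<forall>a\<in>H. \<forall>b\<in>H. E a b \<longrightarrow> \<phi> a \<inter> \<phi> b = {}" by blast
  have "\<phi> x \<inter> blocked \<phi> v = {}" using \<phi>(2) xH unfolding blocked_def E_def nbrs_def by blast
  moreover have "\<forall>a\<in>G. \<forall>b\<in>G. a \<noteq> b \<longrightarrow> \<phi> a \<inter> \<phi> b = {}" using \<phi>(2) GH unfolding E_def by blast
  ultimately show ?thesis using \<phi>(1) by blast
qed

lemma pair_extend_avoiding:
  assumes \<phi>: "set_colouring H A palette \<phi>" "\<phi> x \<inter> blocked \<phi> v = {}" and u: "u1 \<in> K" "u2 \<in> K" "u1 \<noteq> u2" and v: "v \<in> C - K"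
    and h: "vol (side_colours \<phi> u1 \<inter> side_colours \<phi> u2) \<le> 1 - e"
  shows "colourable V A palette"
proof (rule pair_extend[OF \<phi>(1) u v])
  have "vol ((\<phi> x \<union> (side_colours \<phi> u1 \<inter> side_colours \<phi> u2)) \<inter> blocked \<phi> v) \<le> vol (side_colours \<phi> u1 \<inter> side_colours \<phi> u2)"
    by (rule vol_mono[of palette]) (use \<phi> xH side_colours_set[OF \<phi>(1)] colour_set_bl[OF \<phi>(1)] in \<open>auto simp: set_colouring_def intro!: colour_set_Int colour_set_Un\<close>)
  then show "vol ((\<phi> x \<union> (side_colours \<phi> u1 \<inter> side_colours \<phi> u2)) \<inter> blocked \<phi> v) \<le> 1 - e" using h by simp
  show "vol (\<phi> x \<inter> blocked \<phi> v) \<le> 1 - e" using \<phi>(2) e5 by simp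
qed (rule h)

text \<open>Neither of two colourings of the rest may extend, one because the colours of \<open>z1\<close> and \<open>z2\<close>
  agree and the other because they are disjoint, but then their average does.\<close>

lemma no_twins_two_triangle:
  assumes k: "card K = 2" and u: "u1 \<in> K" "u2 \<in> K" "u1 \<noteq> u2" and v: "v \<in> C - K"
    and z1: "z1 \<in> H" "z1 \<noteq> x" "nbrs H A u1 = {x, z1}" and z2: "z2 \<in> H" "z2 \<noteq> x" "nbrs H A u2 = {x, z2}"
    and z12: "z1 \<noteq> z2" and xz: "A x z1" "A x z2"
  shows "colourable V A palette"
proof -
  obtain \<phi>2 where \<phi>2: "set_colouring H A palette \<phi>2" "\<phi>2 x \<inter> blocked \<phi>2 v = {}"
    using colour_off_x[OF k v, of "{}" x x] by auto
  note P2 = side_colours_single[OF z1(3,2)] side_colours_single[OF z2(3,2)]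
  show ?thesis
  proof (cases "vol (\<phi>2 z1 \<inter> \<phi>2 z2) \<le> 1 - e")
    case True
    then show ?thesis using pair_extend_avoiding[OF \<phi>2 u v] P2 by simp
  next
    case False
    have ne: "nbrs C A z1 \<noteq> {}" "nbrs C A z2 \<noteq> {}" using nbrs_C_memI[OF u(1) z1(3)] nbrs_C_memI[OF u(2) z2(3)] by auto
    have "card K \<noteq> D - 2" using k D6 by simp
    then obtain \<phi>1 where \<phi>1: "set_colouring H A palette \<phi>1" "\<phi>1 z1 \<inter> \<phi>1 z2 = {}"
      using colour_add_edge[OF z1(1) z2(1) z12 ne] by blast
    obtain \<phi> where \<phi>: "set_colouring H A palette \<phi>"
      "\<forall>a\<in>H. \<forall>b\<in>H. vol (\<phi> a \<inter> \<phi> b) = (vol (\<phi>1 a \<inter> \<phi>1 b) + vol (\<phi>2 a \<inter> \<phi>2 b)) / 2"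
      using set_colouring_mix[OF fH cc0(1) \<phi>1(1) \<phi>2(1)] by blast
    define Z where "Z = \<phi> z1 \<inter> \<phi> z2"
    define \<zeta> where "\<zeta> = vol Z"
    have bz: "colour_set palette (\<phi> z1)" "colour_set palette (\<phi> z2)" "vol (\<phi> z1) = 1" "vol (\<phi> z2) = 1" using \<phi>(1) z1 z2 by (auto simp: set_colouring_def)
    have bZ: "colour_set palette Z" unfolding Z_def by (intro colour_set_Int bz)
    have "colour_set palette (\<phi>2 z1)" "colour_set palette (\<phi>2 z2)" "vol (\<phi>2 z1) = 1" using \<phi>2(1) z1 z2 by (auto simp: set_colouring_def)
    then have "vol (\<phi>2 z1 \<inter> \<phi>2 z2) \<le> 1" using vol_mono[of palette "\<phi>2 z1" "\<phi>2 z1 \<inter> \<phi>2 z2"] colour_set_Int by auto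
    moreover have "\<zeta> = vol (\<phi>2 z1 \<inter> \<phi>2 z2) / 2" using \<phi>(2) z1(1) z2(1) \<phi>1(2) by (simp add: \<zeta>_def Z_def)
    \<comment> \<open>Half of the overlap in \<open>\<phi>2\<close>, which lies between 1 - e and 1,
      as there is no overlap in \<open>\<phi>1\<close>.\<close>
    ultimately have \<zeta>: "(1 - e) / 2 \<le> \<zeta>" "\<zeta> \<le> 1/2" using False by auto
    define B where "B = blocked \<phi> v"
    have B: "colour_set palette B" "vol B \<le> 2" unfolding B_def using colour_set_bl[OF \<phi>(1)] vol_bl[OF \<phi>(1)] v by auto
    define L where "L = free_colours \<phi> (nbrs H A x)"
    have bL: "colour_set palette L" unfolding L_def by (rule free_colours_nbrs[OF \<phi>(1) xH])
    define N where "N = nbrs H A x - {z1, z2}"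
    have zN: "{z1, z2} \<subseteq> nbrs H A x" using xz z1 z2 by (auto simp: nbrs_def)
    have "card N = card (nbrs H A x) - 2" unfolding N_def using zN fH z12 by (subst card_Diff_subset) auto
    moreover have "card (nbrs H A x) + card K \<le> D" using card_nbrs_H[of x] xH by auto
    ultimately have cN: "card N \<le> D - 4" using k by simp
    have fN: "finite N" "N \<subseteq> H" using fH nbrs_subset[of H A x] by (auto simp: N_def)
    note mN = vol_nb[OF \<phi>(1) fN]
    have b12: "colour_set palette (\<phi> z1 \<union> \<phi> z2)" "vol (\<phi> z1 \<union> \<phi> z2) = 2 - \<zeta>"
      using colour_set_Un[OF bz(1,2)] vol_Un_Int[OF bz(1,2)] bz(3,4) by (auto simp: \<zeta>_def Z_def)
    have Leq: "L = {0..<palette} - ((\<Union>a\<in>N. \<phi> a) \<union> (\<phi> z1 \<union> \<phi> z2))"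
      unfolding L_def free_colours_def N_def using zN by blast
    have "palette - vol ((\<Union>a\<in>N. \<phi> a) \<union> (\<phi> z1 \<union> \<phi> z2)) \<le> vol L"
      unfolding Leq using vol_Diff_ge[OF colour_set_ivl colour_set_Un[OF mN(1) b12(1)]] vol_ivl[OF cc0(1)] by simp
    moreover have "vol ((\<Union>a\<in>N. \<phi> a) \<union> (\<phi> z1 \<union> \<phi> z2)) \<le> real (card N) + (2 - \<zeta>)"
      using vol_Un_le[OF mN(1) b12(1)] mN(2) b12(2) by linarith
    \<comment> \<open>The overlap of \<open>z1\<close> and \<open>z2\<close> frees
      \<open>\<zeta>\<close> further colours for their common neighbour \<open>x\<close>.\<close>
    ultimately have L2: "2 - e + \<zeta> \<le> vol L" using cN D6 by linarith
    define \<beta> where "\<beta> = vol (B \<inter> Z)"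
    have "\<beta> \<le> \<zeta>" unfolding \<beta>_def \<zeta>_def using vol_mono[OF bZ colour_set_Int[OF B(1) bZ]] by auto
    have "0 \<le> \<beta>" by (simp add: \<beta>_def)
    have "vol B = \<beta> + vol (B - Z)" unfolding \<beta>_def by (rule vol_split[OF B(1) bZ])
    then have "vol (B - Z) \<le> 2 - \<beta>" using B(2) by simp
    moreover have "L - B = L - (B - Z)" unfolding Leq Z_def by blast
    ultimately have LB: "\<zeta> - e + \<beta> \<le> vol (L - B)"
      using vol_Diff_ge[OF bL colour_set_Diff[OF B(1) bZ]] L2 by simp
    have "0 \<le> \<zeta>" by (simp add: \<zeta>_def)
    then have "1 \<le> vol L" using L2 e5 by linarith
    then obtain X where X: "colour_set palette X" "X \<subseteq> L" "vol X = 1" "vol (X \<inter> B) \<le> max 0 (1 - vol (L - B))"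
      using vol_subset_avoiding[OF bL B(1), of 1] by auto
    have XB: "vol (X \<inter> B) \<le> max 0 (1 - (\<zeta> - e + \<beta>))" using X(4) LB by linarith
    have \<phi>': "set_colouring H A palette (\<phi>(x := X))" using X by (intro recolour[OF \<phi>(1) xH]) (auto simp: L_def)
    have blv: "blocked (\<phi>(x := X)) v = B" unfolding B_def by (rule blocked_upd[OF x_notin_nbrs_CK[OF v]])
    have PZ: "side_colours \<phi> u1 \<inter> side_colours \<phi> u2 = Z" using P2 by (simp add: Z_def)
    show ?thesis
    proof (rule pair_extend[OF \<phi>' u v], unfold blv side_colours_upd fun_upd_same PZ)
      have "vol ((X \<union> Z) \<inter> B) \<le> vol (X \<inter> B) + vol (B \<inter> Z)"
        by (rule vol_le_add[of palette]) (use X B bZ colour_set_Int colour_set_Un in auto)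
      then have "vol ((X \<union> Z) \<inter> B) \<le> max \<beta> (1 - \<zeta> + e)" using XB by (auto simp: \<beta>_def)
      \<comment> \<open>The bound on \<open>e\<close> is used up: 1 - (1 - e)/2 + e is at most 1 - e
        exactly for e <= 1/5.\<close>
      then show "vol ((X \<union> Z) \<inter> B) \<le> 1 - e" using \<open>\<beta> \<le> \<zeta>\<close> \<zeta> e5 by auto
      show "vol Z \<le> 1 - e" using \<zeta> e5 by (simp add: \<zeta>_def)
      show "vol (X \<inter> B) \<le> 1 - e" using XB \<zeta> e5 \<open>0 \<le> \<beta>\<close> by auto
    qed
  qed
qed

text \<open>The side colours of \<open>u1\<close> and \<open>u2\<close> are separated by the mildest
  means: nothing if one of them has no second neighbour, recolouring if \<open>z1\<close> or
  \<open>z2\<close> has two neighbours in \<open>C\<close>, an added edge if \<open>x\<close> is not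
  adjacent to both, and averaging otherwise.\<close>

lemma no_twins_two:
  assumes k: "card K = 2"
  shows "colourable V A palette"
proof -
  obtain u1 u2 where u: "u1 \<in> K" "u2 \<in> K" "u1 \<noteq> u2" and ui: "nbrs H A u1 \<inter> nbrs H A u2 = {x}"
    using pair_exists by blast
  have c3: "3 \<le> card (C - K)" using card_CK k D6 by simp
  then have "C - K \<noteq> {}" by (metis card.empty not_numeral_le_zero)
  then obtain v0 where v0: "v0 \<in> C - K" by blast
  have none: "colourable V A palette" if "w1 \<in> K" "w2 \<in> K" "w1 \<noteq> w2" "nbrs H A w1 = {x}" for w1 w2
  proof -
    obtain \<phi> where \<phi>: "set_colouring H A palette \<phi>" "\<phi> x \<inter> blocked \<phi> v0 = {}"
      using colour_off_x[OF k v0, of "{}" x x] by auto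
    have "side_colours \<phi> w1 = {}" using that by (simp add: side_colours_def)
    then show ?thesis using pair_extend_avoiding[OF \<phi> that(1-3) v0] e5 by simp
  qed
  have rec: "colourable V A palette" if w: "w1 \<in> K" "w2 \<in> K" "w1 \<noteq> w2"
    and z: "z \<in> H" "z \<noteq> x" "nbrs H A w1 = {x, z}" "z \<notin> nbrs H A w2" "2 \<le> card (nbrs C A z)" for w1 w2 z
  proof -
    have "card (nbrs C A z) \<le> 2" using kmax[OF C, of z] z(1) k by auto
    \<comment> \<open>A vertex \<open>v\<close> not adjacent to \<open>z\<close>, so that
      recolouring \<open>z\<close> leaves its blocked colours unchanged.\<close>
    then have "\<not> C - K \<subseteq> nbrs C A z" using card_mono[of "nbrs C A z" "C - K"] fC c3 by auto
    then obtain v where v: "v \<in> C - K" "v \<notin> nbrs C A z" by blast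
    have zv: "z \<notin> nbrs H A v" using v adj_sym by (auto simp: nbrs_def)
    obtain \<phi> where \<phi>: "set_colouring H A palette \<phi>" "\<phi> x \<inter> blocked \<phi> v = {}"
      using colour_off_x[OF k v(1), of "{}" x x] by auto
    obtain X where X: "set_colouring H A palette (\<phi>(z := X))" "vol (X \<inter> side_colours \<phi> w2) \<le> e"
      using recolour_avoiding[OF \<phi>(1) z(1,5) side_colours_set[OF \<phi>(1)] side_colours_le[OF \<phi>(1) w(2)]] by blast
    have "side_colours (\<phi>(z := X)) w2 = side_colours \<phi> w2" unfolding side_colours_def using z(4) by (intro SUP_cong) auto
    moreover have "side_colours (\<phi>(z := X)) w1 = X" using side_colours_single[OF z(3,2)] by simp
    ultimately have "vol (side_colours (\<phi>(z := X)) w1 \<inter> side_colours (\<phi>(z := X)) w2) \<le> 1 - e" using X(2) e5 by simp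
    moreover have "(\<phi>(z := X)) x \<inter> blocked (\<phi>(z := X)) v = {}" using \<phi>(2) z(2) blocked_upd[OF zv] by simp
    ultimately show ?thesis using pair_extend_avoiding[OF X(1) _ w v(1)] by blast
  qed
  show ?thesis
  proof (rule nbrs_K_cases[OF u(1)])
    assume "nbrs H A u1 = {x}"
    then show ?thesis using none[OF u] by blast
  next
    fix z1 assume z1: "z1 \<in> H" "z1 \<noteq> x" "nbrs H A u1 = {x, z1}"
    show ?thesis
    proof (rule nbrs_K_cases[OF u(2)])
      assume "nbrs H A u2 = {x}"
      then show ?thesis using none[OF u(2,1) u(3)[symmetric]] by blast
    next
      fix z2 assume z2: "z2 \<in> H" "z2 \<noteq> x" "nbrs H A u2 = {x, z2}"
      have z12: "z1 \<noteq> z2" using ui z1 z2 by auto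
      have nz: "z1 \<notin> nbrs H A u2" "z2 \<notin> nbrs H A u1" using z1 z2 z12 by auto
      note P2 = side_colours_single[OF z1(3,2)] side_colours_single[OF z2(3,2)]
      show ?thesis
      proof (cases "2 \<le> card (nbrs C A z1) \<or> 2 \<le> card (nbrs C A z2)")
        case True
        then show ?thesis using rec[OF u z1 nz(1)] rec[OF u(2,1) u(3)[symmetric] z2 nz(2)] by blast
      next
        case False
        have n1: "v0 \<notin> nbrs C A z1"
        proof
          assume "v0 \<in> nbrs C A z1"
          then have "card {v0, u1} \<le> card (nbrs C A z1)" using nbrs_C_memI[OF u(1) z1(3)] fC by (intro card_mono) auto
          moreover have "v0 \<noteq> u1" using v0 u by auto
          ultimately show False using False by simp
        qed
        have n2: "v0 \<notin> nbrs C A z2"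
        proof
          assume "v0 \<in> nbrs C A z2"
          then have "card {v0, u2} \<le> card (nbrs C A z2)" using nbrs_C_memI[OF u(2) z2(3)] fC by (intro card_mono) auto
          moreover have "v0 \<noteq> u2" using v0 u by auto
          ultimately show False using False by simp
        qed
        have nv: "z1 \<notin> nbrs H A v0" "z2 \<notin> nbrs H A v0" using n1 n2 v0 adj_sym by (auto simp: nbrs_def)
        have ne: "nbrs C A z1 \<noteq> {}" "nbrs C A z2 \<noteq> {}" using nbrs_C_memI[OF u(1) z1(3)] nbrs_C_memI[OF u(2) z2(3)] by auto
        show ?thesis
        proof (cases "A x z1 \<and> A x z2")
          case True
          then show ?thesis using no_twins_two_triangle[OF k u v0 z1 z2 z12] by blast
        next
          case nA: False
          obtain \<phi> where \<phi>: "set_colouring H A palette \<phi>" "\<phi> x \<inter> blocked \<phi> v0 = {}"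
            "\<forall>a\<in>{z1, z2}. \<forall>b\<in>{z1, z2}. a \<noteq> b \<longrightarrow> \<phi> a \<inter> \<phi> b = {}"
            using colour_off_x[OF k v0, of "{z1, z2}" z1 z2] z1 z2 z12 nv ne nA by auto
          then have "side_colours \<phi> u1 \<inter> side_colours \<phi> u2 = {}" using P2 z12 by simp
          then show ?thesis using pair_extend_avoiding[OF \<phi>(1,2) u v0] e5 by simp
        qed
      qed
    qed
  qed
qed

lemma no_twins_colourable: "colourable V A palette"
  using no_twins_large no_twins_two k2 by (cases "card K = 2") auto

end

section \<open>Choice of the extremal clique and outside vertex\<close>

context induction_step
begin

text \<open>Maximise the number of neighbours over all big cliques and outside vertices. If twins
  occur at some pair attaining the maximum, work at that pair; otherwise the assumption of
  \<open>step_no_twins\<close> is met.\<close>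

lemma reducible:
  assumes "big_clique C" "x \<in> V - C" "2 \<le> card (nbrs C A x)"
  shows "colourable V A palette"
proof -
  define Pr where "Pr = (\<lambda>(C, x). big_clique C \<and> x \<in> V - C)"
  define f where "f = (\<lambda>(C, x). card (nbrs C A x))"
  have bound: "f p \<le> card V" if "Pr p" for p
  proof -
    obtain C x where p: "p = (C, x)" by force
    have "nbrs C A x \<subseteq> V" using that unfolding p Pr_def big_clique_def nbrs_def by auto
    then show ?thesis unfolding p f_def using fV by (auto intro: card_mono)
  qed
  have "Pr (C, x)" using assms by (simp add: Pr_def)
  then obtain q where q: "Pr q" and qmax: "\<And>p. Pr p \<Longrightarrow> f p \<le> f q"
    using ex_has_greatest_nat[of Pr "(C, x)" f "card V + 1"] bound by (auto simp: less_Suc_eq_le)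
  obtain C0 x0 where q0: "q = (C0, x0)" by force
  have C0: "big_clique C0" "x0 \<in> V - C0" using q by (auto simp: q0 Pr_def)
  have mx: "card (nbrs C' A y) \<le> card (nbrs C0 A x0)" if "big_clique C'" "y \<in> V - C'" for C' y
    using qmax[of "(C', y)"] that by (simp add: Pr_def f_def q0)
  have k2: "2 \<le> card (nbrs C0 A x0)" using mx[OF assms(1,2)] assms(3) by simp
  show ?thesis
  proof (cases "\<exists>C' x' z'. big_clique C' \<and> x' \<in> V - C' \<and> z' \<in> V - C' \<and> x' \<noteq> z' \<and>
      card (nbrs C' A x') = card (nbrs C0 A x0) \<and> nbrs C' A x' \<subseteq> nbrs C' A z'")
    case True
    then obtain C' x' z' where t: "big_clique C'" "x' \<in> V - C'" "z' \<in> V - C'" "x' \<noteq> z'"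
      "card (nbrs C' A x') = card (nbrs C0 A x0)" "nbrs C' A x' \<subseteq> nbrs C' A z'" by blast
    interpret step_twins V A D e C' x' z'
      by unfold_locales (use t mx k2 in auto)
    show ?thesis by (rule twins)
  next
    case False
    interpret step_no_twins V A D e C0 x0
      by unfold_locales (use C0 mx k2 False in blast)+
    show ?thesis by (rule no_twins_colourable)
  qed
qed

end

section \<open>The random stable set\<close>

lemma subsets_containing:
  assumes C: "finite C" "card C = n" and a: "a \<in> C" and n: "4 \<le> n"
  defines "B \<equiv> {T. T \<subseteq> C \<and> card T = 4}"
  shows "finite B" "B \<noteq> {}" "real (card {T\<in>B. a \<in> T}) / real (card B) = 4 / real n"
proof -
  show fB: "finite B" unfolding B_def using C by auto
  have cB: "card B = n choose 4" unfolding B_def using n_subsets[OF C(1)] C(2) by simp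
  then show "B \<noteq> {}" using n by (auto simp: zero_less_binomial_iff)
  have "{T\<in>B. a \<in> T} = insert a ` {T. T \<subseteq> C - {a} \<and> card T = 3}"
  proof (intro equalityI subsetI)
    fix T assume T: "T \<in> {T\<in>B. a \<in> T}"
    then have "finite T" using C finite_subset by (auto simp: B_def)
    then have "T - {a} \<in> {T. T \<subseteq> C - {a} \<and> card T = 3}" using T by (auto simp: B_def)
    moreover have "T = insert a (T - {a})" using T by auto
    ultimately show "T \<in> insert a ` {T. T \<subseteq> C - {a} \<and> card T = 3}" by blast
  next
    fix T assume "T \<in> insert a ` {T. T \<subseteq> C - {a} \<and> card T = 3}"
    then obtain S where S: "S \<subseteq> C - {a}" "card S = 3" "T = insert a S" by auto
    then have "finite S" "a \<notin> S" using C finite_subset by auto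
    then show "T \<in> {T\<in>B. a \<in> T}" using S a by (auto simp: B_def)
  qed
  moreover have "inj_on (insert a) {T. T \<subseteq> C - {a} \<and> card T = 3}"
    by (rule inj_onI) blast
  ultimately have "card {T\<in>B. a \<in> T} = card {T. T \<subseteq> C - {a} \<and> card T = 3}" by (simp add: card_image)
  also have "\<dots> = (n - 1) choose 3" using n_subsets[of "C - {a}" 3] C a by simp
  finally have ca: "card {T\<in>B. a \<in> T} = (n - 1) choose 3" .
  have "Suc 3 * (Suc (n - 1) choose Suc 3) = Suc (n - 1) * ((n - 1) choose 3)"
    by (rule Suc_times_binomial)
  then have "4 * card B = n * card {T\<in>B. a \<in> T}" using n cB ca by (simp add: numeral_eq_Suc)
  then have "4 * real (card B) = real n * real (card {T\<in>B. a \<in> T})"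
    by (metis of_nat_mult of_nat_numeral)
  moreover have "0 < real (card B)" using fB \<open>B \<noteq> {}\<close> by (simp add: card_gt_0_iff)
  ultimately show "real (card {T\<in>B. a \<in> T}) / real (card B) = 4 / real n"
    using n by (simp add: field_simps)
qed

text \<open>Choice functions with default value \<open>{}\<close>, the form in which the uniform
  distribution is a product of independent uniform choices.\<close>

definition four_subsets :: "'a set set \<Rightarrow> ('a set \<Rightarrow> 'a set) set" where
  "four_subsets big_cliques = PiE_dflt big_cliques {} (\<lambda>C. {T. T \<subseteq> C \<and> card T = 4})"

text \<open>This is max 0 (1 - k/4), written as a sum over thresholds so that its binomial
  expectation is literally the numerator of \<open>p_val\<close>.\<close>

definition survival :: "nat \<Rightarrow> real" where
  "survival k = (\<Sum>i=0..3. 1/4 * (if k \<le> i then 1 else 0))"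

lemma survival_le: "survival k \<le> max 0 (1 - real k / 4)"
proof -
  consider "k = 0" | "k = 1" | "k = 2" | "k = 3" | "4 \<le> k" by linarith
  then show ?thesis by cases (auto simp: survival_def numeral_eq_Suc)
qed

context
  fixes big_cliques :: "'a set set" and n :: nat
  assumes finite_big_cliques: "finite big_cliques" and big_cliques: "\<And>C. C \<in> big_cliques \<Longrightarrow> finite C \<and> card C = n" and n4: "4 \<le> n"
begin

abbreviation B4 :: "'a set \<Rightarrow> 'a set set" where
  "B4 C \<equiv> {T. T \<subseteq> C \<and> card T = 4}"

lemma B4_fin: "C \<in> big_cliques \<Longrightarrow> finite (B4 C)" "C \<in> big_cliques \<Longrightarrow> B4 C \<noteq> {}"
proof -
  assume C: "C \<in> big_cliques"
  then obtain a where "a \<in> C" using big_cliques[OF C] n4 by fastforce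
  then show "finite (B4 C)" "B4 C \<noteq> {}" using subsets_containing[of C n a] big_cliques[OF C] n4 by auto
qed

lemma four_subsets_pmf: "Pi_pmf big_cliques {} (\<lambda>C. pmf_of_set (B4 C)) = pmf_of_set (four_subsets big_cliques)"
  unfolding four_subsets_def by (rule Pi_pmf_of_set[OF finite_big_cliques B4_fin])

lemma four_subsets_fin: "finite (four_subsets big_cliques)" "four_subsets big_cliques \<noteq> {}"
  unfolding four_subsets_def using finite_big_cliques B4_fin by (auto simp: finite_PiE_dflt PiE_dflt_empty_iff)

lemma average_eq: "(\<Sum>Q\<in>four_subsets big_cliques. g Q) / card (four_subsets big_cliques)
    = measure_pmf.expectation (Pi_pmf big_cliques {} (\<lambda>C. pmf_of_set (B4 C))) g"
  unfolding four_subsets_pmf by (rule integral_pmf_of_set[OF four_subsets_fin(2) four_subsets_fin(1), symmetric])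

lemma average_member:
  assumes C: "C \<in> big_cliques" and a: "a \<in> C"
  shows "(\<Sum>Q\<in>four_subsets big_cliques. if a \<in> Q C then 1 else 0) / card (four_subsets big_cliques) = 4 / real n"
proof -
  have "measure_pmf.expectation (Pi_pmf big_cliques {} (\<lambda>C. pmf_of_set (B4 C))) (\<lambda>Q. if a \<in> Q C then 1 else 0)
    = measure_pmf.expectation (map_pmf (\<lambda>Q. Q C) (Pi_pmf big_cliques {} (\<lambda>C. pmf_of_set (B4 C)))) (\<lambda>T. if a \<in> T then 1 else (0::real))"
    by simp
  also have "\<dots> = measure_pmf.expectation (pmf_of_set (B4 C)) (\<lambda>T. if a \<in> T then 1 else 0)"
    unfolding Pi_pmf_component[OF finite_big_cliques] using C by simp
  also have "\<dots> = (\<Sum>T\<in>B4 C. if a \<in> T then 1 else 0) / card (B4 C)"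
    by (rule integral_pmf_of_set[OF B4_fin(2)[OF C] B4_fin(1)[OF C]])
  also have "(\<Sum>T\<in>B4 C. if a \<in> T then 1 else (0::real)) = real (card {T\<in>B4 C. a \<in> T})"
    using B4_fin(1)[OF C] by (simp add: sum.inter_filter[symmetric])
  also have "\<dots> / card (B4 C) = 4 / real n"
    using subsets_containing(3)[of C n a] big_cliques[OF C] a n4 by simp
  finally show ?thesis unfolding average_eq .
qed

text \<open>The cliques choose independently, and each \<open>a C\<close> is chosen with probability
  4 / n, so the number of chosen ones is binomial.\<close>

lemma average_surv:
  assumes J: "J \<subseteq> big_cliques" and a: "\<And>C. C \<in> J \<Longrightarrow> a C \<in> C"
  shows "(\<Sum>Q\<in>four_subsets big_cliques. survival (card {C\<in>J. a C \<in> Q C})) / card (four_subsets big_cliques)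
    = (\<Sum>i=0..3. 1/4 * measure_pmf.prob (binomial_pmf (card J) (4 / real n)) {X. X \<le> i})"
proof -
  have fJ: "finite J" using finite_subset[OF J finite_big_cliques] .
  define p where "p = 4 / real n"
  have p: "p \<in> {0..1}" using n4 by (auto simp: p_def)
  define M where "M = Pi_pmf big_cliques {} (\<lambda>C. pmf_of_set (B4 C))"
  have bern: "bernoulli_pmf p = bind_pmf (pmf_of_set (B4 C)) (\<lambda>T. return_pmf (a C \<in> T))" if C: "C \<in> J" for C
  proof -
    have CCC: "C \<in> big_cliques" using C J by auto
    have "pmf (map_pmf (\<lambda>T. a C \<in> T) (pmf_of_set (B4 C))) True = p"
    proof -
      have "pmf (map_pmf (\<lambda>T. a C \<in> T) (pmf_of_set (B4 C))) True
        = measure_pmf.prob (pmf_of_set (B4 C)) ((\<lambda>T. a C \<in> T) -` {True})" by (rule pmf_map)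
      also have "\<dots> = real (card (B4 C \<inter> ((\<lambda>T. a C \<in> T) -` {True}))) / card (B4 C)"
        by (rule measure_pmf_of_set[OF B4_fin(2)[OF CCC] B4_fin(1)[OF CCC]])
      also have "B4 C \<inter> ((\<lambda>T. a C \<in> T) -` {True}) = {T\<in>B4 C. a C \<in> T}" by auto
      finally show ?thesis unfolding p_def using subsets_containing(3)[of C n "a C"] big_cliques[OF CCC] a[OF C] n4 by simp
    qed
    moreover have "pmf N False = 1 - pmf N True" for N :: "bool pmf"
    proof -
      have "sum (pmf N) UNIV = 1" by (rule sum_pmf_eq_1) auto
      then show ?thesis by (simp add: UNIV_bool)
    qed
    ultimately have "pmf (bernoulli_pmf p) b = pmf (map_pmf (\<lambda>T. a C \<in> T) (pmf_of_set (B4 C))) b" for b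
      using p by (cases b) auto
    then show ?thesis by (intro pmf_eqI) (simp add: map_pmf_def)
  qed
  have "Pi_pmf J False (\<lambda>_. bernoulli_pmf p)
    = Pi_pmf J False (\<lambda>C. bind_pmf (pmf_of_set (B4 C)) (\<lambda>T. return_pmf (a C \<in> T)))"
    using bern by (intro Pi_pmf_cong) auto
  also have "\<dots> = bind_pmf (Pi_pmf J {} (\<lambda>C. pmf_of_set (B4 C))) (\<lambda>Q. Pi_pmf J False (\<lambda>C. return_pmf (a C \<in> Q C)))"
    by (rule Pi_pmf_bind[OF fJ])
  also have "\<dots> = map_pmf (\<lambda>Q C. if C \<in> J then a C \<in> Q C else False) (Pi_pmf J {} (\<lambda>C. pmf_of_set (B4 C)))"
    unfolding map_pmf_def using fJ by simp
  also have "Pi_pmf J {} (\<lambda>C. pmf_of_set (B4 C)) = map_pmf (\<lambda>Q C. if C \<in> J then Q C else {}) M"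
    unfolding M_def by (rule Pi_pmf_subset[OF finite_big_cliques J])
  finally have 1: "Pi_pmf J False (\<lambda>_. bernoulli_pmf p) = map_pmf (\<lambda>Q C. C \<in> J \<and> a C \<in> Q C) M"
    by (simp add: map_pmf_comp if_distrib[where f = "\<lambda>x. _ \<in> x"] cong: if_cong)
      (intro map_pmf_cong refl ext, auto)
  have "binomial_pmf (card J) p = map_pmf (\<lambda>f. card {C\<in>J. f C}) (map_pmf (\<lambda>Q C. C \<in> J \<and> a C \<in> Q C) M)"
    unfolding binomial_pmf_altdef'[OF fJ refl p, where dflt = False] 1 ..
  also have "\<dots> = map_pmf (\<lambda>Q. card {C\<in>J. a C \<in> Q C}) M"
    unfolding map_pmf_comp by (intro map_pmf_cong refl arg_cong[where f = card]) auto
  finally have bin: "binomial_pmf (card J) p = map_pmf (\<lambda>Q. card {C\<in>J. a C \<in> Q C}) M" .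
  have "measure_pmf.expectation M (\<lambda>Q. survival (card {C\<in>J. a C \<in> Q C}))
    = measure_pmf.expectation (binomial_pmf (card J) p) survival" unfolding bin by simp
  also have "\<dots> = (\<Sum>i=0..3. measure_pmf.expectation (binomial_pmf (card J) p) (\<lambda>k. 1/4 * indicator {X. X \<le> i} k))"
  proof -
    have s: "survival = (\<lambda>k. \<Sum>i=0..3. 1/4 * indicator {X. X \<le> i} k)"
      unfolding survival_def by (intro ext sum.cong refl) (simp add: indicator_def)
    show ?thesis unfolding s
      by (rule Bochner_Integration.integral_sum)
        (intro measure_pmf.integrable_const_bound[of _ 1], auto simp: indicator_def)
  qed
  also have "\<dots> = (\<Sum>i=0..3. 1/4 * measure_pmf.prob (binomial_pmf (card J) p) {X. X \<le> i})"
    by simp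
  finally show ?thesis unfolding average_eq M_def p_def .
qed

end

section \<open>Random stable sets when outside vertices have at most one neighbour in a big
  clique\<close>

locale reduced_graph =
  fixes V :: "'a set" and A :: "'a \<Rightarrow> 'a \<Rightarrow> bool" and D :: nat
  assumes fV: "finite V" and sym: "symp A" and irr: "irreflp A" and D6: "6 \<le> D"
    and deg: "\<And>v. v \<in> V \<Longrightarrow> card (nbrs V A v) \<le> D"
    and clq: "\<And>K. K \<subseteq> V \<Longrightarrow> is_clique A K \<Longrightarrow> card K < D"
    and one_neighbour: "\<And>C x. C \<subseteq> V \<Longrightarrow> is_clique A C \<Longrightarrow> card C = D - 1 \<Longrightarrow> x \<in> V - C \<Longrightarrow> card (nbrs C A x) \<le> 1"
begin

lemma adj_sym: "A u v \<Longrightarrow> A v u"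
  using sym by (auto simp: symp_def)

lemma adj_irrefl: "\<not> A u u"
  using irr by (auto simp: irreflp_def)

definition big_cliques :: "'a set set" where
  "big_cliques = {C. C \<subseteq> V \<and> is_clique A C \<and> card C = D - 1}"

definition clique_vertices :: "'a set" where
  "clique_vertices = \<Union>big_cliques"

lemma big_cliques_D: "C \<in> big_cliques \<Longrightarrow> C \<subseteq> V" "C \<in> big_cliques \<Longrightarrow> is_clique A C" "C \<in> big_cliques \<Longrightarrow> card C = D - 1" "C \<in> big_cliques \<Longrightarrow> finite C"
  using fV finite_subset by (auto simp: big_cliques_def)

lemma finite_big_cliques: "finite big_cliques"
  using fV by (auto simp: big_cliques_def intro: finite_subset[of _ "Pow V"])

lemma clique_vertices_V: "clique_vertices \<subseteq> V"
  using big_cliques_D by (auto simp: clique_vertices_def)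

lemma nbrs_unique:
  assumes "C \<in> big_cliques" "x \<in> V - C" "a \<in> C" "b \<in> C" "A x a" "A x b"
  shows "a = b"
proof (rule ccontr)
  assume "a \<noteq> b"
  moreover have "{a, b} \<subseteq> nbrs C A x" using assms by (auto simp: nbrs_def)
  then have "card {a, b} \<le> card (nbrs C A x)" using big_cliques_D(4)[OF assms(1)] by (intro card_mono) auto
  moreover have "card (nbrs C A x) \<le> 1" using big_cliques_D[OF assms(1)] assms(2) by (intro one_neighbour) auto
  ultimately show False by simp
qed

lemma outside_degree:
  assumes C: "C \<in> big_cliques" and u: "u \<in> C"
  shows "card (nbrs V A u - C) \<le> 2"
proof -
  have "card (nbrs V A u - C) + card (C - {u}) = card ((nbrs V A u - C) \<union> (C - {u}))"
    using fV big_cliques_D(4)[OF C] by (intro card_Un_disjoint[symmetric]) auto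
  also have "\<dots> \<le> card (nbrs V A u)"
    using fV big_cliques_D(1,2)[OF C] u by (intro card_mono) (auto simp: nbrs_def is_clique_def)
  also have "\<dots> \<le> D" using big_cliques_D(1)[OF C] u by (intro deg) auto
  finally show ?thesis using big_cliques_D(3,4)[OF C] u D6 by simp
qed

text \<open>A vertex of \<open>C'\<close> outside \<open>C\<close> sees all of the intersection,
  which is therefore just \<open>{s}\<close>; but then \<open>s\<close> would have 2(D - 2) > D
  neighbours.\<close>

lemma big_cliques_disjoint:
  assumes C: "C \<in> big_cliques" and C': "C' \<in> big_cliques" and s: "s \<in> C" "s \<in> C'"
  shows "C = C'"
proof (rule ccontr)
  assume ne: "C \<noteq> C'"
  have "\<not> C' \<subseteq> C" using card_seteq[OF big_cliques_D(4)[OF C], of C'] big_cliques_D(3)[OF C] big_cliques_D(3)[OF C'] ne by auto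
  then obtain x where x: "x \<in> C'" "x \<notin> C" by blast
  have "C \<inter> C' \<subseteq> nbrs C A x" using big_cliques_D(2)[OF C'] x by (auto simp: nbrs_def is_clique_def)
  then have "card (C \<inter> C') \<le> card (nbrs C A x)" using big_cliques_D(4)[OF C] by (intro card_mono) auto
  also have "\<dots> \<le> 1" using big_cliques_D[OF C] big_cliques_D(1)[OF C'] x by (intro one_neighbour) auto
  finally have "card (C \<inter> C') \<le> 1" .
  moreover have "card C + card C' = card (C \<union> C') + card (C \<inter> C')"
    using big_cliques_D(4)[OF C] big_cliques_D(4)[OF C'] by (rule card_Un_Int)
  moreover have "C \<union> C' - {s} \<subseteq> nbrs V A s"
    using big_cliques_D(1,2)[OF C] big_cliques_D(1,2)[OF C'] s by (auto simp: nbrs_def is_clique_def)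
  then have "card (C \<union> C' - {s}) \<le> card (nbrs V A s)" using fV by (intro card_mono) auto
  then have "card (C \<union> C') - 1 \<le> D" using deg[of s] s big_cliques_D(1)[OF C] big_cliques_D(4)[OF C] big_cliques_D(4)[OF C'] by auto
  ultimately show False using big_cliques_D(3)[OF C] big_cliques_D(3)[OF C'] D6 by linarith
qed

definition clique_of :: "'a \<Rightarrow> 'a set" where
  "clique_of u = (THE C. C \<in> big_cliques \<and> u \<in> C)"

lemma clique_of_eq: "C \<in> big_cliques \<Longrightarrow> u \<in> C \<Longrightarrow> clique_of u = C"
  unfolding clique_of_def using big_cliques_disjoint by (intro the_equality) blast+

lemma clique_of_in: "u \<in> clique_vertices \<Longrightarrow> clique_of u \<in> big_cliques \<and> u \<in> clique_of u"
  using clique_of_eq by (auto simp: clique_vertices_def)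

text \<open>Meant for clique vertices, where \<open>clique_of\<close> is determined. A transversal
  has only one vertex in a clique anyway, and dropping the inner edges brings the degrees down to
  two.\<close>

definition cross_adj :: "'a \<Rightarrow> 'a \<Rightarrow> bool" where
  "cross_adj u v \<longleftrightarrow> A u v \<and> clique_of u \<noteq> clique_of v"

definition sample :: "('a set \<Rightarrow> 'a set) \<Rightarrow> 'a set" where
  "sample Q = (\<Union>C\<in>big_cliques. Q C)"

definition sample_transversals :: "('a set \<Rightarrow> 'a set) \<Rightarrow> 'a set set" where
  "sample_transversals Q = {T. transversal cross_adj clique_of (sample Q) big_cliques T}"

lemma four_subsets_D: "Q \<in> four_subsets big_cliques \<Longrightarrow> C \<in> big_cliques \<Longrightarrow> Q C \<subseteq> C \<and> card (Q C) = 4"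
  by (auto simp: four_subsets_def PiE_dflt_def)

lemma sample_subset: "Q \<in> four_subsets big_cliques \<Longrightarrow> sample Q \<subseteq> clique_vertices"
  using four_subsets_D by (fastforce simp: sample_def clique_vertices_def)

lemma sample_iff: "Q \<in> four_subsets big_cliques \<Longrightarrow> C \<in> big_cliques \<Longrightarrow> u \<in> C \<Longrightarrow> u \<in> sample Q \<longleftrightarrow> u \<in> Q C"
  using four_subsets_D big_cliques_disjoint unfolding sample_def by blast

lemma sample_transversals_D:
  assumes Q: "Q \<in> four_subsets big_cliques" and T: "T \<in> sample_transversals Q"
  shows "T \<subseteq> sample Q" "T \<subseteq> clique_vertices" "stable A T" "finite T"
proof -
  show 1: "T \<subseteq> sample Q" using T by (auto simp: sample_transversals_def transversal_def)
  then show 2: "T \<subseteq> clique_vertices" using sample_subset[OF Q] by blast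
  then show "finite T" by (rule finite_subset[OF subset_trans[OF _ clique_vertices_V] fV])
  have inj: "inj_on clique_of T" and st: "stable cross_adj T" using T by (auto simp: sample_transversals_def transversal_def)
  show "stable A T" unfolding stable_def
  proof (intro ballI notI)
    fix u v assume uv: "u \<in> T" "v \<in> T" "A u v"
    then have "u \<noteq> v" using adj_irrefl by auto
    then have "clique_of u \<noteq> clique_of v" using inj uv by (auto simp: inj_on_def)
    then show False using st uv by (auto simp: stable_def cross_adj_def)
  qed
qed

lemma finite_sample_transversals: "Q \<in> four_subsets big_cliques \<Longrightarrow> finite (sample_transversals Q)"
proof -
  assume Q: "Q \<in> four_subsets big_cliques"
  have "sample_transversals Q \<subseteq> Pow V" using sample_transversals_D(2)[OF Q] clique_vertices_V by blast
  then show ?thesis by (rule finite_subset) (simp add: fV)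
qed

text \<open>Classes of four vertices and degrees of at most two in \<open>cross_adj\<close>: this is
  \<open>fractional_transversal\<close> with 2 for its \<open>D\<close>.\<close>

lemma uniform_transversal:
  assumes Q: "Q \<in> four_subsets big_cliques"
  shows "\<exists>p. (\<forall>T. 0 \<le> p T) \<and> sum p (sample_transversals Q) = 1 \<and> (\<forall>u\<in>sample Q. cover (sample_transversals Q) p u = 1/4)"
proof -
  have fU: "finite (sample Q)" by (rule finite_subset[OF subset_trans[OF sample_subset[OF Q] clique_vertices_V] fV])
  have "\<exists>p. (\<forall>T. 0 \<le> p T) \<and> sum p {T. transversal cross_adj clique_of (sample Q) big_cliques T} = 1 \<and>
     (\<forall>u\<in>sample Q. cover {T. transversal cross_adj clique_of (sample Q) big_cliques T} p u = 1 / (2 * real 2))"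
  proof (rule fractional_transversal[OF finite_big_cliques fU])
    show "symp cross_adj" using adj_sym by (auto simp: symp_def cross_adj_def)
    show "irreflp cross_adj" by (auto simp: irreflp_def cross_adj_def)
    show "clique_of ` sample Q \<subseteq> big_cliques" using sample_subset[OF Q] clique_of_in by blast
    show "card {u\<in>sample Q. clique_of u = C} = 2 * 2" if C: "C \<in> big_cliques" for C
    proof -
      have "{u\<in>sample Q. clique_of u = C} = Q C"
      proof (intro equalityI subsetI)
        fix u assume u: "u \<in> {u\<in>sample Q. clique_of u = C}"
        then have "u \<in> C" using sample_subset[OF Q] clique_of_in by blast
        then show "u \<in> Q C" using u sample_iff[OF Q C] by blast
      next
        fix u assume u: "u \<in> Q C"
        then have "u \<in> C" using four_subsets_D[OF Q C] by blast
        then show "u \<in> {u\<in>sample Q. clique_of u = C}" using u sample_iff[OF Q C] clique_of_eq[OF C] by blast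
      qed
      then show ?thesis using four_subsets_D[OF Q C] by simp
    qed
    show "card (nbrs (sample Q) cross_adj u) \<le> 2" if u: "u \<in> sample Q" for u
    proof -
      have cu: "clique_of u \<in> big_cliques" "u \<in> clique_of u" using u sample_subset[OF Q] clique_of_in by blast+
      have "nbrs (sample Q) cross_adj u \<subseteq> nbrs V A u - clique_of u"
        using sample_subset[OF Q] clique_vertices_V clique_of_eq[OF cu(1)] by (auto simp: nbrs_def cross_adj_def)
      then have "card (nbrs (sample Q) cross_adj u) \<le> card (nbrs V A u - clique_of u)" using fV by (intro card_mono) auto
      then show ?thesis using outside_degree[OF cu] by simp
    qed
  qed simp
  then show ?thesis by (simp add: sample_transversals_def)
qed

definition closed_nbrs :: "'a \<Rightarrow> 'a set" where
  "closed_nbrs v = insert v (nbrs V A v)"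

definition clique_degree :: "'a \<Rightarrow> nat" where
  "clique_degree v = card (nbrs clique_vertices A v)"

text \<open>Take a sample, a transversal \<open>T\<close> of it, and a random maximal stable set of
  the vertices \<open>R T\<close> of \<open>U\<close> without neighbour in \<open>T\<close>. A
  clique vertex appears with probability 4/(D - 1) times 1/4. A vertex of \<open>U\<close> has a
  neighbour in \<open>T\<close> or is dominated by maximality, and it joins at least with the
  probability of lying in \<open>R T\<close> times the Caro-Wei factor.\<close>

lemma random_stable_set:
  assumes U: "U \<subseteq> V - clique_vertices"
  defines "\<S> \<equiv> {S. S \<subseteq> V \<and> stable A S}"
  shows "\<exists>p. (\<forall>S. 0 \<le> p S) \<and> sum p \<S> = 1 \<and> (\<forall>S\<in>\<S>. p S \<noteq> 0 \<longrightarrow> S \<inter> (V - clique_vertices) \<subseteq> U) \<and>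
    (\<forall>u\<in>clique_vertices. cover \<S> p u = 1 / (real D - 1)) \<and>
    (\<forall>v\<in>U. \<forall>S\<in>\<S>. p S \<noteq> 0 \<longrightarrow> S \<inter> closed_nbrs v \<noteq> {}) \<and>
    (\<forall>v\<in>U. p_val D (clique_degree v) \<le> cover \<S> p v)"
proof -
  have fS: "finite \<S>" using fV by (auto simp: \<S>_def)
  have fU: "finite U" by (rule finite_subset[OF U]) (simp add: fV)
  define \<Omega> where "\<Omega> = four_subsets big_cliques"
  define n where "n = D - 1"
  have n4: "4 \<le> n" and nD: "real n = real D - 1" using D6 by (auto simp: n_def)
  have CCn: "finite C \<and> card C = n" if "C \<in> big_cliques" for C using big_cliques_D[OF that] by (simp add: n_def)
  have fO: "finite \<Omega>" "\<Omega> \<noteq> {}" unfolding \<Omega>_def using four_subsets_fin[OF finite_big_cliques CCn n4] by auto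
  then have cO: "0 < real (card \<Omega>)" by (simp add: card_gt_0_iff)
  have "\<forall>Q\<in>\<Omega>. \<exists>p. (\<forall>T. 0 \<le> p T) \<and> sum p (sample_transversals Q) = 1 \<and> (\<forall>u\<in>sample Q. cover (sample_transversals Q) p u = 1/4)"
    using uniform_transversal by (auto simp: \<Omega>_def)
  then obtain pT where pT0: "\<And>Q T. Q \<in> \<Omega> \<Longrightarrow> 0 \<le> pT Q T" and pT1: "\<And>Q. Q \<in> \<Omega> \<Longrightarrow> sum (pT Q) (sample_transversals Q) = 1"
    and pTc: "\<And>Q u. Q \<in> \<Omega> \<Longrightarrow> u \<in> sample Q \<Longrightarrow> cover (sample_transversals Q) (pT Q) u = 1/4"
    unfolding bchoice_iff by metis
  define R where "R T = {v\<in>U. nbrs T A v = {}}" for T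
  have RU: "R T \<subseteq> U" for T by (auto simp: R_def)
  have fR: "finite (R T)" for T using finite_subset[OF RU fU] .
  obtain pS where pS0: "\<And>T S. 0 \<le> pS T S" and pSm: "\<And>T S. pS T S \<noteq> 0 \<Longrightarrow> maximal_stable (R T) A S"
    and pS1: "\<And>T. sum (pS T) (Pow (R T)) = 1"
    and pSc: "\<And>T v. v \<in> R T \<Longrightarrow> 1 / (real (card (nbrs (R T) A v)) + 1) \<le> cover (Pow (R T)) (pS T) v"
    using maximal_stable_distribution[OF fR sym irr] by metis
  \<comment> \<open>Choices of probability zero in the last stage are left out, so that every triple
    in \<open>X\<close> gives a stable set.\<close>
  define X where "X = (SIGMA Q:\<Omega>. SIGMA T:sample_transversals Q. {S\<in>Pow (R T). pS T S \<noteq> 0})"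
  define q where "q = (\<lambda>(Q, T, S). pT Q T * pS T S / card \<Omega>)"
  define f where "f = (\<lambda>(Q :: 'a set \<Rightarrow> 'a set, T, S). T \<union> S :: 'a set)"
  have fTQ': "finite (sample_transversals Q)" if "Q \<in> \<Omega>" for Q using finite_sample_transversals that by (simp add: \<Omega>_def)
  have fX: "finite X" unfolding X_def using fO fTQ' fR by (intro finite_SigmaI) auto
  have mem: "stable A (T \<union> S)" "T \<union> S \<subseteq> V" "T \<subseteq> clique_vertices" "S \<subseteq> R T" "maximal_stable (R T) A S"
    if z: "Q \<in> \<Omega>" "T \<in> sample_transversals Q" "S \<in> {S\<in>Pow (R T). pS T S \<noteq> 0}" for Q T S
  proof -
    note t = sample_transversals_D[OF z(1)[unfolded \<Omega>_def] z(2)]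
    show m: "maximal_stable (R T) A S" using z(3) pSm by blast
    show s: "S \<subseteq> R T" using z(3) by blast
    show "T \<subseteq> clique_vertices" by (rule t(2))
    have "stable A S" using m by (simp add: maximal_stable_def)
    moreover have "\<not> A a b \<and> \<not> A b a" if "a \<in> S" "b \<in> T" for a b
      using s that adj_sym unfolding R_def nbrs_def by blast
    ultimately show "stable A (T \<union> S)" using t(3) unfolding stable_def by blast
    show "T \<union> S \<subseteq> V" using t(2) clique_vertices_V s RU[of T] U by blast
  qed
  have im: "f ` X \<subseteq> \<S>"
  proof (rule image_subsetI)
    fix i assume i: "i \<in> X"
    obtain Q T S where z: "i = (Q, T, S)" by (cases i)
    then have "Q \<in> \<Omega>" "T \<in> sample_transversals Q" "S \<in> {S\<in>Pow (R T). pS T S \<noteq> 0}" using i by (simp_all add: X_def)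
    from mem(1,2)[OF this] show "f i \<in> \<S>" by (simp add: z f_def \<S>_def)
  qed
  have sumX: "(\<Sum>i\<in>X. q i * g (f i)) = (\<Sum>Q\<in>\<Omega>. \<Sum>T\<in>sample_transversals Q. pT Q T * (\<Sum>S\<in>Pow (R T). pS T S * g (T \<union> S))) / card \<Omega>"
    for g :: "'a set \<Rightarrow> real"
  proof -
    have "(\<Sum>i\<in>X. q i * g (f i)) = (\<Sum>Q\<in>\<Omega>. \<Sum>T\<in>sample_transversals Q. \<Sum>S\<in>{S\<in>Pow (R T). pS T S \<noteq> 0}. q (Q, T, S) * g (f (Q, T, S)))"
    proof -
      define Z where "Z T = {S\<in>Pow (R T). pS T S \<noteq> 0}" for T
      have fZ: "finite (Z T)" for T using fR by (simp add: Z_def)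
      have "(\<Sum>T\<in>sample_transversals Q. \<Sum>S\<in>Z T. q (Q, T, S) * g (f (Q, T, S))) = (\<Sum>TS\<in>Sigma (sample_transversals Q) Z. q (Q, TS) * g (f (Q, TS)))"
        if "Q \<in> \<Omega>" for Q
        using fTQ'[OF that] fZ by (subst sum.Sigma) (auto simp: case_prod_unfold)
      then have "(\<Sum>Q\<in>\<Omega>. \<Sum>T\<in>sample_transversals Q. \<Sum>S\<in>Z T. q (Q, T, S) * g (f (Q, T, S)))
        = (\<Sum>Q\<in>\<Omega>. \<Sum>TS\<in>Sigma (sample_transversals Q) Z. q (Q, TS) * g (f (Q, TS)))" by simp
      also have "\<dots> = (\<Sum>(Q, TS)\<in>(SIGMA Q:\<Omega>. Sigma (sample_transversals Q) Z). q (Q, TS) * g (f (Q, TS)))"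
        using fO(1) fTQ' fZ by (intro sum.Sigma) auto
      also have "\<dots> = (\<Sum>i\<in>X. q i * g (f i))" 
      proof -
        have "Z = (\<lambda>T. {S\<in>Pow (R T). pS T S \<noteq> 0})" by (simp add: Z_def fun_eq_iff)
        then have "X = (SIGMA Q:\<Omega>. Sigma (sample_transversals Q) Z)" by (simp only: X_def)
        then show ?thesis by (simp add: case_prod_unfold)
      qed
      finally show ?thesis by (simp add: Z_def)
    qed
    also have "\<dots> = (\<Sum>Q\<in>\<Omega>. \<Sum>T\<in>sample_transversals Q. pT Q T * (\<Sum>S\<in>Pow (R T). pS T S * g (T \<union> S)) / card \<Omega>)"
    proof (intro sum.cong refl)
      fix Q T
      have "(\<Sum>S\<in>{S\<in>Pow (R T). pS T S \<noteq> 0}. q (Q, T, S) * g (f (Q, T, S)))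
        = (\<Sum>S\<in>Pow (R T). q (Q, T, S) * g (f (Q, T, S)))"
        using fR by (intro sum.mono_neutral_left) (auto simp: q_def)
      also have "\<dots> = pT Q T * (\<Sum>S\<in>Pow (R T). pS T S * g (T \<union> S)) / card \<Omega>"
        by (simp add: q_def f_def sum_distrib_left sum_divide_distrib mult.assoc)
      finally show "(\<Sum>S\<in>{S\<in>Pow (R T). pS T S \<noteq> 0}. q (Q, T, S) * g (f (Q, T, S)))
        = pT Q T * (\<Sum>S\<in>Pow (R T). pS T S * g (T \<union> S)) / card \<Omega>" .
    qed
    finally show ?thesis by (simp add: sum_divide_distrib)
  qed
  define p where "p = push X f q"
  have "0 \<le> q i" if "i \<in> X" for i using that pT0 pS0 by (auto simp: X_def q_def)
  then have p0: "0 \<le> p S" for S unfolding p_def by (intro push_nonneg)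
  have psum: "(\<Sum>S\<in>\<S>. p S * g S) = (\<Sum>Q\<in>\<Omega>. \<Sum>T\<in>sample_transversals Q. pT Q T * (\<Sum>S\<in>Pow (R T). pS T S * g (T \<union> S))) / card \<Omega>" for g
    unfolding p_def sum_push[OF fX fS im] by (rule sumX)
  have supp: "\<exists>Q T S'. Q \<in> \<Omega> \<and> T \<in> sample_transversals Q \<and> S' \<in> {S\<in>Pow (R T). pS T S \<noteq> 0} \<and> S = T \<union> S'" if "p S \<noteq> 0" for S
    using push_nonzero[OF that[unfolded p_def]] by (auto simp: X_def f_def)
  have "sum p \<S> = 1" using psum[of "\<lambda>_. 1"] pS1 pT1 cO by simp
  moreover have "S \<inter> (V - clique_vertices) \<subseteq> U" if pS: "p S \<noteq> 0" for S
  proof -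
    obtain Q T S' where z: "Q \<in> \<Omega>" "T \<in> sample_transversals Q" "S' \<in> {S\<in>Pow (R T). pS T S \<noteq> 0}" "S = T \<union> S'"
      using supp[OF pS] by blast
    show ?thesis using mem(3,4)[OF z(1-3)] z(4) RU[of T] by blast
  qed
  moreover have "S \<inter> closed_nbrs v \<noteq> {}" if pS: "p S \<noteq> 0" and v: "v \<in> U" for S v
  proof -
    obtain Q T S' where z: "Q \<in> \<Omega>" "T \<in> sample_transversals Q" "S' \<in> {S\<in>Pow (R T). pS T S \<noteq> 0}" "S = T \<union> S'"
      using supp[OF pS] by blast
    note m = mem[OF z(1-3)]
    show ?thesis
    proof (cases "v \<in> R T")
      case True
      then have "v \<in> S' \<or> (\<exists>u\<in>S'. A v u)" using m(5) by (auto simp: maximal_stable_def)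
      then show ?thesis using z(4) m(2) unfolding closed_nbrs_def nbrs_def by blast
    next
      case False
      then obtain u where "u \<in> T" "A v u" using v unfolding R_def nbrs_def by blast
      then show ?thesis using z(4) m(2) unfolding closed_nbrs_def nbrs_def by blast
    qed
  qed
  moreover have "cover \<S> p u = 1 / (real D - 1)" if u: "u \<in> clique_vertices" for u
  proof -
    have val: "(\<Sum>T\<in>sample_transversals Q. pT Q T * (\<Sum>S\<in>Pow (R T). pS T S * (if u \<in> T \<union> S then 1 else 0))) = 1/4 * (if u \<in> Q (clique_of u) then 1 else 0)"
      if Q: "Q \<in> \<Omega>" for Q
    proof -
      have "(\<Sum>S\<in>Pow (R T). pS T S * (if u \<in> T \<union> S then 1 else 0)) = (if u \<in> T then 1 else 0)" for T
      proof -
        have "(\<Sum>S\<in>Pow (R T). pS T S * (if u \<in> T \<union> S then 1 else 0)) = (\<Sum>S\<in>Pow (R T). pS T S * (if u \<in> T then 1 else 0))"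
          using RU[of T] U u by (intro sum.cong) auto
        then show ?thesis using pS1 by (simp add: sum_distrib_right[symmetric])
      qed
      then have "(\<Sum>T\<in>sample_transversals Q. pT Q T * (\<Sum>S\<in>Pow (R T). pS T S * (if u \<in> T \<union> S then 1 else 0))) = cover (sample_transversals Q) (pT Q) u"
        by (simp add: cover_alt[OF fTQ'[OF Q]])
      also have "\<dots> = 1/4 * (if u \<in> Q (clique_of u) then 1 else 0)"
      proof (cases "u \<in> sample Q")
        case True
        then show ?thesis using pTc[OF Q True] sample_iff[of Q "clique_of u" u] clique_of_in[OF u] Q by (simp add: \<Omega>_def)
      next
        case False
        then have "{T\<in>sample_transversals Q. u \<in> T} = {}" using sample_transversals_D(1) Q by (auto simp: \<Omega>_def)
        then have "cover (sample_transversals Q) (pT Q) u = 0" unfolding cover_def by (simp only: sum.empty)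
        then show ?thesis using False sample_iff[of Q "clique_of u" u] clique_of_in[OF u] Q by (simp add: \<Omega>_def)
      qed
      finally show ?thesis .
    qed
    have "cover \<S> p u = (\<Sum>Q\<in>\<Omega>. 1/4 * (if u \<in> Q (clique_of u) then 1 else 0)) / card \<Omega>"
      unfolding cover_alt[OF fS] psum by (intro arg_cong2[where f = "(/)"] sum.cong refl val)
    also have "\<dots> = 1/4 * ((\<Sum>Q\<in>\<Omega>. if u \<in> Q (clique_of u) then 1 else 0) / card \<Omega>)"
      by (simp only: sum_distrib_left[symmetric] times_divide_eq_right)
    also have "(\<Sum>Q\<in>\<Omega>. if u \<in> Q (clique_of u) then 1 else 0) / card \<Omega> = 4 / real n"
      unfolding \<Omega>_def using clique_of_in[OF u] by (intro average_member[OF finite_big_cliques CCn n4]) auto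
    finally show ?thesis using nD by simp
  qed
  moreover have "p_val D (clique_degree v) \<le> cover \<S> p v" if v: "v \<in> U" for v
  proof -
    have vV: "v \<in> V" "v \<notin> clique_vertices" using v U by auto
    define J where "J = {C\<in>big_cliques. nbrs C A v \<noteq> {}}"
    \<comment> \<open>The only neighbour of \<open>v\<close> in \<open>C\<close>. Thus the clique
      neighbours of \<open>v\<close> correspond to the cliques in \<open>J\<close>, and whether they
      are sampled is decided independently.\<close>
    define a where "a C = (SOME u. u \<in> nbrs C A v)" for C
    have J: "J \<subseteq> big_cliques" by (auto simp: J_def)
    have fJ: "finite J" using finite_subset[OF J finite_big_cliques] .
    have a: "a C \<in> C" "A v (a C)" if "C \<in> J" for C
      using someI_ex[of "\<lambda>u. u \<in> nbrs C A v"] that unfolding J_def a_def nbrs_def by blast+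
    have a_uniq: "u = a C" if "C \<in> big_cliques" "u \<in> C" "A v u" for u C
    proof -
      have "C \<in> J" using that by (auto simp: J_def nbrs_def)
      moreover have "v \<in> V - C" using vV that(1) by (auto simp: clique_vertices_def)
      ultimately show ?thesis using nbrs_unique[OF that(1) _ that(2) a(1) that(3) a(2)] by blast
    qed
    have a_inj: "inj_on a J"
    proof (rule inj_onI)
      fix C C' assume "C \<in> J" "C' \<in> J" "a C = a C'"
      then show "C = C'" using big_cliques_disjoint[of C C' "a C"] a(1)[of C] a(1)[of C'] J by auto
    qed
    have "nbrs clique_vertices A v = a ` J"
    proof (intro equalityI subsetI)
      fix u assume u: "u \<in> nbrs clique_vertices A v"
      then obtain C where C: "C \<in> big_cliques" "u \<in> C" by (auto simp: nbrs_def clique_vertices_def)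
      have "A v u" using u by (simp add: nbrs_def)
      then have "C \<in> J" "u = a C" using C a_uniq[OF C] by (auto simp: J_def nbrs_def)
      then show "u \<in> a ` J" by blast
    next
      fix u assume "u \<in> a ` J"
      then show "u \<in> nbrs clique_vertices A v" using a J by (auto simp: nbrs_def clique_vertices_def)
    qed
    then have dJ: "clique_degree v = card J" unfolding clique_degree_def using a_inj by (simp add: card_image)
    have dD: "card (nbrs V A v - clique_vertices) + clique_degree v \<le> D"
    proof -
      have "nbrs V A v = (nbrs V A v - clique_vertices) \<union> nbrs clique_vertices A v" using clique_vertices_V by (auto simp: nbrs_def)
      then have "card (nbrs V A v) = card (nbrs V A v - clique_vertices) + clique_degree v"
        unfolding clique_degree_def using fV clique_vertices_V finite_subset[OF clique_vertices_V fV]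
        by (metis card_Un_disjoint Diff_disjoint finite_Diff finite_nbrs Int_commute inf.absorb_iff2 inf_assoc inf_bot_right nbrs_subset)
      then show ?thesis using deg[OF vV(1)] by simp
    qed
    define m where "m = (real D - real (clique_degree v)) + 1"
    have m0: "0 < m" using dD by (simp add: m_def)
    \<comment> \<open>Clique vertices are not in \<open>R T\<close>, so at most
      \<open>D - clique_degree v\<close> neighbours compete with \<open>v\<close> there.\<close>
    have inner: "(if nbrs T A v = {} then 1 else 0) / m \<le> (\<Sum>S\<in>Pow (R T). pS T S * (if v \<in> T \<union> S then 1 else 0))" for T
    proof (cases "nbrs T A v = {}")
      case True
      then have vR: "v \<in> R T" using v by (auto simp: R_def)
      have "nbrs (R T) A v \<subseteq> nbrs V A v - clique_vertices" using RU[of T] U by (auto simp: nbrs_def)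
      then have "card (nbrs (R T) A v) \<le> card (nbrs V A v - clique_vertices)" using fV by (intro card_mono) auto
      then have "real (card (nbrs (R T) A v)) + 1 \<le> m" using dD unfolding m_def by linarith
      then have "1 / m \<le> 1 / (real (card (nbrs (R T) A v)) + 1)" by (intro divide_left_mono) auto
      also have "\<dots> \<le> cover (Pow (R T)) (pS T) v" by (rule pSc[OF vR])
      also have "\<dots> \<le> (\<Sum>S\<in>Pow (R T). pS T S * (if v \<in> T \<union> S then 1 else 0))"
        unfolding cover_alt[OF finite_Pow_iff[THEN iffD2, OF fR]]
        using pS0 by (intro sum_mono mult_left_mono) auto
      finally show ?thesis using True by simp
    next
      case False
      then show ?thesis using pS0 by (auto intro: sum_nonneg)
    qed
    have mid: "survival (card {C\<in>J. a C \<in> Q C}) \<le> (\<Sum>T\<in>sample_transversals Q. pT Q T * (if nbrs T A v = {} then 1 else 0))" if Q: "Q \<in> \<Omega>" for Q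
    proof -
      define Y where "Y = a ` {C\<in>J. a C \<in> Q C}"
      have cY: "card Y = card {C\<in>J. a C \<in> Q C}" unfolding Y_def
        using a_inj by (intro card_image) (auto simp: inj_on_def)
      have fY: "finite Y" using fJ by (simp add: Y_def)
      have YU: "Y \<subseteq> sample Q" using J by (auto simp: Y_def sample_def)
      \<comment> \<open>Union bound for a fixed sample: \<open>v\<close> is lost only if a sampled
        neighbour is in \<open>T\<close>, and each of them is there with probability 1/4.\<close>
      have hit: "1 - (\<Sum>u\<in>Y. if u \<in> T then 1 else 0) \<le> (if nbrs T A v = {} then 1 else (0::real))" if T: "T \<in> sample_transversals Q" for T
      proof (cases "nbrs T A v = {}")
        case False
        then obtain u where u: "u \<in> T" "A v u" by (auto simp: nbrs_def)
        have uU: "u \<in> sample Q" using sample_transversals_D(1)[of Q T] Q T u by (auto simp: \<Omega>_def)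
        then obtain C where C: "C \<in> big_cliques" "u \<in> C" using sample_subset[of Q] Q by (auto simp: \<Omega>_def clique_vertices_def)
        have "u \<in> Q C" using sample_iff[of Q C u] Q C uU by (simp add: \<Omega>_def)
        moreover have "u = a C" "C \<in> J" using a_uniq[OF C u(2)] C u by (auto simp: J_def nbrs_def)
        ultimately have "u \<in> Y" by (auto simp: Y_def)
        then have "(if u \<in> T then 1 else 0) \<le> (\<Sum>u\<in>Y. if u \<in> T then 1 else (0::real))"
          using fY by (intro member_le_sum) auto
        then show ?thesis using False u by simp
      next
        case True
        have "0 \<le> (\<Sum>u\<in>Y. if u \<in> T then 1 else (0::real))" by (intro sum_nonneg) auto
        then show ?thesis using True by simp
      qed
      have "(\<Sum>T\<in>sample_transversals Q. pT Q T * (\<Sum>u\<in>Y. if u \<in> T then 1 else 0)) = (\<Sum>u\<in>Y. cover (sample_transversals Q) (pT Q) u)"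
        unfolding cover_alt[OF fTQ'[OF Q]] sum_distrib_left by (rule sum.swap)
      also have "\<dots> = (\<Sum>u\<in>Y. 1/4)" using YU pTc[OF Q] by (intro sum.cong) auto
      finally have Ysum: "(\<Sum>T\<in>sample_transversals Q. pT Q T * (\<Sum>u\<in>Y. if u \<in> T then 1 else 0)) = real (card Y) / 4" by simp
      have "1 - real (card Y) / 4 = (\<Sum>T\<in>sample_transversals Q. pT Q T * (1 - (\<Sum>u\<in>Y. if u \<in> T then 1 else 0)))"
        unfolding right_diff_distrib sum_subtractf Ysum using pT1[OF Q] by simp
      also have "\<dots> \<le> (\<Sum>T\<in>sample_transversals Q. pT Q T * (if nbrs T A v = {} then 1 else 0))"
        using hit pT0[OF Q] by (intro sum_mono mult_left_mono)
      finally have "1 - real (card Y) / 4 \<le> (\<Sum>T\<in>sample_transversals Q. pT Q T * (if nbrs T A v = {} then 1 else 0))" .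
      moreover have "0 \<le> (\<Sum>T\<in>sample_transversals Q. pT Q T * (if nbrs T A v = {} then 1 else 0))"
        using pT0[OF Q] by (intro sum_nonneg) auto
      ultimately show ?thesis using survival_le[of "card {C\<in>J. a C \<in> Q C}"] cY by auto
    qed
    have av: "(\<Sum>Q\<in>\<Omega>. survival (card {C\<in>J. a C \<in> Q C})) / card \<Omega>
      = (\<Sum>i=0..3. 1/4 * measure_pmf.prob (binomial_pmf (card J) (4 / real n)) {X. X \<le> i})"
      unfolding \<Omega>_def by (rule average_surv[OF finite_big_cliques CCn n4 J a(1)])
    have "p_val D (clique_degree v) = ((\<Sum>Q\<in>\<Omega>. survival (card {C\<in>J. a C \<in> Q C})) / card \<Omega>) / m"
      unfolding av p_val_def m_def dJ nD ..
    also have "\<dots> = (\<Sum>Q\<in>\<Omega>. survival (card {C\<in>J. a C \<in> Q C}) / m) / card \<Omega>"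
      by (simp add: sum_divide_distrib mult.commute)
    also have "\<dots> \<le> (\<Sum>Q\<in>\<Omega>. \<Sum>T\<in>sample_transversals Q. pT Q T * (\<Sum>S\<in>Pow (R T). pS T S * (if v \<in> T \<union> S then 1 else 0))) / card \<Omega>"
    proof (intro divide_right_mono sum_mono)
      fix Q assume Q: "Q \<in> \<Omega>"
      have "survival (card {C\<in>J. a C \<in> Q C}) / m \<le> (\<Sum>T\<in>sample_transversals Q. pT Q T * (if nbrs T A v = {} then 1 else 0)) / m"
        using mid[OF Q] m0 by (intro divide_right_mono) auto
      also have "\<dots> = (\<Sum>T\<in>sample_transversals Q. pT Q T * ((if nbrs T A v = {} then 1 else 0) / m))"
        by (simp add: sum_divide_distrib)
      also have "\<dots> \<le> (\<Sum>T\<in>sample_transversals Q. pT Q T * (\<Sum>S\<in>Pow (R T). pS T S * (if v \<in> T \<union> S then 1 else 0)))"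
        using inner pT0[OF Q] by (intro sum_mono mult_left_mono)
      finally show "survival (card {C\<in>J. a C \<in> Q C}) / m \<le> \<dots>" .
    qed simp
    also have "\<dots> = cover \<S> p v" unfolding cover_alt[OF fS] psum by simp
    finally show ?thesis .
  qed
  ultimately show ?thesis using p0 by (intro exI[of _ p]) blast
qed

end

section \<open>The bound\<close>

text \<open>The maxima and the minimum unpacked, with the \<open>ytilde_k\<close> constraints
  doubled to clear the halves. The bound 1/5 comes from k = D - 2: with t = y / (D + 1), and
  \<open>mu D\<close> and \<open>mu_k D 3\<close> at most 1 / (D + 1), the constraint gives 3t + 2
  \<open>mu\<close> y <= 1, while \<open>mu\<close> y <= t.\<close>

lemma ytilde_bounds:
  assumes D: "6 \<le> D"
  shows "0 \<le> ytilde D" and "ytilde D \<le> omega D"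
    and "ytilde D * (1 - 3 * mu D) \<le> omega D - 3"
    and "\<And>k. 1 \<le> k \<Longrightarrow> k \<le> D - 2 \<Longrightarrow>
      2 * ((1 + mu D) * ytilde D) \<le> (real D - 1 - real k)
        + (1 + real k * (if k \<le> 3 then mu D else mu_k D (D + 1 - k))) * ytilde D"
    and "ytilde D * mu D \<le> 1/5"
proof -
  have fin: "finite {(MIN k\<in>{1..D - 2}. ytilde_k D k), omega D, (omega D - 3) / (1 - 3 * mu D)}" by simp
  have m0: "0 \<le> mu D" "mu D \<le> 1 / (real D + 1)" using mu_k_bounds[OF D, of D] by (auto simp: mu_def)
  have "1 / (real D + 1) \<le> 1/7" using D by (simp add: field_simps)
  then have m7: "mu D \<le> 1/7" using m0 by linarith
  have yk0: "0 \<le> ytilde_k D k" if "1 \<le> k" "k \<le> D - 2" for k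
    by (rule ytilde_k_is_maximum(2)[OF D that]) (use that D in \<open>simp add: of_nat_diff\<close>)
  have yk: "ytilde D \<le> ytilde_k D k" if "1 \<le> k" "k \<le> D - 2" for k
  proof -
    have "ytilde D \<le> (MIN k\<in>{1..D - 2}. ytilde_k D k)" unfolding ytilde_def by (rule Min_le[OF fin]) simp
    also have "\<dots> \<le> ytilde_k D k" using that by (intro Min_le) auto
    finally show ?thesis .
  qed
  show yo: "ytilde D \<le> omega D" unfolding ytilde_def by (rule Min_le[OF fin]) simp
  have "ytilde D \<le> (omega D - 3) / (1 - 3 * mu D)" unfolding ytilde_def by (rule Min_le[OF fin]) simp
  then show "ytilde D * (1 - 3 * mu D) \<le> omega D - 3" using m7 by (simp add: pos_le_divide_eq)
  show y0: "0 \<le> ytilde D"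
  proof -
    have "0 \<le> (MIN k\<in>{1..D - 2}. ytilde_k D k)" using yk0 D by (subst Min_ge_iff) auto
    moreover have "0 \<le> (omega D - 3) / (1 - 3 * mu D)" using m7 D by (intro divide_nonneg_nonneg) auto
    moreover have "0 \<le> omega D" using D by simp
    ultimately show ?thesis unfolding ytilde_def by (subst Min_ge_iff[OF fin]) auto
  qed
  show con: "2 * ((1 + mu D) * ytilde D) \<le> (real D - 1 - real k)
        + (1 + real k * (if k \<le> 3 then mu D else mu_k D (D + 1 - k))) * ytilde D"
    if k: "1 \<le> k" "k \<le> D - 2" for k
  proof -
    define m where "m = (if k \<le> 3 then mu D else mu_k D (D + 1 - k))"
    define a where "a = 2 * (1 + mu D) - (1 + real k * m)"
    define b where "b = real D - 1 - real k"
    have b0: "0 \<le> b" using k D by (simp add: b_def)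
    have "a * ytilde_k D k \<le> b"
      using ytilde_k_is_maximum(1)[OF D k, folded m_def] unfolding a_def b_def by (simp add: field_simps)
    then have "a * ytilde D \<le> b"
    proof (cases "0 \<le> a")
      case True
      then have "a * ytilde D \<le> a * ytilde_k D k" using yk[OF k] by (intro mult_left_mono)
      then show ?thesis using \<open>a * ytilde_k D k \<le> b\<close> by simp
    next
      case False
      then have "a * ytilde D \<le> 0" using y0 by (intro mult_nonpos_nonneg) auto
      then show ?thesis using b0 by simp
    qed
    then have "2 * ((1 + mu D) * ytilde D) \<le> (real D - 1 - real k) + (1 + real k * m) * ytilde D"
      unfolding a_def b_def by (simp add: algebra_simps)
    then show ?thesis unfolding m_def .
  qed
  define y where "y = ytilde D"
  define t where "t = y / (real D + 1)"
  have yt: "y = t * (real D + 1)" by (simp add: t_def)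
  \<comment> \<open>D >= 6 puts k = D - 2 in the second case of \<open>ytilde_k\<close>, where the
    index D + 1 - k is 3.\<close>
  have k4: "\<not> D - 2 \<le> 3" and kk: "D + 1 - (D - 2) = 3" and rk: "real (D - 2) = real D - 2" using D by auto
  have m3: "0 \<le> mu_k D 3" "mu_k D 3 \<le> 1 / (real D + 1)" using mu_k_bounds[OF D, of 3] D by auto
  have "mu_k D 3 * y \<le> 1 / (real D + 1) * y" using m3 y0 by (intro mult_right_mono) (auto simp: y_def)
  then have "mu_k D 3 * y \<le> t" by (simp add: t_def)
  then have "(real D - 2) * (mu_k D 3 * y) \<le> (real D - 2) * t" using D by (intro mult_left_mono) auto
  moreover have "2 * ((1 + mu D) * y) \<le> 1 + (1 + (real D - 2) * mu_k D 3) * y"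
    using con[of "D - 2"] D k4 unfolding kk rk y_def by simp
  then have "2 * y + 2 * (mu D * y) \<le> 1 + y + (real D - 2) * (mu_k D 3 * y)" by (simp add: algebra_simps)
  moreover have "mu D * y \<le> 1 / (real D + 1) * y" using m0 y0 by (intro mult_right_mono) (auto simp: y_def)
  then have "mu D * y \<le> t" by (simp add: t_def)
  moreover have "y = real D * t + t" using yt by (simp add: algebra_simps)
  ultimately have "5 * (mu D * y) \<le> 1" by (simp add: algebra_simps)
  then show "ytilde D * mu D \<le> 1/5" by (simp add: y_def mult.commute)
qed

section \<open>Residual demands and the local Reed bound\<close>

context reduced_graph
begin

text \<open>A vertex of \<open>K\<close> outside \<open>C\<close> has \<open>a\<close> as its only
  neighbour in \<open>C\<close>, so the rest of \<open>K\<close> lies among the at most two outside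
  neighbours of \<open>a\<close>.\<close>

lemma clique_meeting_big_clique:
  assumes K: "K \<subseteq> V" "is_clique A K" and a: "a \<in> K" "a \<in> C" and C: "C \<in> big_cliques" and KC: "\<not> K \<subseteq> C"
  shows "card K \<le> 3"
proof -
  obtain x where x: "x \<in> K" "x \<notin> C" using KC by blast
  have "K \<inter> C = {a}"
  proof -
    have "b = a" if "b \<in> K \<inter> C" for b
    proof (rule nbrs_unique[OF C])
      have "x \<noteq> a" "x \<noteq> b" using x a that by auto
      then show "A x b" "A x a" using K(2) x(1) a(1) that by (simp_all add: is_clique_def)
      show "x \<in> V - C" using x K(1) by blast
    qed (use a that in auto)
    then show ?thesis using a by blast
  qed
  then have "K = insert a (K - C)" by blast
  then have "card K = card (insert a (K - C))" by (rule arg_cong)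
  moreover have "K - C \<subseteq> nbrs V A a - C"
  proof
    fix b assume b: "b \<in> K - C"
    then have "A a b" using K(2) a by (auto simp: is_clique_def)
    then show "b \<in> nbrs V A a - C" using b K(1) by (auto simp: nbrs_def)
  qed
  then have "card (K - C) \<le> card (nbrs V A a - C)" using fV by (intro card_mono) auto
  then have "card (K - C) \<le> 2" using outside_degree[OF C a(2)] by simp
  moreover have fKC: "finite (K - C)" using finite_subset[OF K(1) fV] by simp
  moreover have "card (insert a (K - C)) \<le> Suc (card (K - C))"
    unfolding card_insert_if[OF fKC] by (cases "a \<in> K - C") (simp_all only: if_True if_False le_SucI order_refl)
  ultimately show ?thesis by linarith
qed

text \<open>Time y goes to greedy saturation and the remaining D - y \<open>mu\<close> - y colours
  to \<open>weighted_local_reed\<close>. The latter asks only about vertices with positive demand,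
  so it is enough that \<open>h2\<close> and \<open>h3\<close> hold for unsaturated
  vertices.\<close>

lemma reduced_graph_colourable: "colourable V A (real D - ytilde D * mu D)"
proof -
  define y where "y = ytilde D"
  define m where "m = mu D"
  note yb = ytilde_bounds[OF D6, folded y_def m_def]
  have m0: "0 \<le> m" "m \<le> 1 / (real D + 1)" using mu_k_bounds[OF D6, of D] by (auto simp: mu_def m_def)
  have mk_m: "m \<le> mu_k D j" if "j \<le> D" for j
    unfolding m_def mu_def mu_k_def using that by (intro Min_antimono) auto
  have om: "0 < real D - 1" using D6 by simp
  define W where "W = V - clique_vertices"
  have fW: "finite W" using fV by (simp add: W_def)
  define \<S> where "\<S> = {S. S \<subseteq> V \<and> stable A S}"
  have fS: "finite \<S>" using fV by (auto simp: \<S>_def)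
  define h1 where "h1 u S = (if u \<in> S then 1 else 0) - 1 / (real D - 1)" for u :: 'a and S
  \<comment> \<open>Clique vertices are to be covered at the exact rate 1 / (D - 1), an equation
    encoded as two opposite inequalities. They take no part in saturation;
    \<open>ytilde D <= omega D\<close> keeps their cover at most 1.\<close>
  define H0 where "H0 = (\<Union>u\<in>clique_vertices. {h1 u, \<lambda>S. - h1 u S})"
  define h2 where "h2 v S = real (card (S \<inter> closed_nbrs v)) - 1" for v S
  define h3 where "h3 v S = (if v \<in> S then 1 else 0) - p_val D (clique_degree v)" for v S
  have sum_h1: "(\<Sum>S\<in>\<S>. w S * h1 u S) = cover \<S> w u - sum w \<S> / (real D - 1)" for w u
    unfolding h1_def right_diff_distrib sum_subtractf cover_alt[OF fS] by (simp add: sum_divide_distrib)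
  have sum_h3: "(\<Sum>S\<in>\<S>. w S * h3 v S) = cover \<S> w v - sum w \<S> * p_val D (clique_degree v)" for w v
    unfolding h3_def right_diff_distrib sum_subtractf cover_alt[OF fS] by (simp add: sum_distrib_right)
  have fN: "finite (closed_nbrs v)" for v using fV by (simp add: closed_nbrs_def)
  have sum_h2: "(\<Sum>S\<in>\<S>. w S * h2 v S) = (\<Sum>u\<in>closed_nbrs v. cover \<S> w u) - sum w \<S>" for w v
  proof -
    have "(\<Sum>S\<in>\<S>. w S * real (card (S \<inter> closed_nbrs v))) = (\<Sum>S\<in>\<S>. \<Sum>u\<in>closed_nbrs v. w S * (if u \<in> S then 1 else 0))"
      using fN by (intro sum.cong refl) (simp add: sum_distrib_left[symmetric] sum.If_cases Int_commute)
    also have "\<dots> = (\<Sum>u\<in>closed_nbrs v. cover \<S> w u)" unfolding cover_alt[OF fS] by (rule sum.swap)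
    finally show ?thesis unfolding h2_def right_diff_distrib sum_subtractf by simp
  qed
  have strat: "\<exists>p. (\<forall>S. 0 \<le> p S) \<and> sum p \<S> = 1 \<and> (\<forall>S\<in>\<S>. p S \<noteq> 0 \<longrightarrow> S \<inter> W \<subseteq> U) \<and>
      (\<forall>h\<in>H0. 0 \<le> (\<Sum>S\<in>\<S>. p S * h S)) \<and>
      (\<forall>v\<in>U. \<forall>h\<in>{h2 v, h3 v}. 0 \<le> (\<Sum>S\<in>\<S>. p S * h S))" if U: "U \<subseteq> W" for U
  proof -
    obtain p where p: "\<forall>S. 0 \<le> p S" "sum p \<S> = 1" "\<forall>S\<in>\<S>. p S \<noteq> 0 \<longrightarrow> S \<inter> W \<subseteq> U"
      "\<forall>u\<in>clique_vertices. cover \<S> p u = 1 / (real D - 1)" "\<forall>v\<in>U. \<forall>S\<in>\<S>. p S \<noteq> 0 \<longrightarrow> S \<inter> closed_nbrs v \<noteq> {}"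
      "\<forall>v\<in>U. p_val D (clique_degree v) \<le> cover \<S> p v"
      using random_stable_set[OF U[unfolded W_def], folded \<S>_def W_def] by (elim exE conjE) (rule that)
    have "0 \<le> (\<Sum>S\<in>\<S>. p S * h S)" if hH: "h \<in> H0" for h
    proof -
      obtain u where u: "u \<in> clique_vertices" "h = h1 u \<or> h = (\<lambda>S. - h1 u S)" using hH unfolding H0_def by blast
      have "(\<Sum>S\<in>\<S>. p S * h1 u S) = 0" unfolding sum_h1 using p(2,4) u by simp
      then show ?thesis using u(2) by (auto simp: sum_negf)
    qed
    moreover have "0 \<le> (\<Sum>S\<in>\<S>. p S * h2 v S)" if v: "v \<in> U" for v
    proof (rule sum_nonneg)
      fix S assume S: "S \<in> \<S>"
      show "0 \<le> p S * h2 v S"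
      proof (cases "p S = 0")
        case False
        then have "S \<inter> closed_nbrs v \<noteq> {}" using p(5) S v by blast
        moreover have "finite (S \<inter> closed_nbrs v)" using fN by simp
        ultimately have "1 \<le> card (S \<inter> closed_nbrs v)" by (simp add: Suc_le_eq card_gt_0_iff)
        then show ?thesis using p(1) by (simp add: h2_def)
      qed simp
    qed
    moreover have "0 \<le> (\<Sum>S\<in>\<S>. p S * h3 v S)" if v: "v \<in> U" for v
      unfolding sum_h3 using p(2,6) v by simp
    ultimately show ?thesis using p(1-3) by (intro exI[of _ p]) auto
  qed
  have "\<exists>w. (\<forall>S. 0 \<le> w S) \<and> sum w \<S> = y \<and> (\<forall>v\<in>W. cover \<S> w v \<le> 1) \<and>
      (\<forall>h\<in>H0. 0 \<le> (\<Sum>S\<in>\<S>. w S * h S)) \<and>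
      (\<forall>v\<in>W. cover \<S> w v < 1 \<longrightarrow> (\<forall>h\<in>{h2 v, h3 v}. 0 \<le> (\<Sum>S\<in>\<S>. w S * h S)))"
    by (rule greedy_saturation[OF fS fW strat yb(1)]) auto
  then obtain w where w0: "\<forall>S. 0 \<le> w S" and w1: "sum w \<S> = y" and wle: "\<forall>v\<in>W. cover \<S> w v \<le> 1"
    and wH0: "\<forall>h\<in>H0. 0 \<le> (\<Sum>S\<in>\<S>. w S * h S)"
    and wH: "\<forall>v\<in>W. cover \<S> w v < 1 \<longrightarrow> (\<forall>h\<in>{h2 v, h3 v}. 0 \<le> (\<Sum>S\<in>\<S>. w S * h S))"
    by (elim exE conjE) (rule that)
  define x where "x v = 1 - cover \<S> w v" for v
  have xW1: "x u = 1 - y / (real D - 1)" if u: "u \<in> clique_vertices" for u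
  proof -
    have in_H0: "h1 u \<in> H0" "(\<lambda>S. - h1 u S) \<in> H0" using u by (auto simp: H0_def)
    have "0 \<le> (\<Sum>S\<in>\<S>. w S * h1 u S)" "0 \<le> (\<Sum>S\<in>\<S>. w S * - h1 u S)"
      using bspec[OF wH0 in_H0(1)] bspec[OF wH0 in_H0(2)] by simp_all
    then have "(\<Sum>S\<in>\<S>. w S * h1 u S) = 0" by (simp add: sum_negf)
    then show ?thesis unfolding sum_h1 using w1 by (simp add: x_def)
  qed
  have yo: "y / (real D - 1) \<le> 1" using yb(2) om by (simp add: field_simps)
  have x0: "0 \<le> x v" if "v \<in> V" for v
    using wle xW1[of v] yo that by (cases "v \<in> clique_vertices") (auto simp: x_def W_def)
  have xp: "x v \<le> 1 - y * p_val D (clique_degree v) \<and> (\<Sum>u\<in>closed_nbrs v. x u) \<le> real D + 1 - y" if v: "v \<in> W" "0 < x v" for v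
  proof -
    have "cover \<S> w v < 1" using v by (simp add: x_def)
    then have "0 \<le> (\<Sum>S\<in>\<S>. w S * h3 v S)" "0 \<le> (\<Sum>S\<in>\<S>. w S * h2 v S)" using wH v by blast+
    then have "y * p_val D (clique_degree v) \<le> cover \<S> w v" "y \<le> (\<Sum>u\<in>closed_nbrs v. cover \<S> w u)"
      unfolding sum_h3 sum_h2 w1 by auto
    moreover have "real (card (closed_nbrs v)) \<le> real D + 1"
    proof -
      have "card (closed_nbrs v) \<le> Suc (card (nbrs V A v))" unfolding closed_nbrs_def using fV by (simp add: card_insert_if)
      then show ?thesis using deg[of v] v by (auto simp: W_def)
    qed
    ultimately show ?thesis by (simp add: x_def sum_subtractf)
  qed
  have d1D: "clique_degree v \<le> D" if "v \<in> V" for v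
  proof -
    have "nbrs clique_vertices A v \<subseteq> nbrs V A v" using clique_vertices_V by (auto simp: nbrs_def)
    then have "card (nbrs clique_vertices A v) \<le> card (nbrs V A v)" using fV by (intro card_mono) auto
    then show ?thesis using deg[OF that] by (simp add: clique_degree_def)
  qed
  have mk_p: "mu_k D j \<le> p_val D (clique_degree v)" if "clique_degree v \<le> j" for v j
    unfolding mu_k_def using that by (intro Min_le) auto
  have ymk: "y * mu_k D j \<le> y / (real D - 1)" if "j \<le> D" for j
  proof -
    have "mu_k D j \<le> 1 / (real D + 1)" using mu_k_bounds(2)[OF D6 that] .
    also have "\<dots> \<le> 1 / (real D - 1)" using om by (intro divide_left_mono) auto
    finally have "y * mu_k D j \<le> y * (1 / (real D - 1))" using yb(1) by (intro mult_left_mono)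
    then show ?thesis by simp
  qed
  have xk: "x v \<le> 1 - y * mu_k D j" if v: "v \<in> V" and j: "j \<le> D" "v \<in> clique_vertices \<or> clique_degree v \<le> j" for v j
  proof (cases "v \<in> clique_vertices")
    case True
    then show ?thesis using xW1 ymk[OF j(1)] by simp
  next
    case False
    then have vW: "v \<in> W" using v by (simp add: W_def)
    show ?thesis
    proof (cases "0 < x v")
      case True
      have "y * mu_k D j \<le> y * p_val D (clique_degree v)" using mk_p j False yb(1) by (intro mult_left_mono) auto
      then show ?thesis using xp[OF vW True] by simp
    next
      case xz: False
      then show ?thesis using ymk[OF j(1)] yo by simp
    qed
  qed
  have mD: "mu_k D D = m" by (simp add: m_def mu_def)
  have xm: "x v \<le> 1 - y * m" if "v \<in> V" for v
    using xk[OF that order_refl] d1D[OF that] mD by simp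
  have cc: "0 \<le> real D - y * m - y" using yb(2,5) D6 by simp
  have "\<exists>w'. weight_colouring V A (real D - y * m - y) w' \<and> (\<forall>v\<in>V. x v \<le> cover (Pow V) w' v)"
  proof (rule weighted_local_reed[OF fV sym irr x0 cc])
    fix v K assume v: "v \<in> V" "0 < x v" and K: "K \<subseteq> V" "v \<in> K" "is_clique A K"
    have fK: "finite K" using finite_subset[OF K(1) fV] .
    have sumK: "sum x K \<le> real (card K) * b" if "\<And>u. u \<in> K \<Longrightarrow> x u \<le> b" for b
      using sum_bounded_above[of K x b] that by simp
    show "sum x (insert v (nbrs V A v)) + sum x K \<le> 2 * (real D - y * m - y)"
    \<comment> \<open>For a vertex of a big clique \<open>C\<close> the budget is met exactly: its
      closed neighbourhood contributes at most (D - 1 - y) + 2(1 - y m), and the clique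
      \<open>K\<close> at most D - 1 - y.\<close>
    proof (cases "v \<in> clique_vertices")
      case True
      define C where "C = clique_of v"
      have C: "C \<in> big_cliques" "v \<in> C" using clique_of_in[OF True] by (auto simp: C_def)
      have CW: "C \<subseteq> clique_vertices" using C by (auto simp: clique_vertices_def)
      have cC: "real (card C) = real D - 1" using big_cliques_D(3)[OF C(1)] D6 by simp
      have "sum x C = (\<Sum>u\<in>C. 1 - y / (real D - 1))" using xW1 CW by (intro sum.cong) auto
      also have "\<dots> = (real D - 1) - y" using om cC by (simp add: right_diff_distrib)
      finally have xC: "sum x C = (real D - 1) - y" .
      have "insert v (nbrs V A v) = C \<union> (nbrs V A v - C)"
        using big_cliques_D(1,2)[OF C(1)] C(2) by (auto simp: nbrs_def is_clique_def)
      then have "sum x (insert v (nbrs V A v)) = sum x (C \<union> (nbrs V A v - C))" by (rule arg_cong)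
      also have "\<dots> = sum x C + sum x (nbrs V A v - C)"
        using big_cliques_D(4)[OF C(1)] fV by (intro sum.union_disjoint) auto
      finally have "sum x (insert v (nbrs V A v)) = sum x C + sum x (nbrs V A v - C)" .
      moreover have "sum x (nbrs V A v - C) \<le> 2 * (1 - y * m)"
      proof -
        have "sum x (nbrs V A v - C) \<le> real (card (nbrs V A v - C)) * (1 - y * m)"
          using xm by (intro order.trans[OF sum_bounded_above[of _ x "1 - y * m"]]) (auto simp: nbrs_def)
        also have "\<dots> \<le> 2 * (1 - y * m)"
          using outside_degree[OF C] yb(5) by (intro mult_right_mono) auto
        finally show ?thesis .
      qed
      moreover have "sum x K \<le> (real D - 1) - y"
      proof (cases "K \<subseteq> C")
        case True
        then have "sum x K \<le> sum x C" using big_cliques_D(1,4)[OF C(1)] x0 by (intro sum_mono2) auto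
        then show ?thesis using xC by simp
      next
        case False
        have "sum x K \<le> real (card K) * (1 - y * m)" using xm K by (intro sumK) auto
        also have "\<dots> \<le> 3 * (1 - y * m)"
          using clique_meeting_big_clique[OF K(1,3,2) C(2,1) False] yb(5) by (intro mult_right_mono) auto
        \<comment> \<open>Here the last term in the minimum defining \<open>ytilde\<close>
          enters.\<close>
        also have "\<dots> \<le> (real D - 1) - y" using yb(3) by (simp add: algebra_simps)
        finally show ?thesis .
      qed
      ultimately show ?thesis using xC by simp
    next
      case False
      then have vW: "v \<in> W" using v by (simp add: W_def)
      define k where "k = card K"
      \<comment> \<open>As \<open>v\<close> lies in no big clique, \<open>k\<close> falls into the
        range 1 to D - 2 over which \<open>ytilde\<close> takes the minimum.\<close>
      have "k \<noteq> D - 1"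
      proof
        assume "k = D - 1"
        then have "K \<in> big_cliques" using K by (auto simp: big_cliques_def k_def)
        then show False using K(2) False by (auto simp: clique_vertices_def)
      qed
      then have k: "1 \<le> k" "k \<le> D - 2"
        using clq[OF K(1,3)] fK K(2) by (auto simp: k_def Suc_le_eq card_gt_0_iff)
      \<comment> \<open>For k >= 4 the clique \<open>K\<close> contains no vertex of a big clique;
        its k - 1 edges at \<open>u\<close> leave at most D + 1 - k neighbours in big cliques, hence
        the sharper \<open>mu_k\<close>.\<close>
      define b where "b = (if k \<le> 3 then m else mu_k D (D + 1 - k))"
      have "x u \<le> 1 - y * b" if u: "u \<in> K" for u
      proof (cases "k \<le> 3")
        case True
        then show ?thesis using xm u K by (auto simp: b_def)
      next
        case k3: False
        have "u' \<notin> clique_vertices" if "u' \<in> K" for u'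
        proof
          assume "u' \<in> clique_vertices"
          then have c: "clique_of u' \<in> big_cliques" "u' \<in> clique_of u'" using clique_of_in by auto
          have "v \<notin> clique_of u'" using False c(1) by (auto simp: clique_vertices_def)
          then have "card K \<le> 3" using clique_meeting_big_clique[OF K(1,3) that c(2,1)] K(2) by blast
          then show False using k3 by (simp add: k_def)
        qed
        then have disj: "K \<inter> clique_vertices = {}" by blast
        have "nbrs clique_vertices A u \<subseteq> nbrs V A u" using clique_vertices_V by (auto simp: nbrs_def)
        moreover have "K - {u} \<subseteq> nbrs V A u" using K(1,3) u by (auto simp: nbrs_def is_clique_def)
        moreover have "nbrs clique_vertices A u \<subseteq> clique_vertices" by (rule nbrs_subset)
        ultimately have sub: "nbrs clique_vertices A u \<union> (K - {u}) \<subseteq> nbrs V A u" "nbrs clique_vertices A u \<inter> (K - {u}) = {}"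
          using disj by blast+
        have "card (nbrs clique_vertices A u) + card (K - {u}) = card (nbrs clique_vertices A u \<union> (K - {u}))"
          using finite_subset[OF clique_vertices_V fV] fK sub(2) by (intro card_Un_disjoint[symmetric]) auto
        also have "\<dots> \<le> card (nbrs V A u)" using sub(1) fV by (intro card_mono) auto
        also have "\<dots> \<le> D" using u K by (intro deg) auto
        finally have "clique_degree u \<le> D + 1 - k" using u fK k(1) by (simp add: clique_degree_def k_def)
        then show ?thesis using xk[of u "D + 1 - k"] u K k(1) k3 by (auto simp: b_def)
      qed
      then have "sum x K \<le> real k * (1 - y * b)" unfolding k_def by (rule sumK)
      moreover have "(\<Sum>u\<in>closed_nbrs v. x u) \<le> real D + 1 - y" using xp[OF vW v(2)] by simp
      moreover have "2 * ((1 + m) * y) \<le> (real D - 1 - real k) + (1 + real k * b) * y"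
        using yb(4)[OF k] by (simp add: b_def)
      ultimately show ?thesis by (simp add: closed_nbrs_def algebra_simps)
    qed
  qed
  then obtain w' where w': "weight_colouring V A (real D - y * m - y) w'" "\<forall>v\<in>V. x v \<le> cover (Pow V) w' v" by blast
  define w2 where "w2 S = 1 * (if S \<in> \<S> then w S else 0) + 1 * w' S" for S
  have SP: "\<S> \<subseteq> Pow V" by (auto simp: \<S>_def)
  have cov: "cover (Pow V) w2 v = cover \<S> w v + cover (Pow V) w' v" for v
  proof -
    have "cover (Pow V) (\<lambda>S. if S \<in> \<S> then w S else 0) v = cover \<S> w v"
      unfolding cover_def using fV SP by (intro sum.mono_neutral_cong_right) auto
    then show ?thesis unfolding w2_def cover_add by simp
  qed
  have "sum w2 (Pow V) = sum w \<S> + sum w' (Pow V)"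
  proof -
    have "(\<Sum>S\<in>Pow V. if S \<in> \<S> then w S else 0) = sum w \<S>"
      using fV SP by (intro sum.mono_neutral_cong_right) auto
    then show ?thesis by (simp add: w2_def sum.distrib)
  qed
  then have "sum w2 (Pow V) = real D - y * m" using w1 w'(1) by (simp add: weight_colouring_def)
  moreover have "S \<subseteq> V \<and> stable A S" if "w2 S \<noteq> 0" for S
  proof (cases "S \<in> \<S>")
    case False
    then have "w' S \<noteq> 0" using that by (simp add: w2_def)
    then show ?thesis using w'(1) unfolding weight_colouring_def by blast
  qed (simp add: \<S>_def)
  moreover have "0 \<le> w2 S" for S using w0 w'(1) by (simp add: w2_def weight_colouring_def)
  ultimately have "weight_colouring V A (real D - y * m) w2" by (auto simp: weight_colouring_def)
  moreover have "1 \<le> cover (Pow V) w2 v" if "v \<in> V" for v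
    unfolding cov using w'(2) that by (auto simp: x_def)
  ultimately show ?thesis unfolding colourable_def y_def m_def by blast
qed

end

text \<open>Strong induction on the number of vertices. Upper bounds on degrees and cliques, in
  place of an exact maximum degree, let the smaller graphs of the reductions qualify with the same
  \<open>D\<close> and the same saving.\<close>

lemma colourable_bound:
  fixes V :: "'a set"
  assumes D6: "6 \<le> D" and "finite V" "symp A" "irreflp A"
    and "\<And>v. v \<in> V \<Longrightarrow> card (nbrs V A v) \<le> D"
    and "\<And>K. K \<subseteq> V \<Longrightarrow> is_clique A K \<Longrightarrow> card K < D"
  shows "colourable V A (real D - ytilde D * mu D)"
  using assms(2-)
proof (induction "card V" arbitrary: V A rule: less_induct)
  case (less V A)
  note yb = ytilde_bounds[OF D6]
  have m0: "0 \<le> mu D" using mu_k_bounds[OF D6, of D] by (simp add: mu_def)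
  interpret induction_step V A D "ytilde D * mu D"
  proof unfold_locales
    show "0 \<le> ytilde D * mu D" using yb(1) m0 by simp
    show "colourable V' A' (real D - ytilde D * mu D)"
      if "card V' < card V" "finite V'" "symp A'" "irreflp A'" "\<And>v. v \<in> V' \<Longrightarrow> card (nbrs V' A' v) \<le> D"
        "\<And>K. K \<subseteq> V' \<Longrightarrow> is_clique A' K \<Longrightarrow> card K < D" for V' :: "'a set" and A'
      by (rule less.hyps[OF that])
  qed (use less.prems D6 yb(5) in auto)
  show ?case
  proof (cases "\<exists>C x. big_clique C \<and> x \<in> V - C \<and> 2 \<le> card (nbrs C A x)")
    case True
    then show ?thesis using reducible by blast
  next
    case False
    interpret reduced_graph V A D
    proof unfold_locales
      fix C x assume "C \<subseteq> V" "is_clique A C" "card C = D - 1" "x \<in> V - C"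
      then have "big_clique C" "x \<in> V - C" by (auto simp: big_clique_def)
      then have "\<not> 2 \<le> card (nbrs C A x)" using False by blast
      then show "card (nbrs C A x) \<le> 1" by simp
    qed (use less.prems D6 in auto)
    show ?thesis by (rule reduced_graph_colourable)
  qed
qed

theorem theorem7:
  fixes V :: "'a set" and E :: "'a set set" and \<Delta> :: nat
  assumes "\<Delta> \<ge> 6"
    and "simple_graph V E"
    and "max_degree V E = \<Delta>"
    and "clique_number V E \<le> \<Delta> - 1"
  shows "fractional_chromatic_number V E \<le> real \<Delta> - min (1/2) (ytilde \<Delta> * mu \<Delta>)"
proof -
  have fV: "finite V" and E: "E \<subseteq> [V]\<^bsup>2\<^esup>" using assms(2) by (auto simp: simple_graph_def)
  define A where "A u v \<longleftrightarrow> {u, v} \<in> E" for u v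
  have AV: "u \<in> V \<and> v \<in> V \<and> u \<noteq> v" if "A u v" for u v
    using subsetD[OF E that[unfolded A_def]] by (simp add: doubleton_in_nsets_2)
  have sym: "symp A" by (auto simp: symp_def A_def insert_commute)
  have irr: "irreflp A" using AV by (auto simp: irreflp_def)
  have "colourable V A (real \<Delta> - ytilde \<Delta> * mu \<Delta>)"
  proof (rule colourable_bound[OF assms(1) fV sym irr])
    show "card (nbrs V A v) \<le> \<Delta>" if v: "v \<in> V" for v
    proof -
      have "{u. {v, u} \<in> E} = nbrs V A v" using AV by (auto simp: nbrs_def A_def)
      then have "card (nbrs V A v) = vertex_degree E v" by (simp add: vertex_degree_def)
      also have "\<dots> \<le> max_degree V E" unfolding max_degree_def using fV v by (intro Max_ge) auto
      finally show ?thesis using assms(3) by simp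
    qed
    show "card K < \<Delta>" if K: "K \<subseteq> V" "is_clique A K" for K
    proof -
      have "clique K E" using K(2) by (auto simp: clique_def is_clique_def A_def)
      then have "card K \<in> card ` {K. K \<subseteq> V \<and> clique K E}" using K(1) by blast
      then have "card K \<le> clique_number V E" unfolding clique_number_def using fV by (intro Max_ge) auto
      then show ?thesis using assms(1,4) by simp
    qed
  qed
  then obtain w where w: "weight_colouring V A (real \<Delta> - ytilde \<Delta> * mu \<Delta>) w" "\<forall>v\<in>V. 1 \<le> cover (Pow V) w v"
    by (auto simp: colourable_def)
  have st: "stable_sets V E = {S. S \<subseteq> V \<and> stable A S}"
  proof -
    have "indep S E \<longleftrightarrow> stable A S" for S
    proof
      assume i: "indep S E"
      show "stable A S" unfolding stable_def
      proof (intro ballI notI)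
        fix u v assume "u \<in> S" "v \<in> S" "A u v"
        then show False using i AV[of u v] by (auto simp: indep_def A_def)
      qed
    qed (auto simp: indep_def stable_def A_def)
    then show ?thesis by (simp add: stable_sets_def)
  qed
  have stP: "stable_sets V E \<subseteq> Pow V" by (auto simp: stable_sets_def)
  have w0: "0 \<le> w S" and wst: "w S \<noteq> 0 \<Longrightarrow> S \<in> stable_sets V E" for S
    using w(1) unfolding st by (auto simp: weight_colouring_def)
  have "fractional_colouring V E w" unfolding fractional_colouring_def
  proof (intro conjI ballI)
    fix v assume v: "v \<in> V"
    have eq: "cover (Pow V) w v = (\<Sum>S\<in>{S \<in> stable_sets V E. v \<in> S}. w S)"
      unfolding cover_def using fV stP wst by (intro sum.mono_neutral_right) auto
    show "1 \<le> (\<Sum>S\<in>{S \<in> stable_sets V E. v \<in> S}. w S)"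
      unfolding eq[symmetric] using w(2) v by blast
  qed (rule w0)
  moreover have "total_weight V E w = real \<Delta> - ytilde \<Delta> * mu \<Delta>"
  proof -
    have "total_weight V E w = sum w (Pow V)"
      unfolding total_weight_def using fV stP wst by (intro sum.mono_neutral_left) auto
    then show ?thesis using w(1) by (simp add: weight_colouring_def)
  qed
  moreover have "fractional_chromatic_number V E \<le> total_weight V E w" if "fractional_colouring V E w"
    unfolding fractional_chromatic_number_def
  proof (rule cInf_lower)
    show "bdd_below (total_weight V E ` {w. fractional_colouring V E w})"
      by (rule bdd_belowI[of _ 0]) (auto simp: total_weight_def fractional_colouring_def intro!: sum_nonneg)
  qed (use that in blast)
  ultimately show ?thesis by linarith
qed

end
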